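(* Let $X$ be a locally Lipschitz vector field on an open set $\Omega\subset\mathbb{R}^n$. If the function $f\in L^1_{\rm loc}(\Omega)$ admits an upper gradient $h\in L^1_{\rm loc}(\Omega)$ along the vector field $X$, then it also admits the distributional derivative $Xf\in L^1_{\rm loc}(\Omega)$ with respect to $X$, and $$|Xf|\le h$$ almost everywhere on $\Omega$.
   Context: A vector field on $\Omega$ is a map $X=(a_1,\dots,a_n):\Omega\to\mathbb{R}^n$. If $X$ is locally Lipschitz, for $x\in\Omega$ let $t\mapsto\gamma^X_t(x)\in\Omega$, $t\in\Gamma^X_x$ (an open interval containing $0$), be the unique maximal solution of $\dot\gamma(t)=X(\gamma(t))$, $\gamma(0)=x$. Put $\Gamma^X=\bigcup_{x\in\Omega}\Gamma^X_x\times\{x\}$, an open subset of $\mathbb{R}\times\Omega$, and $\Gamma^X_+=\{(t,x)\in\Gamma^X: t>0\}$. "Almost all $(t,x)\in\Gamma^X_+$" refers to Lebesgue measure in $\mathbb{R}^{n+1}$. Upper gradient: a nonnegative function $h\in L^1_{\rm loc}(\Omega)$ is an upper gradient for $f\in L^1_{\rm loc}(\Omega)$ along $X$ if $|f(\gamma^X_t(x))-f(x)|\le\int_0^th(\gamma^X_s(x))\,ds$ for almost all $(t,x)\in\Gamma^X_+$. Distributional derivative: $g\in L^1_{\rm loc}(\Omega)$ is the distributional derivative of $f\in L^1_{\rm loc}(\Omega)$ with respect to $X$, written $g=Xf$, if for each $u\in C_0^\infty(\Omega)$ $$\int_\Omega g\,u\,dx=-\int_\Omega f\,Xu\,dx-\int_\Omega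 f\,u\,\operatorname{div}X\,dx,$$ where $Xu=\sum_i a_i\,\partial u/\partial x_i$ and $\operatorname{div}X=\sum_i\partial a_i/\partial x_i$ (defined a.e. and locally bounded by Rademacher's theorem). *)

theory Defs
  imports "HOL-Analysis.Analysis"
begin

text \<open>
  Functions on an open set \<open>\<Omega>\<close> are total functions whose values outside \<open>\<Omega>\<close> are irrelevant.
  \<open>local_lipschitz\<close> is about time-dependent fields; an autonomous field is constant in time.
\<close>

definition locally_lipschitz_field :: "(real^'n) set \<Rightarrow> (real^'n \<Rightarrow> real^'n) \<Rightarrow> bool" where
  "locally_lipschitz_field \<Omega> X \<longleftrightarrow> local_lipschitz (UNIV :: real set) \<Omega> (\<lambda>_. X)"

definition L1_loc :: "(real^'n) set \<Rightarrow> (real^'n \<Rightarrow> real) \<Rightarrow> bool" where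
  "L1_loc \<Omega> f \<longleftrightarrow> (\<forall>K. compact K \<and> K \<subseteq> \<Omega> \<longrightarrow> set_integrable lebesgue K f)"


subsection \<open>The flow of a vector field\<close>

definition integral_curve ::
    "(real^'n) set \<Rightarrow> (real^'n \<Rightarrow> real^'n) \<Rightarrow> real^'n \<Rightarrow> real set \<Rightarrow> (real \<Rightarrow> real^'n) \<Rightarrow> bool" where
  "integral_curve \<Omega> X x I \<gamma> \<longleftrightarrow>
     open I \<and> is_interval I \<and> 0 \<in> I \<and> \<gamma> 0 = x \<and>
     (\<forall>t\<in>I. \<gamma> t \<in> \<Omega> \<and> (\<gamma> has_vector_derivative X (\<gamma> t)) (at t))"

definition maximal_integral_curve ::
    "(real^'n) set \<Rightarrow> (real^'n \<Rightarrow> real^'n) \<Rightarrow> real^'n \<Rightarrow> real set \<Rightarrow> (real \<Rightarrow> real^'n) \<Rightarrow> bool" where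
  "maximal_integral_curve \<Omega> X x I \<gamma> \<longleftrightarrow>
     integral_curve \<Omega> X x I \<gamma> \<and>
     (\<forall>J \<delta>. integral_curve \<Omega> X x J \<delta> \<and> I \<subseteq> J \<and> (\<forall>t\<in>I. \<delta> t = \<gamma> t) \<longrightarrow> J = I)"

text \<open>
  For a locally Lipschitz field on an open \<open>\<Omega>\<close> and \<open>x \<in> \<Omega>\<close>, the maximal integral curve is unique
  as a map on its interval, so the following descriptions are proper for \<open>x \<in> \<Omega>\<close> and
  \<open>t \<in> flow_interval \<Omega> X x\<close>. They correspond to \<open>\<Gamma>\<^sup>X\<^sub>x\<close> and \<open>\<gamma>\<^sup>X\<^sub>t(x)\<close>.
\<close>

definition flow_interval :: "(real^'n) set \<Rightarrow> (real^'n \<Rightarrow> real^'n) \<Rightarrow> real^'n \<Rightarrow> real set" where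
  "flow_interval \<Omega> X x = (THE I. \<exists>\<gamma>. maximal_integral_curve \<Omega> X x I \<gamma>)"

definition flow :: "(real^'n) set \<Rightarrow> (real^'n \<Rightarrow> real^'n) \<Rightarrow> real \<Rightarrow> real^'n \<Rightarrow> real^'n" where
  "flow \<Omega> X t x = (THE y. \<exists>I \<gamma>. maximal_integral_curve \<Omega> X x I \<gamma> \<and> t \<in> I \<and> \<gamma> t = y)"

definition flow_domain_pos :: "(real^'n) set \<Rightarrow> (real^'n \<Rightarrow> real^'n) \<Rightarrow> (real \<times> (real^'n)) set" where
  "flow_domain_pos \<Omega> X = {(t, x). x \<in> \<Omega> \<and> t \<in> flow_interval \<Omega> X x \<and> 0 < t}"


subsection \<open>Upper gradients\<close>

text \<open>
  The integral of the nonnegative function \<open>s \<mapsto> h (\<gamma>\<^sub>s(x))\<close> is taken in \<open>[0, \<infinity>]\<close>.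
\<close>

definition upper_gradient ::
    "(real^'n) set \<Rightarrow> (real^'n \<Rightarrow> real^'n) \<Rightarrow> (real^'n \<Rightarrow> real) \<Rightarrow> (real^'n \<Rightarrow> real) \<Rightarrow> bool" where
  "upper_gradient \<Omega> X f h \<longleftrightarrow>
     L1_loc \<Omega> f \<and> L1_loc \<Omega> h \<and> (\<forall>x\<in>\<Omega>. 0 \<le> h x) \<and>
     (AE (t, x) in lebesgue. (t, x) \<in> flow_domain_pos \<Omega> X \<longrightarrow>
        ennreal \<bar>f (flow \<Omega> X t x) - f x\<bar> \<le> (\<integral>\<^sup>+ s\<in>{0..t}. ennreal (h (flow \<Omega> X s x)) \<partial>lebesgue))"


subsection \<open>Distributional derivatives along a vector field\<close>

text \<open>
  Since \<^const>\<open>deriv\<close> is a Hilbert choice, the value at a point where the partial derivative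
  does not exist is a fixed but unspecified real.
\<close>

definition partial_deriv :: "'n \<Rightarrow> (real^'n \<Rightarrow> real) \<Rightarrow> real^'n \<Rightarrow> real" where
  "partial_deriv i u x = deriv (\<lambda>s. u (x + s *\<^sub>R axis i 1)) 0"

primrec C_k :: "nat \<Rightarrow> (real^'n \<Rightarrow> real) \<Rightarrow> bool" where
  "C_k 0 u \<longleftrightarrow> continuous_on UNIV u"
| "C_k (Suc k) u \<longleftrightarrow> (\<forall>x. u differentiable (at x)) \<and> (\<forall>i. C_k k (partial_deriv i u))"

text \<open>
  Elements of \<open>C\<^sub>0\<^sup>\<infinity>(\<Omega>)\<close> are extended by zero to the whole space.
\<close>

definition test_function :: "(real^'n) set \<Rightarrow> (real^'n \<Rightarrow> real) \<Rightarrow> bool" where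
  "test_function \<Omega> u \<longleftrightarrow>
     (\<forall>k. C_k k u) \<and> compact (closure {x. u x \<noteq> 0}) \<and> closure {x. u x \<noteq> 0} \<subseteq> \<Omega>"

definition lie_deriv :: "(real^'n \<Rightarrow> real^'n) \<Rightarrow> (real^'n \<Rightarrow> real) \<Rightarrow> real^'n \<Rightarrow> real" where
  "lie_deriv X u x = (\<Sum>i\<in>UNIV. X x $ i * partial_deriv i u x)"

definition divergence :: "(real^'n \<Rightarrow> real^'n) \<Rightarrow> real^'n \<Rightarrow> real" where
  "divergence X x = (\<Sum>i\<in>UNIV. partial_deriv i (\<lambda>y. X y $ i) x)"

definition distributional_deriv ::
    "(real^'n) set \<Rightarrow> (real^'n \<Rightarrow> real^'n) \<Rightarrow> (real^'n \<Rightarrow> real) \<Rightarrow> (real^'n \<Rightarrow> real) \<Rightarrow> bool" where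
  "distributional_deriv \<Omega> X f g \<longleftrightarrow>
     L1_loc \<Omega> f \<and> L1_loc \<Omega> g \<and>
     (\<forall>u. test_function \<Omega> u \<longrightarrow>
        (LINT x:\<Omega>|lebesgue. g x * u x) =
          - (LINT x:\<Omega>|lebesgue. f x * lie_deriv X u x)
          - (LINT x:\<Omega>|lebesgue. f x * u x * divergence X x))"

end

theory Submission
  imports Defs
begin

text \<open>
  For a compact \<open>K \<subseteq> \<Omega>\<close> and small \<open>t > 0\<close> the quotients \<open>q\<^sub>t(x) = (f(\<gamma>\<^sub>t(x)) - f(x)) / t\<close> satisfy, on \<open>K\<close>,
  \<open>\<bar>q\<^sub>t\<bar> \<le> t\<^sup>-\<^sup>1 \<integral>\<^sub>0\<^sup>t h(\<gamma>\<^sub>s(x)) ds\<close>, and the right-hand side tends to \<open>h\<close> in \<open>L\<^sup>1(K)\<close>. Hence truncating \<open>q\<^sub>t\<close>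
  to values in \<open>[-h, h]\<close> changes it by \<open>o(1)\<close> in \<open>L\<^sup>1(K)\<close>, and suitable convex combinations of the
  truncations converge almost everywhere to some \<open>g\<close> with \<open>\<bar>g\<bar> \<le> h\<close>. It remains to see that
  \<open>\<integral> q\<^sub>t u dx\<close> tends to \<open>- \<integral> f (Xu + u div X) dx\<close> for every test function \<open>u\<close>. The flow distorts the
  maximum norm, and therefore Lebesgue measure, only by a factor \<open>1 + O(t)\<close>, so
  \<open>\<bar>\<integral> q\<^sub>t u dx\<bar> \<le> C \<integral> \<bar>f\<bar> dx\<close> with \<open>C\<close> independent of \<open>t\<close> and \<open>f\<close>, and by density it suffices to treat
  polynomials \<open>f\<close>. There the limit is \<open>\<integral> u Xf dx\<close>, and one integrates by parts; this only needs
  the almost everywhere differentiability of Lipschitz functions along lines, not Rademacher's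
  theorem or a Jacobian of the flow.
\<close>

section \<open>Directional derivatives of Lipschitz functions\<close>

text \<open>Two obstacles shape the argument. The upper gradient inequality holds only for almost
  all \<open>(t, x)\<close>, so a particular time may be bad; times are chosen outside exceptional
  null sets, and \<open>f\<close> and \<open>h\<close> are replaced by Borel representatives, which
  may be composed with the flow because its maps pull null sets back to null sets. Moreover, the
  quotients are controlled in L^1 only, where boundedness gives no weak compactness; truncation at
  the fixed function \<open>h\<close> supplies domination, and after division by \<open>h\<close>
  the functions take values in [-1, 1] on a finite measure space. The field is only locally
  Lipschitz, so near each compact set it is replaced by a bounded global Lipschitz field. That field
  depends on the compact set, but the quotients are those of the true flow; a single sequence of
  times, chosen diagonally along an exhaustion of \<Omega>, then yields one function
  \<open>g\<close>. Polynomials serve as the dense class because for them the chain rule gives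
  pointwise convergence of the quotients.\<close>

definition slope_above :: "('a::real_normed_vector \<Rightarrow> real) \<Rightarrow> 'a \<Rightarrow> real \<Rightarrow> 'a set" where
  "slope_above f e q = {x. \<forall>d>0. \<exists>h. h \<noteq> 0 \<and> \<bar>h\<bar> < d \<and> q < (f (x + h *\<^sub>R e) - f x) / h}"

definition slope_below :: "('a::real_normed_vector \<Rightarrow> real) \<Rightarrow> 'a \<Rightarrow> real \<Rightarrow> 'a set" where
  "slope_below f e p = {x. \<forall>d>0. \<exists>h. h \<noteq> 0 \<and> \<bar>h\<bar> < d \<and> (f (x + h *\<^sub>R e) - f x) / h < p}"

lemma slope_below_eq_above: "slope_below f e p = slope_above (\<lambda>x. - f x) e (- p)"
proof -
  have "(- f (x + h *\<^sub>R e) - - f x) / h = - ((f (x + h *\<^sub>R e) - f x) / h)" for x h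
    by (simp add: diff_divide_distrib)
  then show ?thesis by (simp only: slope_below_def slope_above_def neg_less_iff_less)
qed

text \<open>No upper limit occurs in \<open>slope_above\<close>: with a strict inequality and an
  existentially quantified increment, the condition for each \<open>d\<close> defines a union of
  open sets, which is open however many increments there are. Only d = 1/(n+1) has to be considered,
  so the set is a countable intersection of open sets.\<close>

lemma slope_above_borel:
  fixes f :: "'a::euclidean_space \<Rightarrow> real"
  assumes "continuous_on UNIV f"
  shows "slope_above f e q \<in> sets borel"
proof -
  have "open {x. q < (f (x + h *\<^sub>R e) - f x) / h}" if "h \<noteq> 0" for h
    using that
    by (intro open_Collect_less continuous_intros continuous_on_compose2[OF assms]) auto
  then have "open (\<Union>h\<in>{h. h \<noteq> 0 \<and> \<bar>h\<bar> < d}. {x. q < (f (x + h *\<^sub>R e) - f x) / h})" for d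
    by auto
  moreover have "slope_above f e q =
    (\<Inter>n. \<Union>h\<in>{h. h \<noteq> 0 \<and> \<bar>h\<bar> < inverse (real (Suc n))}. {x. q < (f (x + h *\<^sub>R e) - f x) / h})"
    (is "_ = ?R")
  proof
    show "slope_above f e q \<subseteq> ?R"
      unfolding slope_above_def by force
    show "?R \<subseteq> slope_above f e q"
    proof (clarsimp simp: slope_above_def)
      fix x and d :: real
      assume *: "\<forall>n. \<exists>h. h \<noteq> 0 \<and> \<bar>h\<bar> < inverse (1 + real n) \<and> q < (f (x + h *\<^sub>R e) - f x) / h" and "d > 0"
      obtain n where "inverse (real (Suc n)) < d"
        using reals_Archimedean \<open>d > 0\<close> by blast
      with *[rule_format, of n] show "\<exists>h. h \<noteq> 0 \<and> \<bar>h\<bar> < d \<and> q < (f (x + h *\<^sub>R e) - f x) / h"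
        by (auto intro: less_trans)
    qed
  qed
  ultimately show ?thesis
    by (auto intro!: sets.countable_INT')
qed

lemma slope_below_borel:
  fixes f :: "'a::euclidean_space \<Rightarrow> real"
  assumes "continuous_on UNIV f"
  shows "slope_below f e p \<in> sets borel"
  unfolding slope_below_eq_above by (intro slope_above_borel continuous_on_minus assms)

text \<open>The derivative is the supremum of the levels that the quotients exceed at arbitrarily
  small increments, that is, their upper limit. If some \<open>a\<close> below it were not
  eventually exceeded, rational levels \<open>p < q\<close> between \<open>a\<close> and an element
  of \<open>A\<close> would put \<open>x\<close> into both slope sets.\<close>

lemma directional_derivative_if_slopes_agree:
  fixes f :: "'a::real_normed_vector \<Rightarrow> real"
  assumes bnd: "\<And>h. h \<noteq> 0 \<Longrightarrow> \<bar>(f (x + h *\<^sub>R e) - f x) / h\<bar> \<le> C"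
    and agree: "\<And>p q. p \<in> \<rat> \<Longrightarrow> q \<in> \<rat> \<Longrightarrow> p < q \<Longrightarrow> x \<notin> slope_above f e q \<inter> slope_below f e p"
  shows "\<exists>D. ((\<lambda>s. f (x + s *\<^sub>R e)) has_real_derivative D) (at 0)"
proof -
  define Q where "Q h = (f (x + h *\<^sub>R e) - f x) / h" for h
  define A where "A = {q. x \<in> slope_above f e q}"
  have above: "x \<in> slope_above f e q \<longleftrightarrow> (\<exists>\<^sub>F h in at 0. q < Q h)" for q
    by (force simp: slope_above_def frequently_def eventually_at Q_def)
  have below: "x \<in> slope_below f e q \<longleftrightarrow> (\<exists>\<^sub>F h in at 0. Q h < q)" for q
    by (force simp: slope_below_def frequently_def eventually_at Q_def)
  have QC: "eventually (\<lambda>h. \<bar>Q h\<bar> \<le> C) (at 0)"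
    unfolding eventually_at using bnd by (auto intro!: exI[of _ 1] simp: Q_def)
  have "\<exists>\<^sub>F h in at 0. - C - 1 < Q h"
    by (rule eventually_frequently) (use QC in \<open>auto elim!: eventually_mono\<close>)
  \<comment> \<open>Boundedness of the quotients makes \<open>A\<close> nonempty and bounded above,
    so that \<open>Sup A\<close> is meaningful.\<close>
  then have "-C - 1 \<in> A" by (simp add: A_def above)
  have A_le: "q \<le> C" if "q \<in> A" for q
  proof (rule ccontr)
    assume "\<not> q \<le> C"
    then have "eventually (\<lambda>h. \<not> q < Q h) (at 0)"
      using QC by (auto elim!: eventually_mono)
    with that show False by (simp add: A_def above frequently_def)
  qed
  have "(Q \<longlongrightarrow> Sup A) (at 0)"
  proof (rule order_tendstoI)
    fix a assume "a < Sup A"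
    then obtain b where b: "b \<in> A" "a < b"
      using \<open>-C - 1 \<in> A\<close> less_cSup_iff[of A a] A_le by (auto simp: bdd_above_def)
    obtain p where p: "p \<in> \<rat>" "a < p" "p < b" using Rats_dense_in_real b by blast
    obtain q where q: "q \<in> \<rat>" "p < q" "q < b" using Rats_dense_in_real p by blast
    have "x \<in> slope_above f e q"
      using b q unfolding A_def above by (auto elim!: frequently_elim1)
    with agree p q have "x \<notin> slope_below f e p" by blast
    then have "eventually (\<lambda>h. p \<le> Q h) (at 0)"
      by (simp add: below frequently_def not_less)
    then show "eventually (\<lambda>h. a < Q h) (at 0)"
      using p by (auto elim!: eventually_mono)
  next
    fix a assume a: "Sup A < a"
    obtain b where b: "Sup A < b" "b < a" using dense a by blast
    have "b \<notin> A"
      using b cSup_upper[of b A] A_le by (force simp: bdd_above_def)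
    then have "eventually (\<lambda>h. Q h \<le> b) (at 0)"
      by (simp add: A_def above frequently_def not_less)
    then show "eventually (\<lambda>h. Q h < a) (at 0)"
      using b by (auto elim!: eventually_mono)
  qed
  then show ?thesis
    unfolding DERIV_def Q_def by auto
qed

section \<open>Conflicting slopes on the line, excluded by Vitali coverings\<close>

lemma lborel_outer_open:
  fixes S :: "'a::euclidean_space set"
  assumes S: "S \<in> sets borel" and \<epsilon>: "\<epsilon> > 0"
  obtains U where "open U" "S \<subseteq> U" "emeasure lborel U \<le> emeasure lborel S + ennreal \<epsilon>"
proof -
  obtain U where U: "open U" "S \<subseteq> U" "emeasure lebesgue (U - S) < ennreal \<epsilon>"
    using sets_lebesgue_outer_open[of S \<epsilon>] assms by (metis sets_completionI_sets sets_lborel)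
  have "emeasure lborel U = emeasure lborel (S \<union> (U - S))"
    using U(2) by (simp add: Un_absorb1)
  also have "\<dots> \<le> emeasure lborel S + emeasure lborel (U - S)"
    using S U(1) by (intro emeasure_subadditive) auto
  also have "emeasure lborel (U - S) \<le> ennreal \<epsilon>"
    using U S by (auto simp: less_imp_le)
  finally show thesis using U(1,2) by (intro that) (auto simp: add_left_mono)
qed

text \<open>The covering intervals are taken inside an open set barely larger than the image of \<open>S\<close>. Applied to \<open>g\<close>
  and to its inverse, this rules out two different slopes on a set of positive measure.\<close>

lemma emeasure_image_ge_slope:
  fixes g k :: "real \<Rightarrow> real"
  assumes mono: "strict_mono g" and contg: "continuous_on UNIV g"
    and inv: "\<And>x. k (g x) = x" "\<And>y. g (k y) = y" and contk: "continuous_on UNIV k"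
    and S: "S \<in> sets borel" and q: "q > 0"
    and slope: "\<And>x d. x \<in> S \<Longrightarrow> d > 0 \<Longrightarrow>
      \<exists>a b. a < b \<and> x \<in> {a..b} \<and> b - a < d \<and> q * (b - a) \<le> g b - g a"
  shows "ennreal q * emeasure lborel S \<le> emeasure lborel (g ` S)"
proof (rule ennreal_le_epsilon)
  fix \<epsilon> :: real assume "\<epsilon> > 0"
  have gim: "g ` A = k -` A" for A
    using inv by (auto simp: image_iff) metis
  have "g ` S \<in> sets borel"
    unfolding gim using measurable_sets_borel[OF borel_measurable_continuous_onI[OF contk] S] by simp
  then obtain V where V: "open V" "g ` S \<subseteq> V"
    and VgS: "emeasure lborel V \<le> emeasure lborel (g ` S) + ennreal \<epsilon>"
    using lborel_outer_open[of "g ` S" \<epsilon>] \<open>\<epsilon> > 0\<close> by metis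
  define U where "U = g -` V"
  have "open U" unfolding U_def using contg V(1) by (simp add: open_vimage)
  have "S \<subseteq> U" using V by (auto simp: U_def)
  \<comment> \<open>Admissible intervals lie in the preimage \<open>U\<close> of \<open>V\<close>,
    so their images stay in \<open>V\<close>; on each of them \<open>g\<close> stretches the length
    at least by \<open>q\<close>.\<close>
  define K where "K = {(a,b). a < b \<and> {a..b} \<subseteq> U \<and> q * (b - a) \<le> g b - g a}"
  define cen rad where "cen = (\<lambda>(a,b). (a + b) / 2 :: real)" and "rad = (\<lambda>(a,b). (b - a) / 2 :: real)"
  have cball: "cball (cen (a,b)) (rad (a,b)) = {a..b}" if "a < b" for a b
    by (simp add: cen_def rad_def cball_eq_atLeastAtMost field_simps)
  have "\<exists>i. i \<in> K \<and> x \<in> cball (cen i) (rad i) \<and> rad i < d" if "x \<in> S" "d > 0" for x d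
  proof -
    obtain r where r: "r > 0" "ball x r \<subseteq> U"
      using \<open>open U\<close> \<open>S \<subseteq> U\<close> \<open>x \<in> S\<close> openE by blast
    obtain a b where ab: "a < b" "x \<in> {a..b}" "b - a < min r d" "q * (b - a) \<le> g b - g a"
      using slope[OF \<open>x \<in> S\<close>, of "min r d"] r \<open>d > 0\<close> by auto
    have "{a..b} \<subseteq> ball x r" using ab by (auto simp: dist_real_def)
    then have "(a,b) \<in> K" "x \<in> cball (cen (a,b)) (rad (a,b))" "rad (a,b) < d"
      using ab r by (auto simp: K_def cball simp del: mem_cball) (simp add: rad_def)
    then show ?thesis by blast
  qed
  moreover have "0 < rad i" if "i \<in> K" for i
    using that by (auto simp: K_def rad_def)
  ultimately obtain C where C: "countable C" "C \<subseteq> K"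
     "pairwise (\<lambda>i j. disjnt (cball (cen i) (rad i)) (cball (cen j) (rad j))) C"
     "negligible (S - (\<Union>i\<in>C. cball (cen i) (rad i)))"
    by - (rule Vitali_covering_theorem_cballs[of K rad S cen])
  define I where "I = (\<lambda>i::real\<times>real. {fst i..snd i})"
  define J where "J = (\<lambda>i::real\<times>real. {g (fst i)..g (snd i)})"
  have CI: "cball (cen i) (rad i) = I i" if "i \<in> C" for i
    using that C(2) cball by (auto simp: K_def I_def)
  have disj: "disjoint_family_on I C"
    using C(3) CI by (auto simp: disjoint_family_on_def pairwise_def disjnt_def)
  have JI: "J i = g ` I i" if "i \<in> C" for i
  proof -
    have "g x \<le> g y \<longleftrightarrow> x \<le> y" for x y using mono strict_mono_less_eq by blast
    then show ?thesis unfolding I_def J_def gim using inv by auto (metis | blast)+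
  qed
  have disjJ: "disjoint_family_on J C"
    unfolding disjoint_family_on_def
  proof (intro ballI impI)
    fix i j assume ij: "i \<in> C" "j \<in> C" "i \<noteq> j"
    have "I i \<inter> I j = {}" using disj ij by (auto simp: disjoint_family_on_def)
    moreover have "inj g" using inv(1) by (rule inj_on_inverseI)
    ultimately show "J i \<inter> J j = {}" using JI ij by (metis image_Int image_empty)
  qed
  have neg: "S - (\<Union>i\<in>C. I i) \<in> null_sets lborel"
  proof -
    have "negligible (S - (\<Union>i\<in>C. I i))" using C(4) CI by simp
    moreover have "S - (\<Union>i\<in>C. I i) \<in> sets lborel"
      using S C(1) by (auto simp: I_def intro!: sets.Diff sets.countable_UN')
    ultimately show ?thesis
      by (simp add: negligible_iff_null_sets null_sets_def)
  qed
  have UI: "(\<Union>i\<in>C. I i) \<in> sets lborel"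
    using C(1) by (auto simp: I_def intro!: sets.countable_UN')
  \<comment> \<open>The disjoint intervals cover \<open>S\<close> up to a null set and their
    disjoint images lie in \<open>V\<close>; comparing total lengths gives the bound up to
    \<open>\<epsilon>\<close>.\<close>
  have "ennreal q * emeasure lborel S \<le> ennreal q * emeasure lborel ((\<Union>i\<in>C. I i) \<union> (S - (\<Union>i\<in>C. I i)))"
    using UI neg[THEN null_setsD2] by (intro mult_left_mono emeasure_mono sets.Un) auto
  also have "\<dots> = ennreal q * emeasure lborel (\<Union>i\<in>C. I i)"
    by (subst emeasure_Un_null_set[OF UI neg]) simp
  also have "\<dots> = ennreal q * (\<integral>\<^sup>+i. emeasure lborel (I i) \<partial>count_space C)"
    by (subst emeasure_UN_countable[OF _ C(1) disj]) (auto simp: I_def)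
  also have "\<dots> = (\<integral>\<^sup>+i. ennreal q * emeasure lborel (I i) \<partial>count_space C)"
    by (simp add: nn_integral_cmult)
  also have "\<dots> \<le> (\<integral>\<^sup>+i. emeasure lborel (J i) \<partial>count_space C)"
  proof (intro nn_integral_mono)
    fix i assume "i \<in> space (count_space C)"
    with C(2) have "fst i < snd i" "q * (snd i - fst i) \<le> g (snd i) - g (fst i)"
      by (auto simp: K_def)
    then show "ennreal q * emeasure lborel (I i) \<le> emeasure lborel (J i)"
      using q mono by (simp add: I_def J_def strict_mono_less_eq ennreal_mult[symmetric])
  qed
  also have "\<dots> = emeasure lborel (\<Union>i\<in>C. J i)"
    by (subst emeasure_UN_countable[OF _ C(1) disjJ]) (auto simp: J_def)
  also have "\<dots> \<le> emeasure lborel V"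
  proof (rule emeasure_mono)
    show "(\<Union>i\<in>C. J i) \<subseteq> V"
    proof (rule UN_least)
      fix i assume i: "i \<in> C"
      then have "I i \<subseteq> U" using C(2) unfolding K_def I_def by (cases i) fastforce
      then show "J i \<subseteq> V" unfolding JI[OF i] by (auto simp: U_def)
    qed
  qed (use V in simp)
  also note VgS
  finally show "ennreal q * emeasure lborel S \<le> emeasure lborel (g ` S) + ennreal \<epsilon>" .
qed

text \<open>The interval has ends \<open>x\<close> and \<open>x + h\<close>, and the sign of
  \<open>h\<close> decides which is the left one. This puts a pointwise slope into the form used by
  the covering argument.\<close>

lemma slope_above_interval:
  fixes g :: "real \<Rightarrow> real"
  assumes "x \<in> slope_above g 1 q" "d > 0"
  shows "\<exists>a b. a < b \<and> x \<in> {a..b} \<and> b - a < d \<and> q * (b - a) \<le> g b - g a"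
proof -
  obtain h where h: "h \<noteq> 0" "\<bar>h\<bar> < d" "q < (g (x + h) - g x) / h"
    using assms unfolding slope_above_def by auto
  show ?thesis
  proof (cases "h > 0")
    case True
    then show ?thesis using h by (intro exI[of _ x] exI[of _ "x + h"]) (auto simp: field_simps)
  next
    case False
    then have "h < 0" using h by auto
    then show ?thesis using h by (intro exI[of _ "x + h"] exI[of _ x]) (auto simp: field_simps)
  qed
qed

lemma slope_below_interval:
  fixes g :: "real \<Rightarrow> real"
  assumes "x \<in> slope_below g 1 p" "d > 0"
  shows "\<exists>a b. a < b \<and> x \<in> {a..b} \<and> b - a < d \<and> g b - g a \<le> p * (b - a)"
proof -
  obtain a b where "a < b" "x \<in> {a..b}" "b - a < d" "- p * (b - a) \<le> - g b - - g a"
    using slope_above_interval[of x "\<lambda>x. - g x" "-p" d] assms unfolding slope_below_eq_above by auto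
  then show ?thesis by (intro exI[of _ a] exI[of _ b]) simp
qed

text \<open>On a bounded part E of the set, slopes above \<open>q\<close> give q |E| <= |g(E)|,
  while slopes below \<open>p\<close> are slopes above 1/p of the inverse function and give |g(E)|
  <= p |E|. Finiteness of |E| and \<open>p < q\<close> leave only |E| = 0.\<close>

lemma slope_above_below_null_bilipschitz:
  fixes g :: "real \<Rightarrow> real"
  assumes lower: "\<And>x y. x \<le> y \<Longrightarrow> y - x \<le> g y - g x" and upper: "\<And>x y. x \<le> y \<Longrightarrow> g y - g x \<le> M * (y - x)"
    and pq: "0 < p" "p < q"
  shows "slope_above g 1 q \<inter> slope_below g 1 p \<in> null_sets lborel"
proof -
  have mono: "strict_mono g" 
  proof (rule strict_monoI)
    fix x y :: real assume "x < y" with lower[of x y] show "g x < g y" by simp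
  qed
  have "M \<ge> 0" using lower[of 0 1] upper[of 0 1] by simp
  have abs: "\<bar>g x - g y\<bar> \<le> M * \<bar>x - y\<bar> \<and> \<bar>x - y\<bar> \<le> \<bar>g x - g y\<bar>" for x y
    using lower[of x y] upper[of x y] lower[of y x] upper[of y x] by (cases "x \<le> y") (auto simp: abs_if)
  have "M-lipschitz_on UNIV g"
    by (rule lipschitz_onI) (use abs \<open>M \<ge> 0\<close> in \<open>auto simp: dist_real_def\<close>)
  then have contg: "continuous_on UNIV g" by (rule lipschitz_on_continuous_on)
  \<comment> \<open>Since \<open>g\<close> grows at least like the identity, the intermediate value
    theorem on [-r, r] with r = |y - g(0)| shows that \<open>g\<close> is onto, so its inverse is
    defined everywhere.\<close>
  have "\<exists>x. g x = y" for y
  proof -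
    define r where "r = \<bar>y - g 0\<bar>"
    have "g (-r) \<le> y" "y \<le> g r" using lower[of "-r" 0] lower[of 0 r] by (auto simp: r_def)
    then obtain x where "-r \<le> x" "x \<le> r" "g x = y"
      using IVT'[of g "-r" y r] continuous_on_subset[OF contg] by (auto simp: r_def)
    then show ?thesis by blast
  qed
  then obtain k where k: "\<And>y. g (k y) = y" by metis
  have k': "k (g x) = x" for x using k mono by (metis strict_mono_eq)
  have "1-lipschitz_on UNIV k"
    by (rule lipschitz_onI) (use abs[of "k _" "k _"] k in \<open>auto simp: dist_real_def\<close>)
  then have contk: "continuous_on UNIV k" by (rule lipschitz_on_continuous_on)
  have monok: "strict_mono k"
    by (rule strict_monoI) (metis k mono strict_mono_less)
  \<comment> \<open>Cutting to [-n, n] makes the measure finite, as the final cancellation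
    requires.\<close>
  define E where "E n = slope_above g 1 q \<inter> slope_below g 1 p \<inter> {-real n..real n}" for n
  have E: "E n \<in> sets borel" for n
    unfolding E_def using slope_above_borel[OF contg] slope_below_borel[OF contg] by auto
  have "E n \<in> null_sets lborel" for n
  proof -
    have gE: "g ` E n = k -` E n" using k k' by (auto simp: image_iff) metis
    have gEb: "g ` E n \<in> sets borel"
      unfolding gE using measurable_sets_borel[OF borel_measurable_continuous_onI[OF contk] E] by simp
    have 1: "ennreal q * emeasure lborel (E n) \<le> emeasure lborel (g ` E n)"
      using pq by (intro emeasure_image_ge_slope[OF mono contg k' k contk E])
        (use slope_above_interval in \<open>auto simp: E_def\<close>)
    have "ennreal (1/p) * emeasure lborel (g ` E n) \<le> emeasure lborel (k ` g ` E n)"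
    proof (rule emeasure_image_ge_slope[OF monok contk k k' contg gEb])
      fix y d :: real assume "y \<in> g ` E n" "d > 0"
      then obtain x where x: "x \<in> slope_below g 1 p" "y = g x" by (auto simp: E_def)
      \<comment> \<open>An interval shorter than d / (M + 1) has an image shorter than
        \<open>d\<close>, because \<open>g\<close> is \<open>M\<close>-Lipschitz; the summand 1
        keeps the denominator positive.\<close>
      have "d / (M + 1) > 0" using \<open>d > 0\<close> \<open>M \<ge> 0\<close> by simp
      from slope_below_interval[OF x(1) this]
      obtain a b where ab: "a < b" "x \<in> {a..b}" "b - a < d / (M + 1)" "g b - g a \<le> p * (b - a)"
        by auto
      have "g b - g a \<le> M * (b - a)" using upper ab by simp
      also have "\<dots> \<le> (M + 1) * (b - a)" using ab by (simp add: algebra_simps)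
      also have "\<dots> < d" using ab \<open>M \<ge> 0\<close> by (simp add: field_simps)
      finally show "\<exists>a b. a < b \<and> y \<in> {a..b} \<and> b - a < d \<and> 1 / p * (b - a) \<le> k b - k a"
        using ab pq x mono by (intro exI[of _ "g a"] exI[of _ "g b"])
          (auto simp: k' strict_mono_less strict_mono_less_eq field_simps)
    qed (use pq in auto)
    then have 2: "ennreal (1/p) * emeasure lborel (g ` E n) \<le> emeasure lborel (E n)"
      by (simp add: image_image k')
    have "emeasure lborel (E n) \<le> emeasure lborel {-real n..real n}"
      by (intro emeasure_mono) (auto simp: E_def)
    then have fin: "emeasure lborel (E n) < \<infinity>" by (simp add: le_less_trans)
    have "ennreal (q/p) * emeasure lborel (E n) = ennreal (1/p) * (ennreal q * emeasure lborel (E n))"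
      using pq by (simp add: ennreal_mult[symmetric] mult.assoc[symmetric])
    also have "\<dots> \<le> ennreal (1/p) * emeasure lborel (g ` E n)" using 1 by (intro mult_left_mono) auto
    also note 2
    finally have *: "ennreal (q/p) * emeasure lborel (E n) \<le> emeasure lborel (E n)" .
    obtain m where m: "emeasure lborel (E n) = ennreal m" "m \<ge> 0"
      using fin by (cases "emeasure lborel (E n)") auto
    from * have "q / p * m \<le> m" using pq m by (simp add: ennreal_mult[symmetric])
    then have "(q - p) * m \<le> 0" using pq by (simp add: field_simps)
    then have "m = 0" using pq m by (simp add: mult_le_0_iff)
    with m E show ?thesis by (auto simp: null_sets_def)
  qed
  then have "(\<Union>n. E n) \<in> null_sets lborel" by (rule null_sets_UN)
  moreover have "(\<Union>n. E n) = slope_above g 1 q \<inter> slope_below g 1 p"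
  proof -
    have "\<exists>n. x \<in> {-real n..real n}" for x :: real
      using real_arch_simple[of "\<bar>x\<bar>"] by (auto simp: abs_le_iff) (metis minus_le_iff)
    then show ?thesis by (auto simp: E_def)
  qed
  ultimately show ?thesis by simp
qed

text \<open>Adding the linear function \<open>c * x\<close> shifts all difference quotients by
  \<open>c\<close> and makes the function increasing, with slopes between 1 and L + c.\<close>

lemma slope_above_below_null:
  fixes G :: "real \<Rightarrow> real"
  assumes lip: "L-lipschitz_on UNIV G" and pq: "p < q"
  shows "slope_above G 1 q \<inter> slope_below G 1 p \<in> null_sets lborel"
proof -
  \<comment> \<open>|L| + 1 forces slopes of at least 1; the extra |p| makes the shifted level p + c
    positive.\<close>
  define c where "c = \<bar>L\<bar> + 1 + \<bar>p\<bar>"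
  define g where "g x = G x + c * x" for x
  have G: "\<bar>G y - G x\<bar> \<le> L * \<bar>y - x\<bar>" for x y
    using lipschitz_onD[OF lip] by (simp add: dist_real_def)
  have slope: "(g (x + h) - g x) / h = (G (x + h) - G x) / h + c" if "h \<noteq> 0" for x h
    using that by (simp add: g_def field_simps)
  have "slope_above g 1 (q + c) \<inter> slope_below g 1 (p + c) \<in> null_sets lborel"
  proof (rule slope_above_below_null_bilipschitz[where M = "L + c"])
    fix x y :: real assume xy: "x \<le> y"
    have "L \<ge> 0" using lip lipschitz_on_nonneg by blast
    then have "(L + 1) * (y - x) \<le> c * (y - x)" using xy by (intro mult_right_mono) (auto simp: c_def)
    then show "y - x \<le> g y - g x" "g y - g x \<le> (L + c) * (y - x)"
      using G[of y x] xy by (auto simp: g_def algebra_simps abs_le_iff)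
  qed (use pq in \<open>auto simp: c_def\<close>)
  also have "slope_above g 1 (q + c) = slope_above G 1 q"
    unfolding slope_above_def using slope by auto (metis add_less_cancel_right)+
  also have "slope_below g 1 (p + c) = slope_below G 1 p"
    unfolding slope_below_def using slope by auto (metis add_less_cancel_right)+
  finally show ?thesis .
qed

text \<open>On every line in direction \<open>e\<close> the points with conflicting slopes at fixed
  levels form a null set. Fubini's theorem on pairs (x, s) transfers this to space, without
  coordinates adapted to \<open>e\<close>; countably many rational pairs of levels exhaust the
  points of non-differentiability.\<close>

lemma AE_directional_derivative:
  fixes f :: "'a::euclidean_space \<Rightarrow> real"
  assumes lip: "L-lipschitz_on UNIV f"
  shows "AE x in lborel. \<exists>D. ((\<lambda>s. f (x + s *\<^sub>R e)) has_real_derivative D) (at 0)"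
proof -
  have L: "L \<ge> 0" using lip lipschitz_on_nonneg by blast
  have contf: "continuous_on UNIV f" using lip by (rule lipschitz_on_continuous_on)
  define N where "N p q = slope_above f e q \<inter> slope_below f e p" for p q
  have N: "N p q \<in> sets borel" for p q
    unfolding N_def using slope_above_borel[OF contf] slope_below_borel[OF contf] by auto
  have N0: "N p q \<in> null_sets lborel" if "p < q" for p q
  proof -
    have line: "(\<lambda>s. x + s *\<^sub>R e) -` N p q \<in> null_sets lborel" for x
    proof -
      define G where "G s = f (x + s *\<^sub>R e)" for s
      have "(L * norm e)-lipschitz_on UNIV G"
      proof (rule lipschitz_onI)
        fix s t :: real
        have "dist (G s) (G t) \<le> L * dist (x + s *\<^sub>R e) (x + t *\<^sub>R e)"
          unfolding G_def by (rule lipschitz_onD[OF lip]) auto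
        also have "dist (x + s *\<^sub>R e) (x + t *\<^sub>R e) = dist s t * norm e"
          by (simp add: dist_norm flip: scaleR_left_diff_distrib)
        finally show "dist (G s) (G t) \<le> L * norm e * dist s t" by (simp add: mult_ac)
      qed (use L in simp)
      from slope_above_below_null[OF this \<open>p < q\<close>]
      have "slope_above G 1 q \<inter> slope_below G 1 p \<in> null_sets lborel" .
      also have "slope_above G 1 q \<inter> slope_below G 1 p = (\<lambda>s. x + s *\<^sub>R e) -` N p q"
        by (auto simp: slope_above_def slope_below_def N_def G_def algebra_simps)
      finally show ?thesis .
    qed
    \<comment> \<open>For fixed \<open>x\<close> the slice of \<open>Z\<close> is part of a null set
      on a line; for fixed \<open>s\<close> in [0, 1] it is a translate of \<open>N p q\<close>. The
      measure of \<open>Z\<close> is therefore both 0 and the measure of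
      \<open>N p q\<close>.\<close>
    define Z where "Z = {(x, s). s \<in> {0..1::real} \<and> x + s *\<^sub>R e \<in> N p q}"
    have Z: "Z \<in> sets (lborel \<Otimes>\<^sub>M lborel)"
    proof -
      have "(\<lambda>z. fst z + snd z *\<^sub>R e) -` N p q \<inter> space borel \<in> sets borel"
        by (intro measurable_sets[OF borel_measurable_continuous_onI N] continuous_intros)
      moreover have "snd -` {0..1::real} \<inter> space (borel :: ('a \<times> real) measure) \<in> sets borel"
        by (intro measurable_sets[OF borel_measurable_continuous_onI] continuous_intros) auto
      ultimately have "((\<lambda>z. fst z + snd z *\<^sub>R e) -` N p q) \<inter> (snd -` {0..1::real}) \<in> sets borel"
        by auto
      also have "((\<lambda>z. fst z + snd z *\<^sub>R e) -` N p q) \<inter> (snd -` {0..1::real}) = Z"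
        by (auto simp: Z_def)
      finally show ?thesis by (simp only: lborel_prod sets_lborel)
    qed
    have "emeasure (lborel \<Otimes>\<^sub>M lborel) Z = (\<integral>\<^sup>+x. emeasure lborel (Pair x -` Z) \<partial>lborel)"
      by (rule lborel.emeasure_pair_measure_alt[OF Z])
    also have "\<dots> = 0"
    proof -
      have "emeasure lborel (Pair x -` Z) = 0" for x
      proof -
        have "Pair x -` Z \<subseteq> (\<lambda>s. x + s *\<^sub>R e) -` N p q" by (auto simp: Z_def)
        moreover have "Pair x -` Z \<in> sets lborel" by (rule sets_Pair1[OF Z])
        ultimately have "Pair x -` Z \<in> null_sets lborel"
          using null_sets_subset[OF line[of x]] by blast
        then show ?thesis by blast
      qed
      then show ?thesis by simp
    qed
    finally have "(\<integral>\<^sup>+s. emeasure lborel ((\<lambda>x. (x, s)) -` Z) \<partial>lborel) = 0"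
      using lborel_pair.emeasure_pair_measure_alt2[OF Z] by simp
    moreover have "emeasure lborel ((\<lambda>x. (x, s)) -` Z) = indicator {0..1} s * emeasure lborel (N p q)" for s
    proof (cases "s \<in> {0..1}")
      case True
      then have "(\<lambda>x. (x, s)) -` Z = (+) (s *\<^sub>R e) -` N p q" by (auto simp: Z_def add.commute)
      then have "emeasure lborel ((\<lambda>x. (x, s)) -` Z) = emeasure (distr lborel borel ((+) (s *\<^sub>R e))) (N p q)"
        using N by (subst emeasure_distr) auto
      also have "\<dots> = emeasure lborel (N p q)" by (simp add: lborel_distr_plus)
      finally show ?thesis using True by simp
    next
      case False
      then have "(\<lambda>x. (x, s)) -` Z = {}" by (auto simp: Z_def)
      then show ?thesis using False by simp
    qed
    ultimately have "emeasure lborel (N p q) = 0"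
      by (simp add: nn_integral_multc)
    then show ?thesis using N by (auto simp: null_sets_def)
  qed
  define B where "B = (\<Union>(p, q) \<in> {(p,q). p \<in> \<rat> \<and> q \<in> \<rat> \<and> p < q}. N p q)"
  have "countable {(p,q). p \<in> (\<rat>::real set) \<and> q \<in> \<rat> \<and> p < q}"
    by (rule countable_subset[of _ "\<rat> \<times> \<rat>"]) (auto simp: countable_rat)
  then have "B \<in> null_sets lborel"
    unfolding B_def by (rule null_sets_UN') (auto intro: N0)
  then show ?thesis
  proof (rule AE_I', intro subsetI)
    fix x assume "x \<in> {x \<in> space lborel. \<not> (\<exists>D. ((\<lambda>s. f (x + s *\<^sub>R e)) has_real_derivative D) (at 0))}"
    then have nd: "\<not> (\<exists>D. ((\<lambda>s. f (x + s *\<^sub>R e)) has_real_derivative D) (at 0))" by simp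
    have bnd: "\<bar>(f (x + h *\<^sub>R e) - f x) / h\<bar> \<le> L * norm e" if "h \<noteq> 0" for h
      using lipschitz_onD[OF lip, of "x + h *\<^sub>R e" x] that by (simp add: dist_norm field_simps)
    show "x \<in> B"
    proof (rule ccontr)
      assume "x \<notin> B"
      then have "\<exists>D. ((\<lambda>s. f (x + s *\<^sub>R e)) has_real_derivative D) (at 0)"
        by (intro directional_derivative_if_slopes_agree[OF bnd]) (auto simp: B_def N_def)
      with nd show False by blast
    qed
  qed
qed

section \<open>Integration by parts for Lipschitz fields\<close>

lemma bounded_subset_cball_0:
  fixes K :: "'a::real_normed_vector set"
  assumes "bounded K"
  obtains r where "K \<subseteq> cball 0 r"
  using assms by (auto simp: bounded_iff subset_iff)

lemma borel_imp_lebesgue_measurable: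
  fixes f :: "'a::euclidean_space \<Rightarrow> 'b::topological_space"
  shows "f \<in> borel_measurable borel \<Longrightarrow> f \<in> borel_measurable lebesgue"
  by (rule measurable_completion) simp

text \<open>Completeness of Lebesgue measure. \<open>partial_deriv\<close> takes an unspecified
  value where the derivative does not exist, so it is controlled only up to null sets.\<close>

lemma lebesgue_measurable_if_AE_eq:
  fixes f g :: "'a::euclidean_space \<Rightarrow> real"
  assumes g: "g \<in> borel_measurable lebesgue" and eq: "AE x in lebesgue. g x = f x"
  shows "f \<in> borel_measurable lebesgue"
proof (rule measurableI)
  fix A :: "real set" assume A: "A \<in> sets borel"
  show "f -` A \<inter> space lebesgue \<in> sets lebesgue"
  proof (rule complete_measure.in_sets_AE)
    show "complete_measure (lebesgue :: 'a measure)" by unfold_locales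
    show "AE x in lebesgue. x \<in> g -` A \<inter> space lebesgue \<longleftrightarrow> x \<in> f -` A \<inter> space lebesgue"
      using eq by eventually_elim auto
    show "g -` A \<inter> space lebesgue \<in> sets lebesgue" using g A by (rule measurable_sets)
  qed auto
qed simp

lemma partial_deriv_eqI:
  assumes "((\<lambda>s. f (x + s *\<^sub>R axis i 1)) has_real_derivative D) (at 0)"
  shows "partial_deriv i f x = D"
  unfolding partial_deriv_def by (rule DERIV_imp_deriv[OF assms])

lemma partial_deriv_has_derivative:
  fixes u :: "real^'n \<Rightarrow> real"
  assumes D: "(u has_derivative D) (at x)"
  shows "((\<lambda>s. u (x + s *\<^sub>R axis i 1)) has_real_derivative D (axis i 1)) (at 0)"
    and "partial_deriv i u x = D (axis i 1)"
proof -
  have "((\<lambda>s. x + s *\<^sub>R axis i 1) has_derivative (\<lambda>s. s *\<^sub>R axis i (1::real))) (at 0)"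
    by (auto intro!: derivative_eq_intros)
  moreover have "(u has_derivative D) (at (x + 0 *\<^sub>R axis i 1))" using D by simp
  ultimately have "((\<lambda>s. u (x + s *\<^sub>R axis i 1)) has_derivative (\<lambda>s. D (s *\<^sub>R axis i 1))) (at 0)"
    by (rule has_derivative_compose)
  moreover have "(\<lambda>s. D (s *\<^sub>R axis i 1)) = (*) (D (axis i 1))"
    using linear_scale[OF has_derivative_linear[OF D]] by (auto simp: mult.commute)
  ultimately show d: "((\<lambda>s. u (x + s *\<^sub>R axis i 1)) has_real_derivative D (axis i 1)) (at 0)"
    by (simp add: has_field_derivative_def)
  then show "partial_deriv i u x = D (axis i 1)" by (rule partial_deriv_eqI)
qed

lemma lie_deriv_has_derivative:
  fixes u :: "real^'n \<Rightarrow> real"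
  assumes D: "(u has_derivative D) (at x)"
  shows "lie_deriv Y u x = D (Y x)"
proof -
  interpret D: linear D using D by (rule has_derivative_linear)
  have "D (Y x) = D (\<Sum>i\<in>UNIV. Y x $ i *\<^sub>R axis i 1)"
    using basis_expansion[of "Y x"] by (simp add: scalar_mult_eq_scaleR)
  also have "\<dots> = (\<Sum>i\<in>UNIV. Y x $ i * D (axis i 1))" by (simp add: D.sum D.scale)
  finally show ?thesis by (simp add: lie_deriv_def partial_deriv_has_derivative(2)[OF D])
qed

lemma has_derivative_0_outside_support:
  fixes u :: "'a::real_normed_vector \<Rightarrow> 'b::real_normed_vector"
  assumes K: "closed K" and u: "\<And>y. y \<notin> K \<Longrightarrow> u y = 0" and x: "x \<notin> K"
  shows "(u has_derivative (\<lambda>_. 0)) (at x)"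
  by (rule has_derivative_transform_within_open[OF has_derivative_const[of 0] open_Compl[OF K]])
    (use x u in auto)

text \<open>The increments 1/(k+1) exhibit the derivative as the limit of a sequence, which serves
  measurability, the bound by the Lipschitz constant and dominated convergence alike.\<close>

lemma difference_quotient_tendsto:
  fixes f :: "real^'n \<Rightarrow> real"
  assumes "((\<lambda>s. f (x + s *\<^sub>R axis i 1)) has_real_derivative D) (at 0)"
  shows "(\<lambda>k. (f (x + inverse (real (Suc k)) *\<^sub>R axis i 1) - f x) * real (Suc k)) \<longlonglongrightarrow> D"
proof -
  have "((\<lambda>h. (f (x + h *\<^sub>R axis i 1) - f x) / h) \<longlongrightarrow> D) (at 0)"
    using assms by (simp add: DERIV_def)
  moreover have "filterlim (\<lambda>k. inverse (real (Suc k))) (at 0) sequentially"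
    using LIMSEQ_inverse_real_of_nat by (auto simp: filterlim_at)
  ultimately have "(\<lambda>k. (f (x + inverse (real (Suc k)) *\<^sub>R axis i 1) - f x) / inverse (real (Suc k))) \<longlonglongrightarrow> D"
    by (rule filterlim_compose)
  then show ?thesis by (simp add: divide_inverse)
qed

lemma AE_partial_deriv:
  fixes f :: "real^'n \<Rightarrow> real"
  assumes "L-lipschitz_on UNIV f"
  shows "AE x in lebesgue. ((\<lambda>s. f (x + s *\<^sub>R axis i 1)) has_real_derivative partial_deriv i f x) (at 0)"
  using AE_directional_derivative[OF assms, of "axis i 1"]
  unfolding AE_completion_iff
proof eventually_elim
  case (elim x)
  then obtain D where D: "((\<lambda>s. f (x + s *\<^sub>R axis i 1)) has_real_derivative D) (at 0)" by blast
  with partial_deriv_eqI[OF D] show ?case by simp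
qed

lemma abs_difference_quotient_le:
  fixes f :: "real^'n \<Rightarrow> real"
  assumes "L-lipschitz_on UNIV f"
  shows "\<bar>(f (x + inverse (real (Suc k)) *\<^sub>R axis i 1) - f x) * real (Suc k)\<bar> \<le> L"
proof -
  have "\<bar>f (x + inverse (real (Suc k)) *\<^sub>R axis i 1) - f x\<bar> \<le> L * inverse (real (Suc k))"
    using lipschitz_onD[OF assms, of "x + inverse (real (Suc k)) *\<^sub>R axis i 1" x]
    by (simp add: dist_norm norm_axis_1)
  then have "\<bar>f (x + inverse (real (Suc k)) *\<^sub>R axis i 1) - f x\<bar> * real (Suc k) \<le> L * inverse (real (Suc k)) * real (Suc k)"
    by (intro mult_right_mono) auto
  also have "\<dots> = L" by (simp add: mult.assoc)
  finally show ?thesis by (simp only: abs_mult abs_of_nat)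
qed

lemma abs_partial_deriv_le:
  fixes f :: "real^'n \<Rightarrow> real"
  assumes "L-lipschitz_on UNIV f"
    and "((\<lambda>s. f (x + s *\<^sub>R axis i 1)) has_real_derivative D) (at 0)"
  shows "\<bar>D\<bar> \<le> L"
  using tendsto_rabs[OF difference_quotient_tendsto[OF assms(2)]] abs_difference_quotient_le[OF assms(1)]
  by (intro LIMSEQ_le_const2) auto

lemma abs_lie_deriv_le:
  fixes v :: "real^'n \<Rightarrow> real" and L M :: real
  assumes v: "L-lipschitz_on UNIV v" "v differentiable (at x)" and Y: "norm (Y x) \<le> M"
  shows "\<bar>lie_deriv Y v x\<bar> \<le> CARD('n) * (M * L)"
proof -
  obtain D where D: "(v has_derivative D) (at x)" using v(2) by (auto simp: differentiable_def)
  have "\<bar>partial_deriv i v x\<bar> \<le> L" for i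
    using abs_partial_deriv_le[OF v(1) partial_deriv_has_derivative(1)[OF D]]
    by (simp add: partial_deriv_has_derivative(2)[OF D])
  moreover have "\<bar>Y x $ i\<bar> \<le> M" for i using component_le_norm_cart[of "Y x" i] Y by linarith
  moreover have "0 \<le> M" using Y norm_ge_zero order_trans by blast
  ultimately have "\<bar>Y x $ i * partial_deriv i v x\<bar> \<le> M * L" for i
    unfolding abs_mult by (intro mult_mono) auto
  then have "(\<Sum>i\<in>UNIV. \<bar>Y x $ i * partial_deriv i v x\<bar>) \<le> (\<Sum>i\<in>(UNIV::'n set). M * L)"
    by (intro sum_mono)
  then have "\<bar>\<Sum>i\<in>UNIV. Y x $ i * partial_deriv i v x\<bar> \<le> (\<Sum>i\<in>(UNIV::'n set). M * L)"
    by (rule order_trans[OF sum_abs])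
  then show ?thesis by (simp add: lie_deriv_def)
qed

text \<open>Off a null set the partial derivative is a limit of continuous difference quotients; on
  that null set it is arbitrary, hence measurability with respect to the completed measure.\<close>

lemma partial_deriv_measurable:
  fixes f :: "real^'n \<Rightarrow> real"
  assumes L: "L-lipschitz_on UNIV f"
  shows "partial_deriv i f \<in> borel_measurable lebesgue"
proof (rule lebesgue_measurable_if_AE_eq)
  define D where "D k x = (f (x + inverse (real (Suc k)) *\<^sub>R axis i 1) - f x) * real (Suc k)" for k x
  have cont: "continuous_on UNIV f" using L by (rule lipschitz_on_continuous_on)
  have "D k \<in> borel_measurable borel" for k
    unfolding D_def
    by (intro borel_measurable_continuous_onI continuous_intros continuous_on_compose2[OF cont]) auto
  then have "(\<lambda>x. lim (\<lambda>k. D k x)) \<in> borel_measurable borel" by (rule borel_measurable_lim_metric)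
  then show "(\<lambda>x. lim (\<lambda>k. D k x)) \<in> borel_measurable lebesgue"
    by (simp add: borel_imp_lebesgue_measurable)
  show "AE x in lebesgue. lim (\<lambda>k. D k x) = partial_deriv i f x"
    using AE_partial_deriv[OF L, of i]
    unfolding D_def by eventually_elim (rule limI[OF difference_quotient_tendsto])
qed

lemma lborel_integral_translate:
  fixes w :: "'a::euclidean_space \<Rightarrow> real"
  assumes "w \<in> borel_measurable borel"
  shows "(LBINT x. w (x + a)) = (LBINT x. w x)"
proof -
  have "(LBINT x. w x) = (\<integral>x. w x \<partial>distr lborel borel ((+) a))"
    by (simp add: lborel_distr_plus)
  also have "\<dots> = (LBINT x. w (a + x))"
    using assms by (intro integral_distr) auto
  finally show ?thesis by (simp add: add.commute)
qed

lemma integrable_bounded_support: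
  fixes w :: "'a::euclidean_space \<Rightarrow> real"
  assumes w: "w \<in> borel_measurable lebesgue" and bnd: "AE x in lebesgue. \<bar>w x\<bar> \<le> B"
    and supp: "\<And>x. x \<notin> K \<Longrightarrow> w x = 0" and K: "bounded K"
  shows "integrable lebesgue w"
proof -
  obtain r where r: "K \<subseteq> cball 0 r" using bounded_subset_cball_0[OF K] by blast
  have "integrable lebesgue (\<lambda>x. indicator (cball 0 r) x *\<^sub>R B)"
    by (rule integrable_scaleR_left, rule integrable_real_indicator)
      (use emeasure_compact_finite[OF compact_cball, of 0 r] in auto)
  then show ?thesis
  proof (rule Bochner_Integration.integrable_bound[OF _ w])
    show "AE x in lebesgue. norm (w x) \<le> norm (indicator (cball 0 r) x *\<^sub>R B)"
      using bnd
    proof eventually_elim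
      case (elim x)
      then show ?case using supp[of x] r by (cases "x \<in> K") (auto simp: indicator_def)
    qed
  qed
qed

text \<open>Every difference quotient has integral 0 by translation invariance. The quotients are
  bounded by \<open>L\<close> and vanish outside a fixed ball, so dominated convergence passes this
  on to the derivative.\<close>

lemma integral_partial_deriv_eq_0:
  fixes w :: "real^'n \<Rightarrow> real"
  assumes L: "L-lipschitz_on UNIV w" and supp: "\<And>x. x \<notin> K \<Longrightarrow> w x = 0" and K: "bounded K"
  shows "(\<integral>x. partial_deriv i w x \<partial>lebesgue) = 0"
proof -
  define D where "D k x = (w (x + inverse (real (Suc k)) *\<^sub>R axis i 1) - w x) * real (Suc k)" for k x
  have cont: "continuous_on UNIV w" using L by (rule lipschitz_on_continuous_on)
  then have wm: "w \<in> borel_measurable borel" by (rule borel_measurable_continuous_onI)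
  have tm: "(\<lambda>x. w (x + a)) \<in> borel_measurable borel" for a
    by (intro borel_measurable_continuous_onI continuous_intros continuous_on_compose2[OF cont]) auto
  have Dm: "D k \<in> borel_measurable borel" for k
    unfolding D_def using wm tm by simp
  obtain r where r: "K \<subseteq> cball 0 r" using bounded_subset_cball_0[OF K] by blast
  \<comment> \<open>Increments are at most 1, so enlarging the radius by 1 catches all shifted
    supports.\<close>
  have supp': "D k x = 0" if "x \<notin> cball 0 (r + 1)" for k x
  proof -
    have "norm x \<le> norm (x + inverse (real (Suc k)) *\<^sub>R axis i 1) + norm (inverse (real (Suc k)) *\<^sub>R axis i (1::real))"
      using norm_triangle_ineq4[of "x + inverse (real (Suc k)) *\<^sub>R axis i 1" "inverse (real (Suc k)) *\<^sub>R axis i 1"] by simp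
    also have "norm (inverse (real (Suc k)) *\<^sub>R axis i (1::real)) \<le> 1"
      by (simp add: norm_axis_1 field_simps)
    finally have "x + inverse (real (Suc k)) *\<^sub>R axis i 1 \<notin> K" "x \<notin> K" using that r by auto
    then show ?thesis by (simp add: D_def supp)
  qed
  have int0: "(\<integral>x. D k x \<partial>lebesgue) = 0" for k
  proof -
    have cb: "continuous_on (cball 0 (r+1)) w" using cont by (rule continuous_on_subset) auto
    obtain B where B: "\<And>x. x \<in> cball 0 (r+1) \<Longrightarrow> norm (w x) \<le> B"
      using compact_imp_bounded[OF compact_continuous_image[OF cb compact_cball]] unfolding bounded_iff by (metis image_eqI)
    have wi: "integrable lborel w"
    proof -
      have "\<bar>w x\<bar> \<le> max B 0" for x
        using B[of x] supp[of x] r by (cases "x \<in> K") auto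
      then have "integrable lebesgue w"
        using wm supp K by (intro integrable_bounded_support[where K = K and B = "max B 0"])
          (auto simp: borel_imp_lebesgue_measurable)
      then show ?thesis using wm by (simp add: integrable_completion)
    qed
    have wti: "integrable lborel (\<lambda>x. w (x + a))" for a
    proof -
      have "integrable (distr lborel borel ((+) a)) w" using wi by (simp add: lborel_distr_plus)
      then show ?thesis using wm by (subst (asm) integrable_distr_eq) (auto simp: add.commute)
    qed
    have "(\<integral>x. D k x \<partial>lebesgue) = (LBINT x. D k x)" using Dm by (intro integral_completion) auto
    also have "\<dots> = 0"
      unfolding D_def using wi wti by (simp add: lborel_integral_translate[OF wm])
    finally show ?thesis .
  qed
  have "(\<lambda>k. \<integral>x. D k x \<partial>lebesgue) \<longlonglongrightarrow> (\<integral>x. partial_deriv i w x \<partial>lebesgue)"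
  proof (rule integral_dominated_convergence)
    show "partial_deriv i w \<in> borel_measurable lebesgue" by (rule partial_deriv_measurable[OF L])
    show "D k \<in> borel_measurable lebesgue" for k using Dm by (simp add: borel_imp_lebesgue_measurable)
    show "integrable lebesgue (\<lambda>x::real^'n. indicator (cball 0 (r+1)) x *\<^sub>R L)"
      by (rule integrable_scaleR_left, rule integrable_real_indicator)
        (use emeasure_compact_finite[OF compact_cball, of 0 "r+1"] in auto)
    show "AE x in lebesgue. (\<lambda>k. D k x) \<longlonglongrightarrow> partial_deriv i w x"
      using AE_partial_deriv[OF L, of i]
      unfolding D_def by eventually_elim (rule difference_quotient_tendsto)
    show "AE x in lebesgue. norm (D k x) \<le> indicator (cball 0 (r+1)) x *\<^sub>R L" for k
    proof (rule AE_I2)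
      fix x show "norm (D k x) \<le> indicator (cball 0 (r+1)) x *\<^sub>R L"
        using supp'[of x k] abs_difference_quotient_le[OF L, of x k i]
        by (cases "x \<in> cball 0 (r+1)") (auto simp: D_def)
    qed
  qed
  then show ?thesis using int0 LIMSEQ_unique[OF _ tendsto_const] by simp
qed

lemma lipschitz_on_component:
  fixes Y :: "real^'n \<Rightarrow> real^'n"
  assumes "C-lipschitz_on S Y"
  shows "C-lipschitz_on S (\<lambda>x. Y x $ i)"
proof (rule lipschitz_onI)
  fix x y assume "x \<in> S" "y \<in> S"
  have "dist (Y x $ i) (Y y $ i) \<le> dist (Y x) (Y y)" by (rule dist_vec_nth_le)
  also have "\<dots> \<le> C * dist x y" using assms \<open>x \<in> S\<close> \<open>y \<in> S\<close> by (rule lipschitz_onD)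
  finally show "dist (Y x $ i) (Y y $ i) \<le> C * dist x y" .
qed (rule lipschitz_on_nonneg[OF assms])

lemma divergence_lebesgue:
  fixes Y :: "real^'n \<Rightarrow> real^'n"
  assumes "C-lipschitz_on UNIV Y"
  shows "divergence Y \<in> borel_measurable lebesgue"
    and "AE x in lebesgue. \<bar>divergence Y x\<bar> \<le> real CARD('n) * C"
proof -
  note Yi = lipschitz_on_component[OF assms]
  show "divergence Y \<in> borel_measurable lebesgue"
    unfolding divergence_def[abs_def] using partial_deriv_measurable[OF Yi] by (intro borel_measurable_sum) auto
  have "AE x in lebesgue. \<forall>i\<in>UNIV. \<bar>partial_deriv i (\<lambda>y. Y y $ i) x\<bar> \<le> C"
  proof (rule AE_finite_allI)
    fix i show "AE x in lebesgue. \<bar>partial_deriv i (\<lambda>y. Y y $ i) x\<bar> \<le> C"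
      using AE_partial_deriv[OF Yi[of i], of i] by eventually_elim (rule abs_partial_deriv_le[OF Yi])
  qed simp
  then show "AE x in lebesgue. \<bar>divergence Y x\<bar> \<le> real CARD('n) * C"
  proof eventually_elim
    case (elim x)
    have "\<bar>divergence Y x\<bar> \<le> (\<Sum>i\<in>UNIV. \<bar>partial_deriv i (\<lambda>y. Y y $ i) x\<bar>)"
      unfolding divergence_def by (rule sum_abs)
    also have "\<dots> \<le> (\<Sum>i\<in>(UNIV::'n set). C)" using elim by (intro sum_mono) auto
    finally show ?case by simp
  qed
qed

text \<open>Each product v Y_i is Lipschitz with bounded support, so its i-th partial derivative
  integrates to 0; summing the product rule over \<open>i\<close> gives the identity. The product
  rule holds almost everywhere: \<open>v\<close> is differentiable at all points, and Y_i has its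
  i-th partial derivative off a null set.\<close>

lemma integration_by_parts_divergence:
  fixes Y :: "real^'n \<Rightarrow> real^'n" and v :: "real^'n \<Rightarrow> real"
  assumes Y: "C-lipschitz_on UNIV Y" "\<And>x. norm (Y x) \<le> M"
    and v: "L-lipschitz_on UNIV v" "\<And>x. v differentiable (at x)" "\<And>x. x \<notin> K \<Longrightarrow> v x = 0" and K: "bounded K"
  shows "(\<integral>x. lie_deriv Y v x \<partial>lebesgue) = - (\<integral>x. v x * divergence Y x \<partial>lebesgue)"
proof -
  note Yi = lipschitz_on_component[OF Y(1)]
  have C: "C \<ge> 0" "L \<ge> 0" using Y(1) v(1) lipschitz_on_nonneg by auto
  have M: "M \<ge> 0" using Y(2)[of 0] norm_ge_zero order_trans by blast
  have vc: "continuous_on UNIV v" using v(1) by (rule lipschitz_on_continuous_on)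
  obtain r where r: "K \<subseteq> cball 0 r" using bounded_subset_cball_0[OF K] by blast
  obtain B where B: "\<And>x. \<bar>v x\<bar> \<le> B" "B \<ge> 0"
  proof -
    have cb: "continuous_on (cball 0 r) v" using vc by (rule continuous_on_subset) auto
    obtain B where B: "\<And>x. x \<in> cball 0 r \<Longrightarrow> norm (v x) \<le> B"
      using compact_imp_bounded[OF compact_continuous_image[OF cb compact_cball]] unfolding bounded_iff by (metis image_eqI)
    have "\<bar>v x\<bar> \<le> max B 0" for x using B[of x] v(3)[of x] r by (cases "x \<in> K") auto
    then show ?thesis using that[of "max B 0"] by auto
  qed
  have Yb: "\<bar>Y x $ i\<bar> \<le> M" for x i using Y(2)[of x] component_le_norm_cart[of "Y x" i] by linarith
  define w where "w i x = v x * Y x $ i" for i x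
  have wl: "(B * C + M * L)-lipschitz_on UNIV (w i)" for i
  proof (rule lipschitz_onI)
    fix x y :: "real^'n"
    have "w i x - w i y = v x * (Y x $ i - Y y $ i) + Y y $ i * (v x - v y)" by (simp add: w_def algebra_simps)
    then have "\<bar>w i x - w i y\<bar> \<le> \<bar>v x\<bar> * \<bar>Y x $ i - Y y $ i\<bar> + \<bar>Y y $ i\<bar> * \<bar>v x - v y\<bar>"
      by (metis abs_mult abs_triangle_ineq)
    also have "\<dots> \<le> B * (C * dist x y) + M * (L * dist x y)"
      using B Yb[of y i] M lipschitz_onD[OF Yi, of x y i] lipschitz_onD[OF v(1), of x y]
      by (intro add_mono mult_mono) (auto simp: dist_real_def)
    finally show "dist (w i x) (w i y) \<le> (B * C + M * L) * dist x y" by (simp add: dist_real_def algebra_simps)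
  qed (use B M C in auto)
  have dv: "((\<lambda>s. v (x + s *\<^sub>R axis i 1)) has_real_derivative partial_deriv i v x) (at 0)" for x i
  proof -
    obtain D where "(v has_derivative D) (at x)" using v(2) by (auto simp: differentiable_def)
    then show ?thesis using partial_deriv_has_derivative by metis
  qed
  have pw: "AE x in lebesgue. partial_deriv i (w i) x = Y x $ i * partial_deriv i v x + v x * partial_deriv i (\<lambda>y. Y y $ i) x" for i
    using AE_partial_deriv[OF Yi[of i], of i]
  proof eventually_elim
    case (elim x)
    have "((\<lambda>s. w i (x + s *\<^sub>R axis i 1)) has_real_derivative
      Y x $ i * partial_deriv i v x + v x * partial_deriv i (\<lambda>y. Y y $ i) x) (at 0)"
      unfolding w_def by (rule DERIV_cong[OF DERIV_mult[OF dv elim]]) (simp add: algebra_simps)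
    then show ?case by (rule partial_deriv_eqI)
  qed
  have vm: "v \<in> borel_measurable lebesgue"
    using borel_measurable_continuous_onI[OF vc] by (simp add: borel_imp_lebesgue_measurable)
  have Ym: "(\<lambda>x. Y x $ i) \<in> borel_measurable lebesgue" for i
    using borel_measurable_continuous_onI[OF lipschitz_on_continuous_on[OF Yi]] by (simp add: borel_imp_lebesgue_measurable)
  have pv0: "partial_deriv i v x = 0" if "x \<notin> cball 0 r" for i x
  proof -
    have v0: "v y = 0" if "y \<notin> cball 0 r" for y using that v(3) r by blast
    show ?thesis
      by (rule partial_deriv_has_derivative(2)[OF has_derivative_0_outside_support[OF closed_cball v0 that]])
  qed
  have i1: "integrable lebesgue (\<lambda>x. Y x $ i * partial_deriv i v x)" for i
  proof (rule integrable_bounded_support[where K = "cball 0 r" and B = "M * L"])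
    show "AE x in lebesgue. \<bar>Y x $ i * partial_deriv i v x\<bar> \<le> M * L"
      using Yb M abs_partial_deriv_le[OF v(1) dv] by (auto simp: abs_mult intro!: mult_mono)
  qed (use Ym partial_deriv_measurable[OF v(1)] pv0 in auto)
  have i2: "integrable lebesgue (\<lambda>x. v x * partial_deriv i (\<lambda>y. Y y $ i) x)" for i
  proof (rule integrable_bounded_support[where K = K and B = "B * C"])
    show "AE x in lebesgue. \<bar>v x * partial_deriv i (\<lambda>y. Y y $ i) x\<bar> \<le> B * C"
      using AE_partial_deriv[OF Yi[of i], of i]
    proof eventually_elim
      case (elim x)
      then show ?case using B abs_partial_deriv_le[OF Yi elim] by (auto simp: abs_mult intro!: mult_mono)
    qed
  qed (use vm partial_deriv_measurable[OF Yi] v(3) K in auto)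
  have "(\<integral>x. Y x $ i * partial_deriv i v x \<partial>lebesgue) + (\<integral>x. v x * partial_deriv i (\<lambda>y. Y y $ i) x \<partial>lebesgue) = 0" for i
  proof -
    have "(\<integral>x. partial_deriv i (w i) x \<partial>lebesgue) = 0"
      using v(3) K by (intro integral_partial_deriv_eq_0[OF wl, where K = K]) (auto simp: w_def)
    moreover have "(\<integral>x. partial_deriv i (w i) x \<partial>lebesgue) =
        (\<integral>x. Y x $ i * partial_deriv i v x + v x * partial_deriv i (\<lambda>y. Y y $ i) x \<partial>lebesgue)"
      using i1 i2 by (intro integral_cong_AE pw partial_deriv_measurable[OF wl] borel_measurable_add)
        (auto dest: borel_measurable_integrable)
    ultimately show ?thesis using i1[of i] i2[of i] by simp
  qed
  then have "(\<Sum>i\<in>UNIV. (\<integral>x. Y x $ i * partial_deriv i v x \<partial>lebesgue)) + (\<Sum>i\<in>UNIV. (\<integral>x. v x * partial_deriv i (\<lambda>y. Y y $ i) x \<partial>lebesgue)) = 0"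
    by (simp flip: sum.distrib)
  moreover have "(\<integral>x. lie_deriv Y v x \<partial>lebesgue) = (\<Sum>i\<in>UNIV. (\<integral>x. Y x $ i * partial_deriv i v x \<partial>lebesgue))"
    unfolding lie_deriv_def using i1 by (intro Bochner_Integration.integral_sum)
  moreover have "(\<integral>x. v x * divergence Y x \<partial>lebesgue) = (\<Sum>i\<in>UNIV. (\<integral>x. v x * partial_deriv i (\<lambda>y. Y y $ i) x \<partial>lebesgue))"
    unfolding divergence_def sum_distrib_left using i2 by (intro Bochner_Integration.integral_sum)
  ultimately show ?thesis by linarith
qed

section \<open>Volume distortion of Lipschitz maps\<close>

lemma infnorm_le_iff:
  fixes x :: "'a::euclidean_space"
  shows "infnorm x \<le> r \<longleftrightarrow> (\<forall>i\<in>Basis. \<bar>x \<bullet> i\<bar> \<le> r)"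
  by (simp add: infnorm_Max)

text \<open>The set is covered by dyadic cubes with disjoint interiors inside an open set barely
  larger than it. In the maximum norm a cube of side 2s is a ball of radius s, so its image fits
  into a cube of side 2cs.\<close>

lemma emeasure_image_infnorm_lipschitz_bounded:
  fixes T :: "'a::euclidean_space \<Rightarrow> 'a"
  assumes lip: "\<And>x y. infnorm (T x - T y) \<le> c * infnorm (x - y)" and c: "0 \<le> c"
    and A: "A \<in> sets borel" "A \<subseteq> cbox (- (N *\<^sub>R One)) (N *\<^sub>R One)" and N: "N > 0"
    and TA: "T ` A \<in> sets borel"
  shows "emeasure lborel (T ` A) \<le> ennreal (c ^ DIM('a)) * emeasure lborel A"
proof (rule ennreal_le_epsilon)
  fix \<epsilon> :: real assume "\<epsilon> > 0"
  define k where "k = c ^ DIM('a)"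
  have k: "0 \<le> k" using c by (simp add: k_def)
  define \<eta> where "\<eta> = \<epsilon> / (k + 1)"
  have \<eta>: "\<eta> > 0" "k * \<eta> \<le> \<epsilon>" using \<open>\<epsilon> > 0\<close> k by (auto simp: \<eta>_def field_simps)
  obtain U where U: "open U" "A \<subseteq> U" and UA: "emeasure lborel U \<le> emeasure lborel A + ennreal \<eta>"
    by (rule lborel_outer_open[OF A(1) \<eta>(1)])
  \<comment> \<open>The covering lemma supplies for every cube a point of \<open>A\<close> whose
    gauge set contains the cube, so this choice forces all cubes into \<open>U\<close>; the value
    off \<open>A\<close> plays the role of no constraint.\<close>
  define g where "g x = (if x \<in> A then U else UNIV)" for x
  have "gauge g" using U by (auto simp: gauge_def g_def)
  moreover have "box (- (N *\<^sub>R One)) (N *\<^sub>R (One::'a)) \<noteq> {}"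
    using N by (auto simp: box_ne_empty inner_diff_left)
  ultimately obtain \<D> where D: "countable \<D>"
    "\<And>K. K \<in> \<D> \<Longrightarrow> interior K \<noteq> {} \<and> (\<exists>c d. K = cbox c d)"
    "pairwise (\<lambda>A B. interior A \<inter> interior B = {}) \<D>"
    "\<And>K. K \<in> \<D> \<Longrightarrow> \<exists>x \<in> A \<inter> K. K \<subseteq> g x"
    "\<And>u v. cbox u v \<in> \<D> \<Longrightarrow> \<exists>n. \<forall>i \<in> Basis. v \<bullet> i - u \<bullet> i = ((N *\<^sub>R One) \<bullet> i - (- (N *\<^sub>R One)) \<bullet> i) / 2^n"
    "A \<subseteq> \<Union>\<D>"
    using covering_lemma[OF A(2), of g] by metis
  have cube: "\<exists>Q \<in> sets borel. T ` K \<subseteq> Q \<and> emeasure lborel Q \<le> ennreal k * emeasure lborel (interior K)"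
    if K: "K \<in> \<D>" for K
  proof -
    obtain u v where uv: "K = cbox u v" using D(2)[OF K] by blast
    obtain s where s: "\<And>i. i \<in> Basis \<Longrightarrow> v \<bullet> i - u \<bullet> i = 2 * s" "s > 0"
    proof -
      obtain n where "\<forall>i \<in> Basis. v \<bullet> i - u \<bullet> i = ((N *\<^sub>R One) \<bullet> i - (- (N *\<^sub>R One)) \<bullet> i) / 2^n"
        using D(5) K unfolding uv by blast
      then show ?thesis using N by (intro that[of "N / 2^n"]) auto
    qed
    \<comment> \<open>\<open>m\<close> is the centre of the cube and \<open>s\<close> half its side,
      so \<open>K\<close> is the ball of radius \<open>s\<close> about \<open>m\<close> in the
      maximum norm.\<close>
    define m where "m = (1/2) *\<^sub>R (u + v)"
    define Q where "Q = cbox (T m - (c * s) *\<^sub>R One) (T m + (c * s) *\<^sub>R One)"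
    have "T ` K \<subseteq> Q"
    proof
      fix y assume "y \<in> T ` K"
      then obtain x where x: "x \<in> cbox u v" "y = T x" by (auto simp: uv)
      have "infnorm (x - m) \<le> s"
        unfolding infnorm_le_iff
      proof
        fix i :: 'a assume i: "i \<in> Basis"
        have "u \<bullet> i \<le> x \<bullet> i" "x \<bullet> i \<le> v \<bullet> i" using x i by (auto simp: mem_box)
        then show "\<bar>(x - m) \<bullet> i\<bar> \<le> s"
          using s(1)[OF i] by (simp add: m_def inner_diff_left inner_add_left abs_le_iff field_simps)
      qed
      then have "infnorm (T x - T m) \<le> c * s"
        using lip[of x m] c by (meson mult_left_mono order_trans)
      then show "y \<in> Q"
        unfolding infnorm_le_iff Q_def mem_box x(2)
        by (auto simp: inner_diff_left inner_add_left abs_le_iff algebra_simps)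
    qed
    moreover have "emeasure lborel Q = ennreal ((2 * (c * s)) ^ DIM('a))"
      unfolding Q_def using c s(2)
      by (subst emeasure_lborel_cbox) (auto simp: inner_diff_left inner_add_left)
    moreover have "emeasure lborel (interior K) = ennreal ((2 * s) ^ DIM('a))"
    proof -
      have "emeasure lborel (interior K) = ennreal (\<Prod>b\<in>Basis. (v - u) \<bullet> b)"
        unfolding uv interior_cbox using s by (intro emeasure_lborel_box) force
      also have "(\<Prod>b\<in>Basis. (v - u) \<bullet> b) = (\<Prod>b\<in>(Basis::'a set). 2 * s)"
        using s(1) by (intro prod.cong) (auto simp: inner_diff_left)
      finally show ?thesis by simp
    qed
    ultimately show ?thesis
      using c s(2) by (intro bexI[of _ Q])
        (auto simp: k_def ennreal_mult[symmetric] power_mult_distrib mult_ac Q_def)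
  qed
  then obtain Q where Q: "\<And>K. K \<in> \<D> \<Longrightarrow> Q K \<in> sets borel" "\<And>K. K \<in> \<D> \<Longrightarrow> T ` K \<subseteq> Q K"
    "\<And>K. K \<in> \<D> \<Longrightarrow> emeasure lborel (Q K) \<le> ennreal k * emeasure lborel (interior K)"
    by metis
  define I where "I = to_nat_on \<D> ` \<D>"
  define F where "F = from_nat_into \<D>"
  have F: "F i \<in> \<D>" if "i \<in> I" for i using that D(1) by (auto simp: I_def F_def)
  have Fsurj: "\<exists>i\<in>I. F i = K" if "K \<in> \<D>" for K using that D(1) by (auto simp: I_def F_def)
  have Finj: "i = j" if "i \<in> I" "j \<in> I" "F i = F j" for i j using that D(1) by (auto simp: I_def F_def)
  define Q' where "Q' i = (if i \<in> I then Q (F i) else {})" for i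
  \<comment> \<open>Neighbouring cubes share faces; passing to interiors makes the family disjoint
    without loss of volume.\<close>
  define J where "J i = (if i \<in> I then interior (F i) else {})" for i
  have J: "J i \<in> sets borel" for i by (auto simp: J_def)
  have Q': "Q' i \<in> sets borel" for i using Q F by (auto simp: Q'_def)
  have "disjoint_family J"
    unfolding disjoint_family_on_def
  proof (intro ballI impI)
    fix i j :: nat assume "i \<noteq> j"
    then have "interior (F i) \<inter> interior (F j) = {}" if "i \<in> I" "j \<in> I"
      using D(3) F Finj that unfolding pairwise_def by metis
    then show "J i \<inter> J j = {}" by (auto simp: J_def)
  qed
  have "emeasure lborel (T ` A) \<le> emeasure lborel (\<Union>i. Q' i)"
  proof (rule emeasure_mono)
    show "T ` A \<subseteq> (\<Union>i. Q' i)"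
    proof (rule image_subsetI)
      fix x assume "x \<in> A"
      then obtain K where "K \<in> \<D>" "x \<in> K" using D(6) by blast
      then obtain i where "i \<in> I" "F i = K" using Fsurj by blast
      then show "T x \<in> (\<Union>i. Q' i)" using Q(2)[OF \<open>K \<in> \<D>\<close>] \<open>x \<in> K\<close> by (auto simp: Q'_def)
    qed
  qed (use Q' in auto)
  also have "\<dots> \<le> (\<Sum>i. emeasure lborel (Q' i))"
    using Q' by (intro emeasure_subadditive_countably) auto
  also have "\<dots> \<le> (\<Sum>i. ennreal k * emeasure lborel (J i))"
    using Q(3) F by (intro suminf_le) (auto simp: Q'_def J_def)
  also have "\<dots> = ennreal k * (\<Sum>i. emeasure lborel (J i))" by (rule ennreal_suminf_cmult)
  also have "(\<Sum>i. emeasure lborel (J i)) = emeasure lborel (\<Union>i. J i)"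
    using J \<open>disjoint_family J\<close> by (intro suminf_emeasure) auto
  also have "ennreal k * emeasure lborel (\<Union>i. J i) \<le> ennreal k * emeasure lborel U"
  proof (intro mult_left_mono emeasure_mono)
    show "(\<Union>i. J i) \<subseteq> U"
    proof (rule UN_least)
      fix i show "J i \<subseteq> U"
        using D(4)[OF F, of i] interior_subset by (auto simp: J_def g_def split: if_splits)
    qed
  qed (use U in auto)
  also have "\<dots> \<le> ennreal k * (emeasure lborel A + ennreal \<eta>)"
    using UA by (intro mult_left_mono) auto
  also have "\<dots> = ennreal k * emeasure lborel A + ennreal (k * \<eta>)"
    using k \<eta> by (simp add: distrib_left ennreal_mult[symmetric])
  also have "\<dots> \<le> ennreal k * emeasure lborel A + ennreal \<epsilon>"
    using \<eta> by (intro add_left_mono ennreal_leI)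
  finally show "emeasure lborel (T ` A) \<le> ennreal (c ^ DIM('a)) * emeasure lborel A + ennreal \<epsilon>"
    by (simp add: k_def)
qed

text \<open>Exhaustion by boxes reduces this to bounded sets. The image under \<open>T\<close> is
  written as the preimage under its inverse \<open>P\<close>, so that measurability follows from
  continuity and the bound speaks of the distribution of \<open>P\<close>.\<close>

lemma emeasure_vimage_infnorm_lipschitz:
  fixes T P :: "'a::euclidean_space \<Rightarrow> 'a"
  assumes lip: "\<And>x y. infnorm (T x - T y) \<le> c * infnorm (x - y)" and c: "0 \<le> c"
    and inv: "\<And>x. P (T x) = x" "\<And>x. T (P x) = x" and P: "continuous_on UNIV P"
    and A: "A \<in> sets borel"
  shows "emeasure lborel (P -` A) \<le> ennreal (c ^ DIM('a)) * emeasure lborel A"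
proof -
  define B where "B n = A \<inter> cbox (- (real (Suc n) *\<^sub>R One)) (real (Suc n) *\<^sub>R One)" for n
  have im: "T ` S = P -` S" for S using inv by (auto simp: image_iff) metis
  have B: "B n \<in> sets borel" for n using A by (auto simp: B_def)
  have PB: "P -` B n \<in> sets borel" for n
    using measurable_sets_borel[OF borel_measurable_continuous_onI[OF P] B] by simp
  have le: "emeasure lborel (P -` B n) \<le> ennreal (c ^ DIM('a)) * emeasure lborel A" for n
  proof -
    have "emeasure lborel (T ` B n) \<le> ennreal (c ^ DIM('a)) * emeasure lborel (B n)"
      using emeasure_image_infnorm_lipschitz_bounded[OF lip c B, where N = "real (Suc n)"] PB
      by (auto simp: B_def im)
    also have "\<dots> \<le> ennreal (c ^ DIM('a)) * emeasure lborel A"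
      using A by (intro mult_left_mono emeasure_mono) (auto simp: B_def)
    finally show ?thesis by (simp add: im)
  qed
  have inc: "incseq (\<lambda>n. P -` B n)"
  proof (rule incseq_SucI, rule vimage_mono)
    fix n show "B n \<subseteq> B (Suc n)"
      unfolding B_def by (intro Int_mono subset_box_imp order_refl) auto
  qed
  have un: "(\<Union>n. P -` B n) = P -` A"
  proof -
    have "\<exists>n. x \<in> cbox (- (real (Suc n) *\<^sub>R One)) (real (Suc n) *\<^sub>R (One::'a))" for x
    proof -
      obtain n where n: "infnorm x \<le> real n" using real_arch_simple by blast
      then have "\<bar>x \<bullet> i\<bar> \<le> real n" if "i \<in> Basis" for i using Basis_le_infnorm that by (meson order_trans)
      then show ?thesis by (intro exI[of _ n]) (force simp: mem_box abs_le_iff)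
    qed
    then show ?thesis by (auto simp: B_def)
  qed
  have "emeasure lborel (P -` A) = (SUP n. emeasure lborel (P -` B n))"
    unfolding un[symmetric] using PB inc by (subst SUP_emeasure_incseq) auto
  also have "\<dots> \<le> ennreal (c ^ DIM('a)) * emeasure lborel A"
    using le by (intro SUP_least)
  finally show ?thesis .
qed

text \<open>The setwise bound places \<open>M\<close> below the rescaled measure, and the integral
  is monotone in the measure.\<close>

lemma nn_integral_le_of_emeasure_le:
  assumes "sets M = sets N" and "\<And>A. A \<in> sets N \<Longrightarrow> emeasure M A \<le> c * emeasure N A"
    and "\<phi> \<in> borel_measurable N"
  shows "(\<integral>\<^sup>+x. \<phi> x \<partial>M) \<le> c * (\<integral>\<^sup>+x. \<phi> x \<partial>N)"
proof -
  have "M \<le> scale_measure c N"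
    using assms by (subst le_measure) auto
  then have "(\<integral>\<^sup>+x. \<phi> x \<partial>M) \<le> (\<integral>\<^sup>+x. \<phi> x \<partial>scale_measure c N)"
    using assms by (intro nn_integral_mono_measure) auto
  also have "\<dots> = c * (\<integral>\<^sup>+x. \<phi> x \<partial>N)"
    using assms by (intro nn_integral_scale_measure)
  finally show ?thesis .
qed

text \<open>A one-sided substitute for the change of variables formula; applied to a map and to its
  inverse it controls integrals from both sides.\<close>

lemma nn_integral_infnorm_lipschitz_le:
  fixes T P :: "'a::euclidean_space \<Rightarrow> 'a"
  assumes lip: "\<And>x y. infnorm (T x - T y) \<le> c * infnorm (x - y)" and c: "0 \<le> c"
    and inv: "\<And>x. P (T x) = x" "\<And>x. T (P x) = x" and P: "continuous_on UNIV P"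
    and \<phi>: "\<phi> \<in> borel_measurable borel"
  shows "(\<integral>\<^sup>+x. \<phi> (P x) \<partial>lborel) \<le> ennreal (c ^ DIM('a)) * (\<integral>\<^sup>+x. \<phi> x \<partial>lborel)"
proof -
  have Pm: "P \<in> borel_measurable borel" by (rule borel_measurable_continuous_onI[OF P])
  have "(\<integral>\<^sup>+x. \<phi> (P x) \<partial>lborel) = (\<integral>\<^sup>+x. \<phi> x \<partial>distr lborel borel P)"
    using \<phi> Pm by (subst nn_integral_distr) auto
  also have "\<dots> \<le> ennreal (c ^ DIM('a)) * (\<integral>\<^sup>+x. \<phi> x \<partial>lborel)"
    using \<phi> Pm emeasure_vimage_infnorm_lipschitz[OF lip c inv P]
    by (intro nn_integral_le_of_emeasure_le) (auto simp: emeasure_distr)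
  finally show ?thesis .
qed

section \<open>Flows of Lipschitz fields\<close>

lemma infnorm_lipschitz:
  fixes Y :: "'a::euclidean_space \<Rightarrow> 'a"
  assumes Y: "C-lipschitz_on S Y" and xy: "x \<in> S" "y \<in> S"
  shows "infnorm (Y x - Y y) \<le> C * sqrt DIM('a) * infnorm (x - y)"
proof -
  have "infnorm (Y x - Y y) \<le> norm (Y x - Y y)" by (rule infnorm_le_norm)
  also have "\<dots> \<le> C * norm (x - y)" using lipschitz_onD[OF Y xy] by (simp add: dist_norm)
  also have "\<dots> \<le> C * (sqrt DIM('a) * infnorm (x - y))"
    using norm_le_infnorm lipschitz_on_nonneg[OF Y] by (intro mult_left_mono) auto
  finally show ?thesis by (simp add: mult.assoc)
qed

lemma continuous_on_if_has_vector_derivative: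
  assumes "\<And>t. t \<in> S \<Longrightarrow> (\<gamma> has_vector_derivative \<gamma>' t) (at t within S)"
  shows "continuous_on S \<gamma>"
  using assms has_vector_derivative_continuous unfolding continuous_on_eq_continuous_within by blast

text \<open>A replacement for Gronwall's inequality on short intervals. If m is the largest
  separation, every coordinate of the difference changes at most by \<Lambda> m (b - a); hence m is
  at most the separation at \<open>t0\<close> plus \<Lambda> m (b - a), and one solves for m.
  Uniqueness, dependence on the starting point and the inverse property all come from this
  estimate.\<close>

lemma integral_curves_separation:
  fixes \<gamma> \<delta> :: "real \<Rightarrow> 'a::euclidean_space"
  assumes lip: "\<And>x y. x \<in> S \<Longrightarrow> y \<in> S \<Longrightarrow> infnorm (X x - X y) \<le> \<Lambda> * infnorm (x - y)" and \<Lambda>: "\<Lambda> \<ge> 0"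
    and t0: "t0 \<in> {a..b}" and small: "\<Lambda> * (b - a) < 1"
    and \<gamma>: "\<And>t. t \<in> {a..b} \<Longrightarrow> (\<gamma> has_vector_derivative X (\<gamma> t)) (at t within {a..b})" "\<And>t. t \<in> {a..b} \<Longrightarrow> \<gamma> t \<in> S"
    and \<delta>: "\<And>t. t \<in> {a..b} \<Longrightarrow> (\<delta> has_vector_derivative X (\<delta> t)) (at t within {a..b})" "\<And>t. t \<in> {a..b} \<Longrightarrow> \<delta> t \<in> S"
    and t: "t \<in> {a..b}"
  shows "infnorm (\<gamma> t - \<delta> t) \<le> infnorm (\<gamma> t0 - \<delta> t0) / (1 - \<Lambda> * (b - a))"
proof -
  have c\<gamma>: "continuous_on {a..b} \<gamma>" using \<gamma>(1) by (rule continuous_on_if_has_vector_derivative)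
  have c\<delta>: "continuous_on {a..b} \<delta>" using \<delta>(1) by (rule continuous_on_if_has_vector_derivative)
  have "continuous_on {a..b} (\<lambda>t. infnorm (\<gamma> t - \<delta> t))" by (intro continuous_intros c\<gamma> c\<delta>)
  then obtain s where s: "s \<in> {a..b}" "\<And>r. r \<in> {a..b} \<Longrightarrow> infnorm (\<gamma> r - \<delta> r) \<le> infnorm (\<gamma> s - \<delta> s)"
    using continuous_attains_sup[of "{a..b}" "\<lambda>t. infnorm (\<gamma> t - \<delta> t)"] t by auto
  define m where "m = infnorm (\<gamma> s - \<delta> s)"
  have m: "m \<ge> 0" by (simp add: m_def infnorm_pos_le)
  have "infnorm ((\<gamma> s - \<delta> s) - (\<gamma> t0 - \<delta> t0)) \<le> \<Lambda> * m * (b - a)"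
    unfolding infnorm_le_iff
  proof
    fix i :: 'a assume i: "i \<in> Basis"
    define f where "f r = (\<gamma> r - \<delta> r) \<bullet> i" for r
    have "norm (f s - f t0) \<le> (\<Lambda> * m) * norm (s - t0)"
    proof (rule field_differentiable_bound[where S = "{a..b}" and f' = "\<lambda>r. (X (\<gamma> r) - X (\<delta> r)) \<bullet> i"])
      fix r assume r: "r \<in> {a..b}"
      have "((\<lambda>r. \<gamma> r - \<delta> r) has_vector_derivative X (\<gamma> r) - X (\<delta> r)) (at r within {a..b})"
        by (intro derivative_intros \<gamma> \<delta> r)
      from bounded_linear.has_vector_derivative[OF bounded_linear_inner_left this]
      show "(f has_field_derivative (X (\<gamma> r) - X (\<delta> r)) \<bullet> i) (at r within {a..b})"
        by (simp add: f_def[abs_def] has_real_derivative_iff_has_vector_derivative)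
      have "\<bar>(X (\<gamma> r) - X (\<delta> r)) \<bullet> i\<bar> \<le> infnorm (X (\<gamma> r) - X (\<delta> r))" by (rule Basis_le_infnorm[OF i])
      also have "\<dots> \<le> \<Lambda> * infnorm (\<gamma> r - \<delta> r)" using \<gamma>(2) \<delta>(2) r by (intro lip)
      also have "\<dots> \<le> \<Lambda> * m" using s(2)[OF r] \<Lambda> by (auto simp: m_def intro: mult_left_mono)
      finally show "norm ((X (\<gamma> r) - X (\<delta> r)) \<bullet> i) \<le> \<Lambda> * m" by simp
    qed (use s t0 in auto)
    also have "\<dots> \<le> (\<Lambda> * m) * (b - a)" using s t0 \<Lambda> m by (intro mult_left_mono) auto
    finally show "\<bar>((\<gamma> s - \<delta> s) - (\<gamma> t0 - \<delta> t0)) \<bullet> i\<bar> \<le> \<Lambda> * m * (b - a)"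
      by (simp add: f_def inner_diff_left)
  qed
  moreover have "m \<le> infnorm (\<gamma> t0 - \<delta> t0) + infnorm ((\<gamma> s - \<delta> s) - (\<gamma> t0 - \<delta> t0))"
    unfolding m_def using infnorm_triangle[of "\<gamma> t0 - \<delta> t0" "(\<gamma> s - \<delta> s) - (\<gamma> t0 - \<delta> t0)"] by simp
  ultimately have "m * (1 - \<Lambda> * (b - a)) \<le> infnorm (\<gamma> t0 - \<delta> t0)" by (simp add: algebra_simps)
  then have "m \<le> infnorm (\<gamma> t0 - \<delta> t0) / (1 - \<Lambda> * (b - a))" using small by (simp add: pos_le_divide_eq)
  then show ?thesis using s(2)[OF t] by (simp add: m_def)
qed

text \<open>Banach's fixed point theorem in the space of bounded continuous functions on the whole
  line. Clamping the time to [-\<tau>, \<tau>] makes the integral operator produce curves that are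
  constant beyond the ends, hence bounded.\<close>

lemma picard_lindelof_short_time:
  fixes Y :: "'a::euclidean_space \<Rightarrow> 'a"
  assumes Y: "C-lipschitz_on UNIV Y" and \<tau>: "\<tau> > 0" "6 * C * \<tau> \<le> 1"
  shows "\<exists>\<gamma>. continuous_on UNIV \<gamma> \<and> \<gamma> 0 = x \<and> (\<forall>t. \<gamma> t = \<gamma> (max (-\<tau>) (min \<tau> t))) \<and>
    (\<forall>t\<in>{-\<tau>..\<tau>}. (\<gamma> has_vector_derivative Y (\<gamma> t)) (at t within {-\<tau>..\<tau>}))"
proof -
  have C: "C \<ge> 0" using Y by (rule lipschitz_on_nonneg)
  have Yc: "continuous_on UNIV Y" using Y by (rule lipschitz_on_continuous_on)
  define cl where "cl t = max (-\<tau>) (min \<tau> t)" for t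
  have cl: "cl t \<in> {-\<tau>..\<tau>}" for t using \<tau> by (auto simp: cl_def)
  have cl_id: "cl t = t" if "t \<in> {-\<tau>..\<tau>}" for t using that by (auto simp: cl_def)
  have clc: "continuous_on UNIV cl" unfolding cl_def by (intro continuous_intros)
  \<comment> \<open>Integrating from -\<tau> and subtracting the integral up to 0 expresses the
    integral from 0 to \<open>t\<close> for both signs of \<open>t\<close>.\<close>
  define G where "G \<gamma> t = x + integral {-\<tau>..cl t} (\<lambda>s. Y (\<gamma> s)) - integral {-\<tau>..0} (\<lambda>s. Y (\<gamma> s))"
    for \<gamma> :: "real \<Rightarrow> 'a" and t
  have Y\<gamma>: "continuous_on S (\<lambda>s. Y (\<gamma> s))" if "continuous_on UNIV \<gamma>" for \<gamma> :: "real \<Rightarrow> 'a" and S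
    by (rule continuous_on_compose2[OF Yc]) (use that continuous_on_subset in auto)
  have Gd: "(G \<gamma> has_vector_derivative Y (\<gamma> t)) (at t within {-\<tau>..\<tau>})"
    if "continuous_on UNIV \<gamma>" "t \<in> {-\<tau>..\<tau>}" for \<gamma> t
  proof -
    have "((\<lambda>u. x + integral {-\<tau>..u} (\<lambda>s. Y (\<gamma> s)) - integral {-\<tau>..0} (\<lambda>s. Y (\<gamma> s))) has_vector_derivative 0 + Y (\<gamma> t) - 0)
      (at t within {-\<tau>..\<tau>})"
      by (intro derivative_intros integral_has_vector_derivative Y\<gamma> that)
    from has_vector_derivative_transform[OF that(2) _ this, of "G \<gamma>"] show ?thesis
      using cl_id by (simp add: G_def)
  qed
  have Gc: "continuous_on UNIV (G \<gamma>)" if "continuous_on UNIV \<gamma>" for \<gamma>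
  proof -
    have "continuous_on {-\<tau>..\<tau>} (G \<gamma>)"
      using Gd[OF that] by (rule continuous_on_if_has_vector_derivative)
    then have "continuous_on UNIV (\<lambda>t. G \<gamma> (cl t))"
      by (rule continuous_on_compose2[OF _ clc]) (use cl in auto)
    then show ?thesis by (simp add: G_def[abs_def] cl_id[OF cl])
  qed
  have Gb: "G \<gamma> \<in> bcontfun" if "continuous_on UNIV \<gamma>" for \<gamma>
  proof -
    have "compact (G \<gamma> ` {-\<tau>..\<tau>})"
      by (intro compact_continuous_image continuous_on_subset[OF Gc[OF that]]) auto
    then have "bounded (G \<gamma> ` {-\<tau>..\<tau>})" by (rule compact_imp_bounded)
    moreover have "range (G \<gamma>) \<subseteq> G \<gamma> ` {-\<tau>..\<tau>}"
    proof (rule image_subsetI)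
      fix t show "G \<gamma> t \<in> G \<gamma> ` {-\<tau>..\<tau>}"
        by (rule image_eqI[OF _ cl[of t]]) (simp add: G_def cl_id[OF cl])
    qed
    ultimately show ?thesis using Gc[OF that] bounded_subset by (auto simp: bcontfun_def)
  qed
  define F where "F \<gamma> = Bcontfun (G (apply_bcontfun \<gamma>))" for \<gamma> :: "real \<Rightarrow>\<^sub>C 'a"
  have bc: "continuous_on UNIV (apply_bcontfun \<gamma>)" for \<gamma> :: "real \<Rightarrow>\<^sub>C 'a"
    using apply_bcontfun[of \<gamma>] by (simp add: bcontfun_def)
  have F: "apply_bcontfun (F \<gamma>) = G (apply_bcontfun \<gamma>)" for \<gamma>
    unfolding F_def by (rule Bcontfun_inverse) (rule Gb[OF bc])
  \<comment> \<open>Two integrals over intervals of length at most 2 \<tau> contribute the factor 4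
    C \<tau>, which is at most 2/3 because 6 C \<tau> <= 1.\<close>
  have "dist (F \<gamma>) (F \<delta>) \<le> 2/3 * dist \<gamma> \<delta>" for \<gamma> \<delta>
  proof (rule dist_bound)
    fix t
    define D where "D s = Y (apply_bcontfun \<gamma> s) - Y (apply_bcontfun \<delta> s)" for s
    have Db: "norm (D s) \<le> C * dist \<gamma> \<delta>" for s
    proof -
      have "norm (D s) \<le> C * dist (apply_bcontfun \<gamma> s) (apply_bcontfun \<delta> s)"
        unfolding D_def using lipschitz_onD[OF Y] by (simp add: dist_norm)
      also have "\<dots> \<le> C * dist \<gamma> \<delta>" using C dist_bounded by (intro mult_left_mono) auto
      finally show ?thesis .
    qed
    have Dint: "norm (integral {-\<tau>..u} D) \<le> C * dist \<gamma> \<delta> * (2 * \<tau>)" if "u \<in> {-\<tau>..\<tau>}" for u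
    proof -
      have "norm (integral {-\<tau>..u} D) \<le> (C * dist \<gamma> \<delta>) * (u - (-\<tau>))"
        using that Db unfolding D_def
        by (intro integral_bound continuous_intros Y\<gamma> bc) auto
      also have "\<dots> \<le> (C * dist \<gamma> \<delta>) * (2 * \<tau>)" using that C by (intro mult_left_mono) auto
      finally show ?thesis .
    qed
    have 0: "0 \<in> {-\<tau>..\<tau>}" using \<tau> by auto
    have "G (apply_bcontfun \<gamma>) t - G (apply_bcontfun \<delta>) t = integral {-\<tau>..cl t} D - integral {-\<tau>..0} D"
      unfolding G_def D_def
      by (subst (1 2) integral_diff) (auto intro!: integrable_continuous_real Y\<gamma> bc)
    then have "norm (G (apply_bcontfun \<gamma>) t - G (apply_bcontfun \<delta>) t) \<le> C * dist \<gamma> \<delta> * (2 * \<tau>) + C * dist \<gamma> \<delta> * (2 * \<tau>)"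
      using Dint[OF cl] Dint[OF 0] norm_triangle_ineq4 by (smt (verit))
    also have "\<dots> = 4 * C * \<tau> * dist \<gamma> \<delta>" by simp
    also have "\<dots> \<le> (4/6) * dist \<gamma> \<delta>" using \<tau>(2) by (intro mult_right_mono) auto
    finally show "dist (apply_bcontfun (F \<gamma>) t) (apply_bcontfun (F \<delta>) t) \<le> 2/3 * dist \<gamma> \<delta>"
      by (simp add: F dist_norm)
  qed
  then have "\<exists>!\<gamma>. F \<gamma> = \<gamma>"
    by (intro banach_fix_type[of "2/3"]) auto
  then obtain g where g: "F g = g" by blast
  define \<gamma> where "\<gamma> = apply_bcontfun g"
  have fix\<gamma>: "G \<gamma> = \<gamma>" using F[of g] by (simp add: g \<gamma>_def)
  have c\<gamma>: "continuous_on UNIV \<gamma>" unfolding \<gamma>_def by (rule bc)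
  show ?thesis
  proof (intro exI[of _ \<gamma>] conjI allI ballI)
    show "\<gamma> 0 = x" using \<tau> by (subst fix\<gamma>[symmetric]) (simp add: G_def cl_def)
    show "\<gamma> t = \<gamma> (max (-\<tau>) (min \<tau> t))" for t
      unfolding cl_def[symmetric] by (subst (1 2) fix\<gamma>[symmetric]) (simp add: G_def cl_id[OF cl])
    show "(\<gamma> has_vector_derivative Y (\<gamma> t)) (at t within {-\<tau>..\<tau>})" if "t \<in> {-\<tau>..\<tau>}" for t
      using Gd[OF c\<gamma> that] by (simp add: fix\<gamma>)
  qed (rule c\<gamma>)
qed

text \<open>The maximum norm is used because its balls are cubes: a \<open>c\<close>-Lipschitz map for this norm enlarges
  volumes at most by \<open>c ^ DIM\<close>, with no further constant.\<close>

locale short_time_flow =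
  fixes Y :: "'a::euclidean_space \<Rightarrow> 'a" and \<Psi> :: "real \<Rightarrow> 'a \<Rightarrow> 'a" and \<tau> \<Lambda> M :: real
  assumes \<tau>: "\<tau> > 0" and \<Lambda>: "\<Lambda> \<ge> 0" and M: "M \<ge> 0" and \<Lambda>\<tau>: "\<Lambda> * \<tau> \<le> 1/6"
    and start: "\<And>x. \<Psi> 0 x = x"
    and derivative: "\<And>t x. t \<in> {-\<tau>..\<tau>} \<Longrightarrow>
      ((\<lambda>s. \<Psi> s x) has_vector_derivative Y (\<Psi> t x)) (at t within {-\<tau>..\<tau>})"
    and continuous: "continuous_on UNIV (\<lambda>(t, x). \<Psi> t x)"
    and expansion: "\<And>t x y. t \<in> {-\<tau>..\<tau>} \<Longrightarrow>
      infnorm (\<Psi> t x - \<Psi> t y) \<le> (1 + 2 * \<Lambda> * \<bar>t\<bar>) * infnorm (x - y)"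
    and inverse: "\<And>t x. t \<in> {-\<tau>..\<tau>} \<Longrightarrow> \<Psi> (- t) (\<Psi> t x) = x"
    and speed: "\<And>t x. t \<in> {-\<tau>..\<tau>} \<Longrightarrow> norm (\<Psi> t x - x) \<le> M * \<bar>t\<bar>"

text \<open>The separation estimate is used twice: with two starting points for the expansion bound,
  and with two parametrisations of the same orbit for the inverse. The bound \<open>M\<close> on the
  field is a bound on the speed.\<close>

lemma short_time_flow_exists:
  fixes Y :: "'a::euclidean_space \<Rightarrow> 'a"
  assumes Y: "C-lipschitz_on UNIV Y" and M: "\<And>x. norm (Y x) \<le> M"
  obtains \<Psi> \<tau> \<Lambda> where "short_time_flow Y \<Psi> \<tau> \<Lambda> M"
proof -
  have C: "C \<ge> 0" using Y by (rule lipschitz_on_nonneg)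
  \<comment> \<open>The Lipschitz constant in the maximum norm: comparing it with the Euclidean norm
    costs sqrt DIM.\<close>
  define \<Lambda> where "\<Lambda> = C * sqrt DIM('a)"
  have "C * 1 \<le> C * sqrt DIM('a)" using C by (intro mult_left_mono) auto
  then have C\<Lambda>: "C \<le> \<Lambda>" by (simp add: \<Lambda>_def)
  have \<Lambda>: "\<Lambda> \<ge> 0" using C C\<Lambda> by linarith
  \<comment> \<open>The 6 gives both the contraction condition of the fixed point argument and
    \<Lambda> \<tau> <= 1/6; the summand 1 covers \<Lambda> = 0.\<close>
  define \<tau> where "\<tau> = 1 / (6 * (\<Lambda> + 1))"
  have \<tau>: "\<tau> > 0" using \<Lambda> by (simp add: \<tau>_def)
  have \<Lambda>\<tau>: "\<Lambda> * \<tau> \<le> 1/6" using \<Lambda> by (simp add: \<tau>_def field_simps)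
  have "C * \<tau> \<le> \<Lambda> * \<tau>" using C\<Lambda> \<tau> by (intro mult_right_mono) auto
  then have C\<tau>: "6 * C * \<tau> \<le> 1" using \<Lambda>\<tau> by simp
  have M0: "M \<ge> 0" using M[of undefined] norm_ge_zero order_trans by blast
  obtain \<Psi>' where \<Psi>': "\<And>x. continuous_on UNIV (\<Psi>' x)" "\<And>x. \<Psi>' x 0 = x"
    "\<And>x t. \<Psi>' x t = \<Psi>' x (max (-\<tau>) (min \<tau> t))"
    "\<And>x t. t \<in> {-\<tau>..\<tau>} \<Longrightarrow> (\<Psi>' x has_vector_derivative Y (\<Psi>' x t)) (at t within {-\<tau>..\<tau>})"
    using picard_lindelof_short_time[OF Y \<tau> C\<tau>] by metis
  define \<Psi> where "\<Psi> t x = \<Psi>' x t" for t x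
  have start: "\<Psi> 0 x = x" for x by (simp add: \<Psi>_def \<Psi>'(2))
  have deriv: "((\<lambda>s. \<Psi> s x) has_vector_derivative Y (\<Psi> t x)) (at t within {-\<tau>..\<tau>})" if "t \<in> {-\<tau>..\<tau>}" for t x
    using \<Psi>'(4)[OF that] by (simp add: \<Psi>_def)
  have dsub: "((\<lambda>s. \<Psi> s x) has_vector_derivative Y (\<Psi> r x)) (at r within S)"
    if "S \<subseteq> {-\<tau>..\<tau>}" "r \<in> S" for r S x
    using that by (intro has_vector_derivative_within_subset[OF deriv that(1)]) auto
  have lip: "infnorm (Y x - Y y) \<le> \<Lambda> * infnorm (x - y)" for x y
    using infnorm_lipschitz[OF Y] by (simp add: \<Lambda>_def)
  have sep: "infnorm (\<Psi> t x - \<Psi> t y) \<le> infnorm (x - y) / (1 - \<Lambda> * \<bar>t\<bar>)" if t: "t \<in> {-\<tau>..\<tau>}" for t x y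
  proof -
    define a b where "a = min 0 t" and "b = max 0 t"
    have ab: "{a..b} \<subseteq> {-\<tau>..\<tau>}" "b - a = \<bar>t\<bar>" "0 \<in> {a..b}" "t \<in> {a..b}" using t \<tau> by (auto simp: a_def b_def)
    have "\<Lambda> * \<bar>t\<bar> \<le> \<Lambda> * \<tau>" using t \<Lambda> by (intro mult_left_mono) auto
    then have small: "\<Lambda> * (b - a) < 1" unfolding ab(2) using \<Lambda>\<tau> by linarith
    have "infnorm (\<Psi> t x - \<Psi> t y) \<le> infnorm (\<Psi> 0 x - \<Psi> 0 y) / (1 - \<Lambda> * (b - a))"
      by (rule integral_curves_separation[where S = UNIV and X = Y and \<gamma> = "\<lambda>s. \<Psi> s x" and \<delta> = "\<lambda>s. \<Psi> s y"])
        (use lip \<Lambda> small ab(3,4) dsub[OF ab(1)] in simp_all)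
    then show ?thesis by (simp add: start ab)
  qed
  have expansion: "infnorm (\<Psi> t x - \<Psi> t y) \<le> (1 + 2 * \<Lambda> * \<bar>t\<bar>) * infnorm (x - y)" if t: "t \<in> {-\<tau>..\<tau>}" for t x y
  proof -
    define z where "z = \<Lambda> * \<bar>t\<bar>"
    have "\<Lambda> * \<bar>t\<bar> \<le> \<Lambda> * \<tau>" using t \<Lambda> by (intro mult_left_mono) auto
    then have z: "0 \<le> z" "z \<le> 1/6" using \<Lambda> \<Lambda>\<tau> by (auto simp: z_def)
    \<comment> \<open>The product equals 1 + z - 2 z^2, which is at least 1 for z <= 1/2; thus 1 /
      (1 - z) is replaced by a bound that is linear in \<open>t\<close>.\<close>
    have "1 \<le> (1 + 2 * z) * (1 - z)"
      using mult_left_mono[OF z(2) z(1)] z(1) by (simp add: algebra_simps)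
    then have "1 / (1 - z) \<le> 1 + 2 * z" using z by (simp add: pos_divide_le_eq)
    then have "infnorm (x - y) * (1 / (1 - z)) \<le> infnorm (x - y) * (1 + 2 * z)"
      by (intro mult_left_mono infnorm_pos_le)
    then show ?thesis using sep[OF t, of x y] by (simp add: z_def mult_ac)
  qed
  have tdist: "norm (\<Psi> t x - \<Psi> s x) \<le> M * \<bar>t - s\<bar>" if "t \<in> {-\<tau>..\<tau>}" "s \<in> {-\<tau>..\<tau>}" for s t x
  proof -
    have "norm (\<Psi> t x - \<Psi> s x) \<le> M * norm (t - s)"
    proof (rule differentiable_bound[where S = "{-\<tau>..\<tau>}" and f' = "\<lambda>r h. h *\<^sub>R Y (\<Psi> r x)"])
      fix r assume "r \<in> {-\<tau>..\<tau>}"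
      then show "((\<lambda>s. \<Psi> s x) has_derivative (\<lambda>h. h *\<^sub>R Y (\<Psi> r x))) (at r within {-\<tau>..\<tau>})"
        using deriv by (simp add: has_vector_derivative_def)
      show "onorm (\<lambda>h. h *\<^sub>R Y (\<Psi> r x)) \<le> M"
        by (rule onorm_bound[OF M0]) (use M in \<open>auto simp: mult.commute[of M] intro!: mult_left_mono\<close>)
    qed (use that in auto)
    then show ?thesis by simp
  qed
  \<comment> \<open>The curves s -> \<Psi> s (\<Psi> t x) and s -> \<Psi> (s + t) x solve the same
    equation and agree at s = 0; at s = -t they give \<Psi> (-t) (\<Psi> t x) and x.\<close>
  have inverse: "\<Psi> (- t) (\<Psi> t x) = x" if t: "t \<in> {-\<tau>..\<tau>}" for t x
  proof -
    define a b where "a = min 0 (-t)" and "b = max 0 (-t)"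
    have ab: "{a..b} \<subseteq> {-\<tau>..\<tau>}" "b - a = \<bar>t\<bar>" "0 \<in> {a..b}" "-t \<in> {a..b}" "(\<lambda>s. s + t) ` {a..b} \<subseteq> {-\<tau>..\<tau>}"
      using t \<tau> by (auto simp: a_def b_def)
    have "\<Lambda> * \<bar>t\<bar> \<le> \<Lambda> * \<tau>" using t \<Lambda> by (intro mult_left_mono) auto
    then have small: "\<Lambda> * (b - a) < 1" unfolding ab(2) using \<Lambda>\<tau> by linarith
    have d: "((\<lambda>s. \<Psi> (s + t) x) has_vector_derivative Y (\<Psi> (s + t) x)) (at s within {a..b})" if "s \<in> {a..b}" for s
    proof -
      have "((\<lambda>s. s + t) has_vector_derivative 1) (at s within {a..b})"
        by (auto intro!: derivative_eq_intros)
      moreover have "((\<lambda>s. \<Psi> s x) has_vector_derivative Y (\<Psi> (s + t) x)) (at (s + t) within (\<lambda>s. s + t) ` {a..b})"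
        by (rule has_vector_derivative_within_subset[OF deriv ab(5)]) (use ab(5) that in auto)
      ultimately show ?thesis
        using vector_diff_chain_within[of "\<lambda>s. s + t" 1 s "{a..b}" "\<lambda>s. \<Psi> s x"] by (simp add: o_def)
    qed
    have "infnorm (\<Psi> (-t) (\<Psi> t x) - \<Psi> (-t + t) x) \<le> infnorm (\<Psi> 0 (\<Psi> t x) - \<Psi> (0 + t) x) / (1 - \<Lambda> * (b - a))"
      by (rule integral_curves_separation[where S = UNIV and X = Y and \<gamma> = "\<lambda>s. \<Psi> s (\<Psi> t x)" and \<delta> = "\<lambda>s. \<Psi> (s + t) x"])
        (use lip \<Lambda> small ab(3,4) d dsub[OF ab(1)] in simp_all)
    then have "infnorm (\<Psi> (-t) (\<Psi> t x) - x) \<le> 0" by (simp add: start infnorm_0)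
    then show ?thesis using infnorm_pos_lt[of "\<Psi> (-t) (\<Psi> t x) - x"] by (metis eq_iff_diff_eq_0 not_le)
  qed
  \<comment> \<open>Beyond [-\<tau>, \<tau>] the curves are constant, so after clamping the
    Lipschitz bounds in time and space hold for all times and give joint continuity.\<close>
  have cont: "continuous_on UNIV (\<lambda>(t, x). \<Psi> t x)"
  proof -
    have cl: "\<Psi> t x = \<Psi> (max (-\<tau>) (min \<tau> t)) x" for t x unfolding \<Psi>_def by (rule \<Psi>'(3))
    define S where "S = sqrt DIM('a)"
    have bd: "norm (\<Psi> t x - \<Psi> s y) \<le> M * \<bar>t - s\<bar> + S * (2 * norm (x - y))" for t s x y
    proof -
      define t' s' where "t' = max (-\<tau>) (min \<tau> t)" and "s' = max (-\<tau>) (min \<tau> s)"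
      have ts: "t' \<in> {-\<tau>..\<tau>}" "s' \<in> {-\<tau>..\<tau>}" "\<bar>t' - s'\<bar> \<le> \<bar>t - s\<bar>" using \<tau> by (auto simp: t'_def s'_def)
      have "norm (\<Psi> s' x - \<Psi> s' y) \<le> S * infnorm (\<Psi> s' x - \<Psi> s' y)"
        unfolding S_def by (rule norm_le_infnorm)
      also have "infnorm (\<Psi> s' x - \<Psi> s' y) \<le> (1 + 2 * \<Lambda> * \<bar>s'\<bar>) * infnorm (x - y)" by (rule expansion[OF ts(2)])
      also have "\<dots> \<le> 2 * norm (x - y)"
      proof (rule mult_mono)
        have "\<Lambda> * \<bar>s'\<bar> \<le> \<Lambda> * \<tau>" using ts \<Lambda> by (intro mult_left_mono) auto
        then show "1 + 2 * \<Lambda> * \<bar>s'\<bar> \<le> 2" using \<Lambda>\<tau> by linarith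
      qed (auto simp: infnorm_le_norm infnorm_pos_le)
      finally have "norm (\<Psi> s' x - \<Psi> s' y) \<le> S * (2 * norm (x - y))" by (simp add: S_def)
      moreover have "norm (\<Psi> t' x - \<Psi> s' x) \<le> M * \<bar>t - s\<bar>"
        using tdist[OF ts(1,2), of x] mult_left_mono[OF ts(3) M0] by linarith
      moreover have "norm (\<Psi> t' x - \<Psi> s' y) \<le> norm (\<Psi> t' x - \<Psi> s' x) + norm (\<Psi> s' x - \<Psi> s' y)"
        using norm_triangle_ineq[of "\<Psi> t' x - \<Psi> s' x" "\<Psi> s' x - \<Psi> s' y"] by simp
      ultimately show ?thesis unfolding cl[of t] cl[of s] t'_def s'_def by linarith
    qed
    have "(M + S * 2)-lipschitz_on UNIV (\<lambda>(t, x). \<Psi> t x)"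
    proof (rule lipschitz_onI, clarify)
      fix t s :: real and x y :: 'a
      have "\<bar>t - s\<bar> \<le> dist (t, x) (s, y)" using dist_fst_le[of "(t,x)" "(s,y)"] by (simp add: dist_real_def)
      moreover have "norm (x - y) \<le> dist (t, x) (s, y)" using dist_snd_le[of "(t,x)" "(s,y)"] by (simp add: dist_norm)
      ultimately have "M * \<bar>t - s\<bar> + S * (2 * norm (x - y)) \<le> M * dist (t, x) (s, y) + S * (2 * dist (t, x) (s, y))"
        using M0 by (intro add_mono mult_left_mono) (auto simp: S_def)
      then show "dist (\<Psi> t x) (\<Psi> s y) \<le> (M + S * 2) * dist (t, x) (s, y)"
        using bd[of t x s y] by (simp add: dist_norm algebra_simps)
    qed (use M0 in \<open>auto simp: S_def\<close>)
    then show ?thesis by (rule lipschitz_on_continuous_on)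
  qed
  have "short_time_flow Y \<Psi> \<tau> \<Lambda> M"
  proof
    show "norm (\<Psi> t x - x) \<le> M * \<bar>t\<bar>" if "t \<in> {-\<tau>..\<tau>}" for t x
      using tdist[OF that, of 0 x] \<tau> by (simp add: start)
  qed (use \<tau> \<Lambda> M0 \<Lambda>\<tau> start deriv cont expansion inverse in auto)
  then show thesis by (rule that)
qed

section \<open>Uniqueness, the maximal flow and localisation near a compact set\<close>

lemma integral_curve_continuous:
  assumes "integral_curve \<Omega> X x I \<gamma>" "t \<in> I"
  shows "isCont \<gamma> t"
  using assms has_vector_derivative_continuous unfolding integral_curve_def by blast

text \<open>The set where the curves agree is closed in the common interval by continuity, and open
  by the separation estimate started from separation 0; it contains 0, and the interval is
  connected.\<close>

lemma integral_curves_agree: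
  fixes X :: "real^'n \<Rightarrow> real^'n"
  assumes X: "locally_lipschitz_field \<Omega> X"
    and \<gamma>: "integral_curve \<Omega> X x I \<gamma>" and \<delta>: "integral_curve \<Omega> X x J \<delta>" and t: "t \<in> I \<inter> J"
  shows "\<gamma> t = \<delta> t"
proof -
  define A where "A = {t \<in> I \<inter> J. \<gamma> t - \<delta> t = 0}"
  have IJ: "open (I \<inter> J)" using \<gamma> \<delta> by (auto simp: integral_curve_def)
  have "is_interval (I \<inter> J)" using \<gamma> \<delta> by (auto simp: integral_curve_def is_interval_Int)
  then have conn: "connected (I \<inter> J)" by (rule is_interval_connected)
  have "continuous_on (I \<inter> J) (\<lambda>t. \<gamma> t - \<delta> t)"
    using integral_curve_continuous[OF \<gamma>] integral_curve_continuous[OF \<delta>]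
    by (intro continuous_intros continuous_at_imp_continuous_on) auto
  then have cl: "closedin (top_of_set (I \<inter> J)) A"
    unfolding A_def by (rule continuous_closedin_preimage_constant)
  have "\<exists>e>0. ball t0 e \<subseteq> A" if t0: "t0 \<in> A" for t0
  proof -
    define z where "z = \<gamma> t0"
    have z: "z \<in> \<Omega>" "\<delta> t0 = z" using t0 \<gamma> by (auto simp: A_def z_def integral_curve_def)
    obtain u L where u: "u > 0" and L: "L-lipschitz_on (cball z u \<inter> \<Omega>) X"
      using X z(1) unfolding locally_lipschitz_field_def local_lipschitz_def by (metis UNIV_I centre_in_cball Int_iff less_imp_le)
    define \<Lambda> where "\<Lambda> = L * sqrt DIM(real^'n)"
    have \<Lambda>: "\<Lambda> \<ge> 0" using lipschitz_on_nonneg[OF L] by (simp add: \<Lambda>_def)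
    have cont: "isCont \<gamma> t0" "isCont \<delta> t0"
      using integral_curve_continuous[OF \<gamma>] integral_curve_continuous[OF \<delta>] t0 by (auto simp: A_def)
    have "eventually (\<lambda>t. t \<in> I \<inter> J \<and> dist (\<gamma> t) z < u \<and> dist (\<delta> t) z < u) (nhds t0)"
    proof (intro eventually_conj)
      show "eventually (\<lambda>t. t \<in> I \<inter> J) (nhds t0)"
        using IJ t0 by (intro eventually_nhds_in_open) (auto simp: A_def)
      show "eventually (\<lambda>t. dist (\<gamma> t) z < u) (nhds t0)"
        using cont(1) u by (auto simp: z_def continuous_at_eps_delta eventually_nhds_metric) 
      show "eventually (\<lambda>t. dist (\<delta> t) z < u) (nhds t0)"
        using cont(2) u z(2) by (auto simp: continuous_at_eps_delta eventually_nhds_metric)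
    qed
    then obtain e where e: "e > 0" "\<And>t. dist t t0 < e \<Longrightarrow> t \<in> I \<inter> J \<and> dist (\<gamma> t) z < u \<and> dist (\<delta> t) z < u"
      by (auto simp: eventually_nhds_metric)
    \<comment> \<open>Half of \<open>e\<close> keeps the closed interval inside the neighbourhood; 1
      / (4 (\<Lambda> + 1)) makes \<Lambda> times its length 2r at most 1/2.\<close>
    define r where "r = min (e / 2) (1 / (4 * (\<Lambda> + 1)))"
    have r: "r > 0" "r < e" using e(1) \<Lambda> by (auto simp: r_def)
    have "\<Lambda> * r \<le> \<Lambda> * (1 / (4 * (\<Lambda> + 1)))" using \<Lambda> by (intro mult_left_mono) (auto simp: r_def)
    also have "\<dots> \<le> 1/4" using \<Lambda> by (simp add: field_simps)
    finally have small: "\<Lambda> * ((t0 + r) - (t0 - r)) < 1" by simp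
    have near: "t \<in> I \<inter> J" "dist (\<gamma> t) z < u" "dist (\<delta> t) z < u" if "t \<in> {t0 - r..t0 + r}" for t
      using e(2)[of t] that r by (auto simp: dist_real_def)
    have eq: "\<gamma> t = \<delta> t" if "t \<in> {t0 - r..t0 + r}" for t
    proof -
      have "infnorm (\<gamma> t - \<delta> t) \<le> infnorm (\<gamma> t0 - \<delta> t0) / (1 - \<Lambda> * ((t0 + r) - (t0 - r)))"
      proof (rule integral_curves_separation[where S = "cball z u \<inter> \<Omega>" and X = X])
        show "infnorm (X x - X y) \<le> \<Lambda> * infnorm (x - y)" if "x \<in> cball z u \<inter> \<Omega>" "y \<in> cball z u \<inter> \<Omega>" for x y
          using infnorm_lipschitz[OF L that] by (simp add: \<Lambda>_def)
        fix s assume s: "s \<in> {t0 - r..t0 + r}"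
        show "(\<gamma> has_vector_derivative X (\<gamma> s)) (at s within {t0 - r..t0 + r})" "\<gamma> s \<in> cball z u \<inter> \<Omega>"
          using near(1,2)[OF s] \<gamma> has_vector_derivative_at_within[of \<gamma> "X (\<gamma> s)" s]
          by (simp_all add: integral_curve_def dist_commute)
        show "(\<delta> has_vector_derivative X (\<delta> s)) (at s within {t0 - r..t0 + r})" "\<delta> s \<in> cball z u \<inter> \<Omega>"
          using near(1,3)[OF s] \<delta> has_vector_derivative_at_within[of \<delta> "X (\<delta> s)" s]
          by (simp_all add: integral_curve_def dist_commute)
      qed (use \<Lambda> small r that in auto)
      then have "infnorm (\<gamma> t - \<delta> t) \<le> 0" using z by (simp add: z_def infnorm_0)
      then show ?thesis using infnorm_pos_lt[of "\<gamma> t - \<delta> t"] by (metis eq_iff_diff_eq_0 not_le)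
    qed
    have "ball t0 r \<subseteq> A"
    proof
      fix t assume "t \<in> ball t0 r"
      then have "t \<in> {t0 - r..t0 + r}" by (auto simp: dist_real_def)
      with eq near(1) show "t \<in> A" by (simp add: A_def)
    qed
    with r(1) show ?thesis by blast
  qed
  then have "open A" by (simp add: open_contains_ball)
  then have op: "openin (top_of_set (I \<inter> J)) A" by (rule open_openin_trans[OF IJ]) (auto simp: A_def)
  have "0 \<in> A" using \<gamma> \<delta> by (auto simp: A_def integral_curve_def)
  then have "A = I \<inter> J" using conn op cl unfolding connected_clopen by blast
  then show ?thesis using t by (auto simp: A_def)
qed

text \<open>The union of all integral curves from \<open>x\<close> is well defined by uniqueness,
  and it is the only maximal one. This evaluates the definite descriptions in
  \<open>flow_interval\<close> and \<open>flow\<close>, so that any integral curve computes the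
  flow.\<close>

lemma flow_eq_integral_curve:
  fixes X :: "real^'n \<Rightarrow> real^'n"
  assumes X: "locally_lipschitz_field \<Omega> X" and \<gamma>: "integral_curve \<Omega> X x I \<gamma>" and t: "t \<in> I"
  shows "t \<in> flow_interval \<Omega> X x" "flow \<Omega> X t x = \<gamma> t"
proof -
  define \<I> where "\<I> = {J. \<exists>\<delta>. integral_curve \<Omega> X x J \<delta>}"
  define c where "c J = (SOME \<delta>. integral_curve \<Omega> X x J \<delta>)" for J
  have c: "integral_curve \<Omega> X x J (c J)" if "J \<in> \<I>" for J
    using that unfolding \<I>_def c_def mem_Collect_eq by (rule someI_ex)
  define U where "U = \<Union>\<I>"
  \<comment> \<open>A curve is chosen separately for each time; uniqueness makes the choice
    irrelevant.\<close>
  define \<Gamma> where "\<Gamma> s = c (SOME J. J \<in> \<I> \<and> s \<in> J) s" for s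
  have \<Gamma>: "\<Gamma> s = \<delta> s" if "integral_curve \<Omega> X x J \<delta>" "s \<in> J" for J \<delta> s
  proof -
    define J' where "J' = (SOME J. J \<in> \<I> \<and> s \<in> J)"
    have "J' \<in> \<I> \<and> s \<in> J'" unfolding J'_def by (rule someI[of _ J]) (use that in \<open>auto simp: \<I>_def\<close>)
    then show ?thesis
      using integral_curves_agree[OF X c that(1), of J' s] that(2) by (simp add: \<Gamma>_def J'_def)
  qed
  have IU: "J \<subseteq> U" if "integral_curve \<Omega> X x J \<delta>" for J \<delta>
    using that by (auto simp: U_def \<I>_def)
  have UC: "integral_curve \<Omega> X x U \<Gamma>"
    unfolding integral_curve_def
  proof (intro conjI ballI)
    show "open U" unfolding U_def \<I>_def by (intro open_Union) (auto simp: integral_curve_def)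
    have "connected U"
      unfolding U_def
    proof (rule connected_Union)
      show "connected J" if "J \<in> \<I>" for J
        using that by (auto simp: \<I>_def integral_curve_def intro: is_interval_connected)
      have "0 \<in> \<Inter>\<I>" by (auto simp: \<I>_def integral_curve_def)
      then show "\<Inter>\<I> \<noteq> {}" by blast
    qed
    then show "is_interval U" by (simp add: is_interval_connected_1)
    show "0 \<in> U" using \<gamma> IU[OF \<gamma>] by (auto simp: integral_curve_def)
    show "\<Gamma> 0 = x" using \<Gamma>[OF \<gamma>, of 0] \<gamma> by (auto simp: integral_curve_def)
    fix s assume "s \<in> U"
    then obtain J \<delta> where J: "integral_curve \<Omega> X x J \<delta>" "s \<in> J" by (auto simp: U_def \<I>_def)
    then show "\<Gamma> s \<in> \<Omega>" using \<Gamma>[OF J] by (auto simp: integral_curve_def)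
    have "(\<delta> has_vector_derivative X (\<Gamma> s)) (at s)" "open J"
      using J \<Gamma>[OF J] by (auto simp: integral_curve_def)
    then show "(\<Gamma> has_vector_derivative X (\<Gamma> s)) (at s)"
      by (rule has_vector_derivative_transform_within_open) (use J \<Gamma>[OF J(1)] in auto)
  qed
  have max: "maximal_integral_curve \<Omega> X x U \<Gamma>"
    unfolding maximal_integral_curve_def using UC IU by blast
  have uniq: "J = U \<and> (\<forall>s\<in>U. \<delta> s = \<Gamma> s)" if "maximal_integral_curve \<Omega> X x J \<delta>" for J \<delta>
  proof -
    have J: "integral_curve \<Omega> X x J \<delta>" using that by (simp add: maximal_integral_curve_def)
    then have "U = J" using that UC IU[OF J] \<Gamma>[OF J] unfolding maximal_integral_curve_def by blast
    then show ?thesis using \<Gamma>[OF J] by auto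
  qed
  have "flow_interval \<Omega> X x = U"
    unfolding flow_interval_def by (rule the_equality) (use max uniq in blast)+
  then show "t \<in> flow_interval \<Omega> X x" using t IU[OF \<gamma>] by auto
  have tU: "t \<in> U" using t IU[OF \<gamma>] by auto
  have "flow \<Omega> X t x = \<Gamma> t"
    unfolding flow_def by (rule the_equality) (use max uniq tU in blast)+
  then show "flow \<Omega> X t x = \<gamma> t" using \<Gamma>[OF \<gamma> t] by simp
qed

text \<open>\<open>X\<close> is multiplied by a cutoff of the distance to \<open>K\<close>. The
  result equals \<open>X\<close> near \<open>K\<close>, so curves that start in \<open>K\<close>
  cannot tell the two fields apart for short times.\<close>

lemma locally_lipschitz_field_extension:
  fixes X :: "real^'n \<Rightarrow> real^'n"
  assumes \<Omega>: "open \<Omega>" and X: "locally_lipschitz_field \<Omega> X" and K: "compact K" "K \<subseteq> \<Omega>"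
  obtains Y C M \<rho> K' where "C-lipschitz_on UNIV Y" "\<And>x. norm (Y x) \<le> M" "\<rho> > 0" "compact K'" "K' \<subseteq> \<Omega>"
    "\<And>x y. x \<in> K \<Longrightarrow> dist x y \<le> \<rho> \<Longrightarrow> y \<in> K' \<and> Y y = X y"
proof (cases "K = {}")
  \<comment> \<open>The distance to the empty set is 0 by convention, so a cutoff would not
    localise; the zero field serves here.\<close>
  case True
  show ?thesis
    by (rule that[of 0 "\<lambda>_. 0" 0 1 "{}"]) (use True in \<open>auto intro: lipschitz_on_constant\<close>)
next
  case False
  obtain e where e: "e > 0" "{x. infdist x K \<le> e} \<subseteq> \<Omega>"
    using compact_in_open_separated[OF False K(1) \<Omega> K(2)] by metis
  \<comment> \<open>The cutoff is 1 up to distance \<rho> and vanishes from distance 2 \<rho> = e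
    on, still inside \<Omega>.\<close>
  define \<rho> where "\<rho> = e / 2"
  have \<rho>: "\<rho> > 0" using e by (simp add: \<rho>_def)
  define K' where "K' = {x. infdist x K \<le> e}"
  have K': "compact K'" unfolding K'_def using False K(1) e(1) by (intro compact_infdist_le) auto
  have K'\<Omega>: "K' \<subseteq> \<Omega>" using e by (simp add: K'_def)
  obtain L where L: "L-lipschitz_on K' X"
  proof -
    have "local_lipschitz {0} K' (\<lambda>_::real. X)"
      using X K'\<Omega> unfolding locally_lipschitz_field_def
      by - (rule local_lipschitz_subset[where T = UNIV and X = \<Omega>], auto)
    from local_lipschitz_compact_implies_lipschitz[OF this K'] show thesis
      using that by (metis compact_sing continuous_on_const singletonI)
  qed
  have L0: "L \<ge> 0" using L by (rule lipschitz_on_nonneg)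
  obtain M where M: "\<And>x. x \<in> K' \<Longrightarrow> norm (X x) \<le> M" "M \<ge> 0"
  proof -
    have "bounded (X ` K')"
      using compact_imp_bounded[OF compact_continuous_image[OF lipschitz_on_continuous_on[OF L] K']] .
    then obtain M where "\<And>x. x \<in> K' \<Longrightarrow> norm (X x) \<le> M" unfolding bounded_iff by (metis image_eqI)
    then show thesis using that[of "max M 0"] by (auto intro: le_max_iff_disj[THEN iffD2])
  qed
  define cut where "cut x = max 0 (min 1 (2 - infdist x K / \<rho>))" for x
  define Y where "Y x = cut x *\<^sub>R X x" for x
  have cut1: "cut x = 1" if "infdist x K \<le> \<rho>" for x using that \<rho> by (simp add: cut_def field_simps)
  have cut0: "cut x = 0" if "x \<notin> K'" for x using that \<rho> by (simp add: cut_def K'_def \<rho>_def field_simps)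
  have cutb: "0 \<le> cut x" "cut x \<le> 1" for x by (auto simp: cut_def)
  have cutl: "\<bar>cut x - cut y\<bar> \<le> dist x y / \<rho>" for x y
  proof -
    have "\<bar>cut x - cut y\<bar> \<le> \<bar>infdist x K / \<rho> - infdist y K / \<rho>\<bar>" by (auto simp: cut_def)
    also have "\<dots> = \<bar>infdist x K - infdist y K\<bar> / \<rho>" using \<rho> by (metis abs_divide abs_of_pos diff_divide_distrib)
    also have "\<dots> \<le> dist x y / \<rho>" using \<rho> infdist_triangle_abs[of x K y] by (intro divide_right_mono) auto
    finally show ?thesis .
  qed
  \<comment> \<open>One point in \<open>K'\<close> is enough: if the other lies outside, its cutoff
    vanishes and the Lipschitz bound of the cutoff controls the difference.\<close>
  have half: "norm (Y x - Y y) \<le> (L + M / \<rho>) * dist x y" if x: "x \<in> K'" for x y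
  proof (cases "y \<in> K'")
    case True
    have "Y x - Y y = cut x *\<^sub>R (X x - X y) + (cut x - cut y) *\<^sub>R X y" by (simp add: Y_def algebra_simps)
    then have "norm (Y x - Y y) \<le> \<bar>cut x\<bar> * norm (X x - X y) + \<bar>cut x - cut y\<bar> * norm (X y)"
      by (metis norm_scaleR norm_triangle_ineq)
    also have "\<dots> \<le> 1 * (L * dist x y) + (dist x y / \<rho>) * M"
      using cutb cutl[of x y] lipschitz_onD[OF L x True] M(1)[OF True] \<rho> by (intro add_mono mult_mono) (auto simp: dist_norm)
    finally show ?thesis by (simp add: algebra_simps)
  next
    case False
    have "norm (Y x - Y y) = \<bar>cut x - cut y\<bar> * norm (X x)" by (simp add: Y_def cut0[OF False])
    also have "\<dots> \<le> (dist x y / \<rho>) * M" using cutl[of x y] M(1)[OF x] \<rho> by (intro mult_mono) auto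
    also have "\<dots> \<le> (L + M / \<rho>) * dist x y" using L0 by (simp add: algebra_simps)
    finally show ?thesis .
  qed
  show ?thesis
  proof (rule that[of "L + M / \<rho>" Y M \<rho> K'])
    show "(L + M / \<rho>)-lipschitz_on UNIV Y"
    proof (rule lipschitz_onI)
      fix x y
      show "dist (Y x) (Y y) \<le> (L + M / \<rho>) * dist x y"
      proof (cases "x \<in> K' \<or> y \<in> K'")
        case True
        then show ?thesis using half[of x y] half[of y x] by (auto simp: dist_norm norm_minus_commute)
      next
        case False
        then have "Y x = 0" "Y y = 0" by (auto simp: Y_def cut0)
        then show ?thesis using L0 M(2) \<rho> by simp
      qed
    qed (use L0 M(2) \<rho> in auto)
    show "norm (Y x) \<le> M" for x
    proof (cases "x \<in> K'")
      case True
      have "norm (Y x) \<le> 1 * norm (X x)" unfolding Y_def using cutb[of x] by (simp add: mult_left_le_one_le)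
      then show ?thesis using M(1)[OF True] by simp
    qed (use M(2) in \<open>simp add: Y_def cut0\<close>)
    fix x y assume "x \<in> K" "dist x y \<le> \<rho>"
    then have "infdist y K \<le> \<rho>" using infdist_le[of x K y] by (simp add: dist_commute)
    then show "y \<in> K' \<and> Y y = X y" using \<rho> by (simp add: Y_def cut1 K'_def \<rho>_def)
  qed (use \<rho> K' K'\<Omega> in auto)
qed

text \<open>Speed at most \<open>M\<close> keeps the auxiliary curve within distance \<rho> of
  \<open>x\<close> up to time \<sigma>, where both fields agree; it is thus an integral curve of
  \<open>X\<close>, and uniqueness identifies it with the flow.\<close>

lemma flow_eq_short_time_flow:
  fixes X :: "real^'n \<Rightarrow> real^'n"
  assumes X: "locally_lipschitz_field \<Omega> X" and flow: "short_time_flow Y \<Psi> \<tau> \<Lambda> M"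
    and near: "\<And>y. dist x y \<le> \<rho> \<Longrightarrow> y \<in> \<Omega> \<and> Y y = X y"
    and \<sigma>: "0 < \<sigma>" "\<sigma> \<le> \<tau>" "M * \<sigma> \<le> \<rho>" and t: "\<bar>t\<bar> < \<sigma>"
  shows "t \<in> flow_interval \<Omega> X x" "flow \<Omega> X t x = \<Psi> t x"
proof -
  interpret short_time_flow Y \<Psi> \<tau> \<Lambda> M by (rule flow)
  have "integral_curve \<Omega> X x {-\<sigma><..<\<sigma>} (\<lambda>s. \<Psi> s x)"
    unfolding integral_curve_def
  proof (intro conjI ballI)
    fix s assume s: "s \<in> {-\<sigma><..<\<sigma>}"
    have s': "s \<in> {-\<tau>..\<tau>}" "s \<in> {-\<tau><..<\<tau>}" using s \<sigma> by auto
    have "norm (\<Psi> s x - x) \<le> M * \<bar>s\<bar>" by (rule speed[OF s'(1)])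
    also have "\<dots> \<le> M * \<sigma>" using s M by (intro mult_left_mono) auto
    finally have n: "\<Psi> s x \<in> \<Omega> \<and> Y (\<Psi> s x) = X (\<Psi> s x)"
      using \<sigma> by (intro near) (simp add: dist_norm norm_minus_commute)
    then show "\<Psi> s x \<in> \<Omega>" by simp
    have "((\<lambda>s. \<Psi> s x) has_vector_derivative Y (\<Psi> s x)) (at s within {-\<tau><..<\<tau>})"
      by (rule has_vector_derivative_within_subset[OF derivative[OF s'(1)]]) auto
    then show "((\<lambda>s. \<Psi> s x) has_vector_derivative X (\<Psi> s x)) (at s)"
      using n s'(2) by (simp add: at_within_open[OF _ open_greaterThanLessThan])
  qed (use \<sigma> start in \<open>auto simp: is_interval_oo\<close>)
  moreover have "t \<in> {-\<sigma><..<\<sigma>}" using t by auto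
  ultimately show "t \<in> flow_interval \<Omega> X x" "flow \<Omega> X t x = \<Psi> t x"
    by (rule flow_eq_integral_curve[OF X])+
qed

section \<open>Weak limits of dominated sequences\<close>

text \<open>Midpoints suffice in place of convex combinations: the parallelogram identity makes elements of
  nearly minimal \<open>L\<^sup>2\<close> norm in the decreasing hulls a Cauchy sequence.\<close>

inductive_set midpoint_hull :: "(nat \<Rightarrow> 'a \<Rightarrow> real) \<Rightarrow> nat \<Rightarrow> ('a \<Rightarrow> real) set"
  for \<phi> :: "nat \<Rightarrow> 'a \<Rightarrow> real" and n :: nat where
  base: "n \<le> m \<Longrightarrow> \<phi> m \<in> midpoint_hull \<phi> n"
| mid: "a \<in> midpoint_hull \<phi> n \<Longrightarrow> b \<in> midpoint_hull \<phi> n \<Longrightarrow> (\<lambda>x. (a x + b x) / 2) \<in> midpoint_hull \<phi> n"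

lemma midpoint_hull_antimono: "m \<le> n \<Longrightarrow> midpoint_hull \<phi> n \<subseteq> midpoint_hull \<phi> m"
proof
  fix a assume "m \<le> n" "a \<in> midpoint_hull \<phi> n"
  from this(2,1) show "a \<in> midpoint_hull \<phi> m"
    by (induction) (auto intro: midpoint_hull.intros)
qed

lemma midpoint_hull_measurable:
  assumes "a \<in> midpoint_hull \<phi> n" "\<And>m. \<phi> m \<in> borel_measurable M"
  shows "a \<in> borel_measurable M"
  using assms by induction auto

lemma midpoint_hull_bounded:
  assumes "a \<in> midpoint_hull \<phi> n" "\<And>m. \<bar>\<phi> m x\<bar> \<le> B"
  shows "\<bar>a x\<bar> \<le> B"
  using assms by induction (auto simp: abs_le_iff field_simps)

text \<open>Integration against \<open>w\<close> is linear and an interval about \<open>c\<close> is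
  convex, so midpoints keep the estimate; limits of pairings survive the passage to the
  hulls.\<close>

lemma integral_midpoint_hull_near:
  assumes "a \<in> midpoint_hull \<phi> n"
    and \<phi>: "\<And>m. \<phi> m \<in> borel_measurable M" "\<And>m x. \<bar>\<phi> m x\<bar> \<le> 1" and w: "integrable M w"
    and near: "\<And>m. n \<le> m \<Longrightarrow> \<bar>(\<integral>x. \<phi> m x * w x \<partial>M) - c\<bar> \<le> \<epsilon>"
  shows "\<bar>(\<integral>x. a x * w x \<partial>M) - c\<bar> \<le> \<epsilon>"
  using assms(1)
proof induction
  case (mid a b)
  have int: "integrable M (\<lambda>x. a x * w x)" if "a \<in> midpoint_hull \<phi> n" for a
  proof (rule Bochner_Integration.integrable_bound[OF w])
    show "(\<lambda>x. a x * w x) \<in> borel_measurable M"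
      using midpoint_hull_measurable[OF that \<phi>(1)] w by auto
    show "AE x in M. norm (a x * w x) \<le> norm (w x)"
      using midpoint_hull_bounded[OF that \<phi>(2)] by (auto simp: abs_mult mult_left_le_one_le)
  qed
  have "(\<integral>x. (a x + b x) / 2 * w x \<partial>M) = (\<integral>x. (a x * w x + b x * w x) / 2 \<partial>M)"
    by (rule Bochner_Integration.integral_cong) (auto simp: field_simps)
  also have "\<dots> = ((\<integral>x. a x * w x \<partial>M) + (\<integral>x. b x * w x \<partial>M)) / 2"
    using int mid.hyps by simp
  finally show ?case using mid.IH by (simp add: abs_le_iff field_simps)
qed (use near in auto)

text \<open>The infima \<open>d n\<close> of the squared norm over the shrinking hulls increase to a
  finite \<open>D\<close>. Two functions with squared norm close to \<open>D\<close> have a midpoint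
  whose squared norm is not much below \<open>D\<close>, which bounds their distance. Geometric
  rates make the increments summable almost everywhere.\<close>

lemma midpoint_hull_converges_AE:
  fixes \<phi> :: "nat \<Rightarrow> 'a \<Rightarrow> real"
  assumes "finite_measure M"
    and \<phi>: "\<And>m. \<phi> m \<in> borel_measurable M" "\<And>m x. \<bar>\<phi> m x\<bar> \<le> 1"
  obtains \<psi> where "\<And>n. \<psi> n \<in> midpoint_hull \<phi> n" "AE x in M. convergent (\<lambda>n. \<psi> n x)"
proof -
  interpret finite_measure M by fact
  define N where "N a = (\<integral>x. (a x)\<^sup>2 \<partial>M)" for a :: "'a \<Rightarrow> real"
  define C where "C = midpoint_hull \<phi>"
  define d where "d n = Inf (N ` C n)" for n
  have Cne: "C n \<noteq> {}" for n using midpoint_hull.base[of n n \<phi>] by (auto simp: C_def)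
  have Cmono: "m \<le> n \<Longrightarrow> C n \<subseteq> C m" for m n unfolding C_def by (rule midpoint_hull_antimono)
  have Cmeas: "a \<in> borel_measurable M" if "a \<in> C n" for a n
    using midpoint_hull_measurable \<phi>(1) that unfolding C_def by blast
  have Cbnd: "\<bar>a x\<bar> \<le> 1" if "a \<in> C n" for a n x
    using midpoint_hull_bounded[of a \<phi> n] \<phi>(2) that unfolding C_def by blast
  have sq: "integrable M (\<lambda>x. (a x)\<^sup>2)" if "a \<in> C n" for a n
    using Cmeas[OF that] Cbnd[OF that]
    by (intro integrable_const_bound[where B = 1]) (auto simp: abs_square_le_1)
  have N0: "N a \<ge> 0" for a unfolding N_def by simp
  then have bdd: "bdd_below (N ` A)" for A by (intro bdd_belowI[of _ 0]) auto
  have dle: "d n \<le> N a" if "a \<in> C n" for a n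
    unfolding d_def using bdd that by (intro cInf_lower) auto
  have Nle: "N a \<le> measure M (space M)" if "a \<in> C n" for a n
  proof -
    have "N a \<le> (\<integral>x. 1 \<partial>M)"
      unfolding N_def using sq[OF that] Cbnd[OF that]
      by (intro integral_mono) (auto simp: abs_square_le_1)
    then show ?thesis by simp
  qed
  define D where "D = Sup (range d)"
  have bddd: "bdd_above (range d)"
    using Cne dle Nle by (intro bdd_aboveI[of _ "measure M (space M)"]) (force intro: order_trans)
  then have dD: "d n \<le> D" for n unfolding D_def by (intro cSup_upper) auto
  \<comment> \<open>Chosen so that the parallelogram bound 8 e_k becomes 4^-k, which leaves the
    order 2^-k after passing from L^2 to L^1.\<close>
  define e where "e k = (1/4::real)^k / 8" for k
  have e: "e k > 0" "e (Suc k) \<le> e k" for k by (auto simp: e_def)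
  have "\<exists>n \<psi>. k \<le> n \<and> D - e k < d n \<and> \<psi> \<in> C n \<and> N \<psi> < D + e k" for k
  proof -
    obtain n0 where n0: "D - e k < d n0"
      using less_cSup_iff[of "range d" "D - e k"] bddd e(1)[of k] unfolding D_def by auto
    define n where "n = max k n0"
    have "d n0 \<le> d n"
      unfolding d_def using Cmono[of n0 n] Cne bdd by (intro cInf_superset_mono image_mono) (auto simp: n_def)
    moreover have "Inf (N ` C n) < D + e k" using dD[of n] e(1)[of k] by (simp add: d_def)
    then obtain \<psi> where "\<psi> \<in> C n" "N \<psi> < D + e k"
      using cInf_less_iff[of "N ` C n" "D + e k"] Cne bdd by auto
    ultimately show ?thesis using n0 by (intro exI[of _ n] exI[of _ \<psi>]) (auto simp: n_def)
  qed
  then obtain n \<psi> where n: "\<And>k. k \<le> n k" "\<And>k. D - e k < d (n k)"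
    and \<psi>: "\<And>k. \<psi> k \<in> C (n k)" "\<And>k. N (\<psi> k) < D + e k" by metis
  have \<psi>C: "\<psi> k \<in> C k" for k using \<psi>(1) n(1) Cmono by blast
  have \<psi>m: "\<psi> k \<in> borel_measurable M" for k using Cmeas \<psi>C by blast
  define \<delta> where "\<delta> k x = \<psi> (Suc k) x - \<psi> k x" for k x
  have \<delta>m: "\<delta> k \<in> borel_measurable M" for k unfolding \<delta>_def using \<psi>m by auto
  have \<delta>sq: "integrable M (\<lambda>x. (\<delta> k x)\<^sup>2)" for k
  proof (intro integrable_const_bound[where B = 4])
    have "\<bar>\<delta> k x\<bar> \<le> 2" for x using Cbnd[OF \<psi>C[of k], of x] Cbnd[OF \<psi>C[of "Suc k"], of x] by (auto simp: \<delta>_def)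
    then show "AE x in M. norm ((\<delta> k x)\<^sup>2) \<le> 4"
      using power_mono[of "\<bar>\<delta> k _\<bar>" 2 2] by (auto simp: power2_abs)
  qed (use \<delta>m in auto)
  have small: "(\<integral>x. (\<delta> k x)\<^sup>2 \<partial>M) \<le> (1/4)^k" for k
  proof -
    \<comment> \<open>Both functions lie in the hull of the smaller index, hence so does their
      midpoint, whose squared norm is at least \<open>d m\<close>.\<close>
    define m where "m = min (n k) (n (Suc k))"
    have in1: "\<psi> k \<in> C m" "\<psi> (Suc k) \<in> C m"
      using Cmono[of m "n k"] Cmono[of m "n (Suc k)"] \<psi>(1) by (auto simp: m_def)
    define \<mu> where "\<mu> x = (\<psi> k x + \<psi> (Suc k) x) / 2" for x
    have \<mu>: "\<mu> \<in> C m" using in1 unfolding \<mu>_def C_def by (rule midpoint_hull.mid)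
    have "D - e k < d m" using n(2)[of k] n(2)[of "Suc k"] e(2)[of k] by (auto simp: m_def min_def)
    then have "D - e k < N \<mu>" using dle[OF \<mu>] by linarith
    moreover have "N (\<psi> k) < D + e k" "N (\<psi> (Suc k)) < D + e k"
      using \<psi>(2)[of k] \<psi>(2)[of "Suc k"] e(2)[of k] by auto
    moreover have "(\<integral>x. (\<delta> k x)\<^sup>2 \<partial>M) = (\<integral>x. 2 * (\<psi> k x)\<^sup>2 + 2 * (\<psi> (Suc k) x)\<^sup>2 - 4 * (\<mu> x)\<^sup>2 \<partial>M)"
      by (rule Bochner_Integration.integral_cong) (auto simp: \<delta>_def \<mu>_def power2_eq_square field_simps)
    then have "(\<integral>x. (\<delta> k x)\<^sup>2 \<partial>M) = 2 * N (\<psi> k) + 2 * N (\<psi> (Suc k)) - 4 * N \<mu>"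
      using sq[OF in1(1)] sq[OF in1(2)] sq[OF \<mu>] by (simp add: N_def)
    ultimately have "(\<integral>x. (\<delta> k x)\<^sup>2 \<partial>M) \<le> 8 * e k" by linarith
    then show ?thesis by (simp add: e_def)
  qed
  have L1: "(\<integral>\<^sup>+x. ennreal \<bar>\<delta> k x\<bar> \<partial>M) \<le> ennreal ((1/2)^k * (1 + measure M (space M)))" for k
  proof -
    \<comment> \<open>A weighted form of t <= t^2 + 1 with t = 2^k |\<delta>|; it does the work of
      the Cauchy-Schwarz inequality on a finite measure space.\<close>
    have "\<bar>\<delta> k x\<bar> \<le> 2^k * (\<delta> k x)\<^sup>2 + (1/2)^k" for x
    proof -
      define t where "t = 2^k * \<bar>\<delta> k x\<bar>"
      have "2 * t \<le> t\<^sup>2 + 1" using zero_le_power2[of "t - 1"] by (simp add: power2_eq_square algebra_simps)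
      moreover have "0 \<le> t" by (simp add: t_def)
      ultimately have "t \<le> t\<^sup>2 + 1" by linarith
      then have "t / 2^k \<le> (t\<^sup>2 + 1) / 2^k" by (intro divide_right_mono) auto
      then show ?thesis by (simp add: t_def power_mult_distrib field_simps power2_eq_square power_divide)
    qed
    then have "(\<integral>\<^sup>+x. ennreal \<bar>\<delta> k x\<bar> \<partial>M) \<le> (\<integral>\<^sup>+x. ennreal (2^k * (\<delta> k x)\<^sup>2 + (1/2)^k) \<partial>M)"
      by (intro nn_integral_mono ennreal_leI) auto
    also have "\<dots> = ennreal (\<integral>x. 2^k * (\<delta> k x)\<^sup>2 + (1/2)^k \<partial>M)"
      using \<delta>sq by (intro nn_integral_eq_integral) auto
    also have "(\<integral>x. 2^k * (\<delta> k x)\<^sup>2 + (1/2)^k \<partial>M) = 2^k * (\<integral>x. (\<delta> k x)\<^sup>2 \<partial>M) + (1/2)^k * measure M (space M)"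
      using \<delta>sq by simp
    also have "ennreal \<dots> \<le> ennreal ((1/2)^k * (1 + measure M (space M)))"
    proof (rule ennreal_leI)
      have "2^k * (\<integral>x. (\<delta> k x)\<^sup>2 \<partial>M) \<le> 2^k * (1/4)^k" using small[of k] by (intro mult_left_mono) auto
      also have "2^k * (1/4::real)^k = (1/2)^k" by (simp flip: power_mult_distrib)
      finally show "2^k * (\<integral>x. (\<delta> k x)\<^sup>2 \<partial>M) + (1/2)^k * measure M (space M) \<le> (1/2)^k * (1 + measure M (space M))"
        by (simp add: algebra_simps)
    qed
    finally show ?thesis .
  qed
  have "(\<integral>\<^sup>+x. (\<Sum>k. ennreal \<bar>\<delta> k x\<bar>) \<partial>M) = (\<Sum>k. \<integral>\<^sup>+x. ennreal \<bar>\<delta> k x\<bar> \<partial>M)"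
    using \<delta>m by (intro nn_integral_suminf) auto
  also have "\<dots> \<le> (\<Sum>k. ennreal ((1/2)^k * (1 + measure M (space M))))"
    by (intro suminf_le L1) auto
  also have "\<dots> = ennreal (\<Sum>k. (1/2)^k * (1 + measure M (space M)))"
    by (intro suminf_ennreal2 summable_mult2 summable_geometric) auto
  finally have "(\<integral>\<^sup>+x. (\<Sum>k. ennreal \<bar>\<delta> k x\<bar>) \<partial>M) \<noteq> \<infinity>" by (auto simp: top_unique)
  then have "AE x in M. (\<Sum>k. ennreal \<bar>\<delta> k x\<bar>) \<noteq> \<infinity>"
    using \<delta>m by (intro nn_integral_noteq_infinite) auto
  then have "AE x in M. convergent (\<lambda>n. \<psi> n x)"
  proof eventually_elim
    case (elim x)
    then have "summable (\<lambda>k. \<bar>\<delta> k x\<bar>)" by (intro summable_suminf_not_top) auto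
    then have "summable (\<lambda>k. \<delta> k x)" by (rule summable_rabs_cancel)
    then have "convergent (\<lambda>n. \<Sum>k<n. \<delta> k x)" by (simp add: summable_iff_convergent)
    moreover have "(\<lambda>n. \<Sum>k<n. \<delta> k x) = (\<lambda>n. \<psi> n x - \<psi> 0 x)"
      unfolding \<delta>_def using sum_lessThan_telescope[of "\<lambda>k. \<psi> k x"] by auto
    ultimately have "convergent (\<lambda>n. \<psi> n x - \<psi> 0 x)" by simp
    then show ?case by (simp add: convergent_diff_const_right_iff)
  qed
  then show ?thesis using that[of \<psi>] \<psi>C by (simp add: C_def)
qed

text \<open>Dividing by \<open>h\<close> gives a sequence bounded by 1, and a strictly positive
  integrable weight turns Lebesgue measure into a finite measure with the same null sets. The
  pairings already converge to \<open>c\<close> along the whole sequence, so the elements of the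
  hulls inherit this limit; dominated convergence with |h u| carries it over to their pointwise
  limit.\<close>

lemma weak_limit_dominated:
  fixes k :: "nat \<Rightarrow> 'a::euclidean_space \<Rightarrow> real" and h :: "'a \<Rightarrow> real"
  assumes k: "\<And>n. k n \<in> borel_measurable borel" "\<And>n x. \<bar>k n x\<bar> \<le> h x" and h: "h \<in> borel_measurable borel"
  obtains g where "g \<in> borel_measurable borel" "\<And>x. \<bar>g x\<bar> \<le> h x"
    "\<And>u c. u \<in> borel_measurable borel \<Longrightarrow> integrable lborel (\<lambda>x. h x * u x) \<Longrightarrow>
      (\<lambda>n. LBINT x. k n x * u x) \<longlonglongrightarrow> c \<Longrightarrow> (LBINT x. g x * u x) = c"
proof -
  \<comment> \<open>Where \<open>h\<close> vanishes so does every \<open>k n\<close>; the value 0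
    keeps k n = \<phi> n h valid there.\<close>
  define \<phi> where "\<phi> n x = (if h x = 0 then 0 else k n x / h x)" for n x
  have h0: "0 \<le> h x" for x using k(2)[of 0 x] by linarith
  have [measurable]: "k n \<in> borel_measurable borel" "h \<in> borel_measurable borel" for n using k h by auto
  have \<phi>m: "\<phi> n \<in> borel_measurable borel" for n unfolding \<phi>_def[abs_def] by measurable
  have \<phi>b: "\<bar>\<phi> n x\<bar> \<le> 1" for n x
    using k(2)[of n x] h0[of x] by (auto simp: \<phi>_def abs_divide divide_le_eq)
  have k\<phi>: "k n x = \<phi> n x * h x" for n x using k(2)[of n x] by (auto simp: \<phi>_def)
  obtain w where w: "w \<in> borel_measurable lborel" "integral\<^sup>N lborel w \<noteq> \<infinity>" "\<And>x::'a. 0 < w x \<and> w x < \<infinity>"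
    using sigma_finite_measure.Ex_finite_integrable_function[OF sigma_finite_lborel] by auto
  define \<mu> where "\<mu> = density lborel w"
  have fin: "finite_measure \<mu>"
    unfolding \<mu>_def using w by (intro finite_measureI) (simp add: emeasure_density)
  have \<phi>m\<mu>: "\<phi> n \<in> borel_measurable \<mu>" for n using \<phi>m by (simp add: \<mu>_def)
  obtain \<psi> where \<psi>: "\<And>n. \<psi> n \<in> midpoint_hull \<phi> n" "AE x in \<mu>. convergent (\<lambda>n. \<psi> n x)"
    by (rule midpoint_hull_converges_AE[OF fin \<phi>m\<mu> \<phi>b]) (rule that)
  have conv: "AE x in lborel. convergent (\<lambda>n. \<psi> n x)"
    using \<psi>(2) w unfolding \<mu>_def by (subst (asm) AE_density) auto
  have \<psi>m: "\<psi> n \<in> borel_measurable borel" for n by (rule midpoint_hull_measurable[OF \<psi>(1) \<phi>m])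
  have \<psi>b: "\<bar>\<psi> n x\<bar> \<le> 1" for n x by (rule midpoint_hull_bounded[OF \<psi>(1) \<phi>b])
  \<comment> \<open>Clamping makes the bound by \<open>h\<close> hold at every point, also where the
    limit does not exist.\<close>
  define G where "G x = max (-1) (min 1 (lim (\<lambda>n. \<psi> n x)))" for x
  have [measurable]: "(\<lambda>x. lim (\<lambda>n. \<psi> n x)) \<in> borel_measurable borel"
    by (rule borel_measurable_lim_metric[OF \<psi>m])
  have Gm [measurable]: "G \<in> borel_measurable borel" unfolding G_def[abs_def] by measurable
  have lim: "AE x in lborel. (\<lambda>n. \<psi> n x) \<longlonglongrightarrow> G x"
    using conv
  proof eventually_elim
    case (elim x)
    then have l: "(\<lambda>n. \<psi> n x) \<longlonglongrightarrow> lim (\<lambda>n. \<psi> n x)" by (simp add: convergent_LIMSEQ_iff)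
    have "lim (\<lambda>n. \<psi> n x) \<le> 1" "-1 \<le> lim (\<lambda>n. \<psi> n x)"
      using \<psi>b[of _ x] by (auto intro!: LIMSEQ_le_const2[OF l] LIMSEQ_le_const[OF l] simp: abs_le_iff minus_le_iff)
    then have "G x = lim (\<lambda>n. \<psi> n x)" by (simp add: G_def)
    with l show ?case by simp
  qed
  show thesis
  proof (rule that[of "\<lambda>x. h x * G x"])
    show "(\<lambda>x. h x * G x) \<in> borel_measurable borel" by measurable
    show "\<bar>h x * G x\<bar> \<le> h x" for x
    proof -
      have "\<bar>G x\<bar> \<le> 1" by (auto simp: G_def)
      then show ?thesis using h0[of x] by (simp add: abs_mult mult_left_le)
    qed
    fix u :: "'a \<Rightarrow> real" and c
    assume u: "u \<in> borel_measurable borel" and hu: "integrable lborel (\<lambda>x. h x * u x)"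
      and c: "(\<lambda>n. LBINT x. k n x * u x) \<longlonglongrightarrow> c"
    have [measurable]: "u \<in> borel_measurable borel" by (rule u)
    have [measurable]: "\<psi> n \<in> borel_measurable borel" for n by (rule \<psi>m)
    have c': "(\<lambda>n. LBINT x. \<phi> n x * (h x * u x)) \<longlonglongrightarrow> c"
      using c by (simp add: k\<phi> mult.assoc)
    have "(\<lambda>n. LBINT x. \<psi> n x * (h x * u x)) \<longlonglongrightarrow> c"
    proof (rule LIMSEQ_I)
      fix r :: real assume "r > 0"
      then obtain n0 where n0: "\<And>n. n \<ge> n0 \<Longrightarrow> \<bar>(LBINT x. \<phi> n x * (h x * u x)) - c\<bar> < r / 2"
        using LIMSEQ_D[OF c', of "r / 2"] by auto
      have "\<bar>(LBINT x. \<psi> n x * (h x * u x)) - c\<bar> \<le> r / 2" if "n \<ge> n0" for n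
      proof (rule integral_midpoint_hull_near[OF \<psi>(1) _ \<phi>b hu])
        show "\<phi> m \<in> borel_measurable lborel" for m using \<phi>m by simp
        show "\<bar>(LBINT x. \<phi> m x * (h x * u x)) - c\<bar> \<le> r / 2" if "n \<le> m" for m
          using n0[of m] that \<open>n0 \<le> n\<close> by linarith
      qed
      then show "\<exists>n0. \<forall>n\<ge>n0. norm ((LBINT x. \<psi> n x * (h x * u x)) - c) < r"
        using \<open>r > 0\<close> by (intro exI[of _ n0]) (force intro: le_less_trans)
    qed
    moreover have "(\<lambda>n. LBINT x. \<psi> n x * (h x * u x)) \<longlonglongrightarrow> (LBINT x. G x * (h x * u x))"
    proof (rule integral_dominated_convergence)
      show "integrable lborel (\<lambda>x. \<bar>h x * u x\<bar>)" using hu by auto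
      show "AE x in lborel. (\<lambda>n. \<psi> n x * (h x * u x)) \<longlonglongrightarrow> G x * (h x * u x)"
        using lim by eventually_elim (intro tendsto_intros)
      show "AE x in lborel. norm (\<psi> n x * (h x * u x)) \<le> \<bar>h x * u x\<bar>" for n
      proof (rule AE_I2)
        fix x show "norm (\<psi> n x * (h x * u x)) \<le> \<bar>h x * u x\<bar>"
          using mult_right_mono[OF \<psi>b[of n x], of "\<bar>h x * u x\<bar>"] by (simp add: abs_mult)
      qed
    qed measurable
    ultimately have "(LBINT x. G x * (h x * u x)) = c" using LIMSEQ_unique by blast
    then show "(LBINT x. h x * G x * u x) = c" by (simp add: mult_ac)
  qed
qed

section \<open>Difference quotients along the flow\<close>

text \<open>Linearises the volume factor (1 + 2 \<Lambda> |t|)^DIM, so that its distance from 1 is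
  of order \<open>t\<close>.\<close>

lemma one_plus_power_diff_le:
  fixes z :: real
  assumes "0 \<le> z"
  shows "(1 + z) ^ n - 1 \<le> real n * z * (1 + z) ^ n"
proof (induction n)
  case (Suc n)
  have "(1 + z) ^ Suc n - 1 = ((1 + z) ^ n - 1) + z * (1 + z) ^ n" by (simp add: algebra_simps)
  also have "\<dots> \<le> real n * z * (1 + z) ^ n + z * (1 + z) ^ n" using Suc by simp
  also have "\<dots> = real (Suc n) * z * (1 + z) ^ n" by (simp add: algebra_simps)
  also have "\<dots> \<le> real (Suc n) * z * (1 + z) ^ Suc n"
    using assms by (intro mult_left_mono power_increasing) auto
  finally show ?case .
qed simp

lemma integrable_mult_bounded:
  fixes F u :: "'a::euclidean_space \<Rightarrow> real"
  assumes F: "integrable lborel F" and u: "u \<in> borel_measurable borel" "\<And>x. \<bar>u x\<bar> \<le> B"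
  shows "integrable lborel (\<lambda>x. F x * u x)"
    and "(LBINT x. \<bar>F x * u x\<bar>) \<le> B * (LBINT x. \<bar>F x\<bar>)"
proof -
  have B: "B \<ge> 0" using u(2)[of undefined] by linarith
  have bd: "\<bar>F x * u x\<bar> \<le> B * \<bar>F x\<bar>" for x
    using mult_right_mono[OF u(2)[of x], of "\<bar>F x\<bar>"] by (simp add: abs_mult mult_ac)
  show int: "integrable lborel (\<lambda>x. F x * u x)"
  proof (rule Bochner_Integration.integrable_bound)
    show "integrable lborel (\<lambda>x. B * \<bar>F x\<bar>)" using F by auto
    show "AE x in lborel. norm (F x * u x) \<le> norm (B * \<bar>F x\<bar>)" using bd B by (simp add: abs_mult)
  qed (use F u in auto)
  have "(LBINT x. \<bar>F x * u x\<bar>) \<le> (LBINT x. B * \<bar>F x\<bar>)"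
    using int F bd by (intro integral_mono) auto
  then show "(LBINT x. \<bar>F x * u x\<bar>) \<le> B * (LBINT x. \<bar>F x\<bar>)" by simp
qed

lemma integrable_mult_lebesgue_bounded:
  fixes F V :: "'a::euclidean_space \<Rightarrow> real"
  assumes F: "integrable lebesgue F" and V: "V \<in> borel_measurable lebesgue" "AE x in lebesgue. \<bar>V x\<bar> \<le> b" and b: "b \<ge> 0"
  shows "integrable lebesgue (\<lambda>x. F x * V x)"
    and "\<bar>\<integral>x. F x * V x \<partial>lebesgue\<bar> \<le> b * (\<integral>x. \<bar>F x\<bar> \<partial>lebesgue)"
proof -
  have bd: "AE x in lebesgue. \<bar>F x * V x\<bar> \<le> b * \<bar>F x\<bar>"
    using V(2)
  proof eventually_elim
    case (elim x)
    from mult_right_mono[OF this, of "\<bar>F x\<bar>"] show ?case by (simp add: abs_mult mult_ac)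
  qed
  have Fb: "integrable lebesgue (\<lambda>x. b * \<bar>F x\<bar>)" using F by auto
  show int: "integrable lebesgue (\<lambda>x. F x * V x)"
  proof (rule Bochner_Integration.integrable_bound[OF Fb])
    show "AE x in lebesgue. norm (F x * V x) \<le> norm (b * \<bar>F x\<bar>)"
      using bd by eventually_elim (use b in \<open>auto simp: abs_mult\<close>)
  qed (use F V in auto)
  have "\<bar>\<integral>x. F x * V x \<partial>lebesgue\<bar> \<le> (\<integral>x. \<bar>F x * V x\<bar> \<partial>lebesgue)" by (rule integral_abs_bound)
  also have "\<dots> \<le> (\<integral>x. b * \<bar>F x\<bar> \<partial>lebesgue)"
    using int by (intro integral_mono_AE Fb bd) auto
  finally show "\<bar>\<integral>x. F x * V x \<partial>lebesgue\<bar> \<le> b * (\<integral>x. \<bar>F x\<bar> \<partial>lebesgue)" by simp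
qed

section \<open>Integral estimates under the short-time flow\<close>

context short_time_flow
begin

lemma continuous_flow: "continuous_on S (\<Psi> t)"
proof -
  have "continuous_on S (\<lambda>x. (t, x))" by (intro continuous_intros)
  then show ?thesis using continuous_on_compose2[OF continuous, of S "\<lambda>x. (t, x)"] by simp
qed

lemma flow_measurable [measurable]: "\<Psi> t \<in> borel_measurable borel"
  by (rule borel_measurable_continuous_onI[OF continuous_flow])

lemma flow_in_ball:
  assumes "norm x \<le> R" "t \<in> {0..\<tau>}"
  shows "\<Psi> t x \<in> cball 0 (R + M * \<tau>)" "x \<in> cball 0 (R + M * \<tau>)"
proof -
  have "norm (\<Psi> t x - x) \<le> M * \<bar>t\<bar>" using assms by (intro speed) auto
  also have "\<dots> \<le> M * \<tau>" using assms M by (intro mult_left_mono) auto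
  finally have "norm (\<Psi> t x) \<le> norm x + M * \<tau>" using norm_triangle_ineq2[of "\<Psi> t x" x] by linarith
  moreover have "0 \<le> M * \<tau>" using M \<tau> by simp
  ultimately show "\<Psi> t x \<in> cball 0 (R + M * \<tau>)" "x \<in> cball 0 (R + M * \<tau>)" using assms by auto
qed

text \<open>A bound, uniform in time, for the volume factor (1 + 2 \<Lambda> |t|)^DIM: on the time
  interval 2 \<Lambda> |t| <= 1/3, so the base is below 2.\<close>

definition distortion :: real where "distortion = 2 ^ DIM('a)"

lemma distortion_ge_1: "1 \<le> distortion"
  by (simp add: distortion_def)

lemma expansion_power:
  assumes "t \<in> {-\<tau>..\<tau>}"
  shows "0 \<le> 1 + 2 * \<Lambda> * \<bar>t\<bar>" "1 \<le> (1 + 2 * \<Lambda> * \<bar>t\<bar>) ^ DIM('a)"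
    "(1 + 2 * \<Lambda> * \<bar>t\<bar>) ^ DIM('a) \<le> distortion"
    "(1 + 2 * \<Lambda> * \<bar>t\<bar>) ^ DIM('a) - 1 \<le> (DIM('a) * 2 * \<Lambda> * distortion) * \<bar>t\<bar>"
proof -
  define z where "z = 2 * \<Lambda> * \<bar>t\<bar>"
  have "\<Lambda> * \<bar>t\<bar> \<le> \<Lambda> * \<tau>" using assms \<Lambda> by (intro mult_left_mono) auto
  then have z: "0 \<le> z" "z \<le> 1" using \<Lambda>\<tau> \<Lambda> by (auto simp: z_def)
  have le: "(1 + z) ^ DIM('a) \<le> distortion" unfolding distortion_def using z by (intro power_mono) auto
  have "(1 + z) ^ DIM('a) - 1 \<le> DIM('a) * z * (1 + z) ^ DIM('a)" by (rule one_plus_power_diff_le[OF z(1)])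
  also have "\<dots> \<le> DIM('a) * z * distortion" using z le by (intro mult_left_mono) auto
  finally show "(1 + 2 * \<Lambda> * \<bar>t\<bar>) ^ DIM('a) - 1 \<le> (DIM('a) * 2 * \<Lambda> * distortion) * \<bar>t\<bar>"
    by (simp add: z_def mult_ac)
  show "0 \<le> 1 + 2 * \<Lambda> * \<bar>t\<bar>" "1 \<le> (1 + 2 * \<Lambda> * \<bar>t\<bar>) ^ DIM('a)" "(1 + 2 * \<Lambda> * \<bar>t\<bar>) ^ DIM('a) \<le> distortion"
    using z le unfolding z_def[symmetric] by auto
qed

lemma nn_integral_flow_le:
  assumes t: "t \<in> {-\<tau>..\<tau>}" and \<phi>: "\<phi> \<in> borel_measurable borel"
  shows "(\<integral>\<^sup>+x. \<phi> (\<Psi> t x) \<partial>lborel) \<le> ennreal ((1 + 2 * \<Lambda> * \<bar>t\<bar>) ^ DIM('a)) * (\<integral>\<^sup>+x. \<phi> x \<partial>lborel)"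
proof -
  have mt: "- t \<in> {-\<tau>..\<tau>}" using t by auto
  show ?thesis
    using nn_integral_infnorm_lipschitz_le[of "\<Psi> (-t)" "1 + 2 * \<Lambda> * \<bar>t\<bar>" "\<Psi> t" \<phi>]
      expansion[OF mt] expansion_power(1)[OF t] inverse[OF t] inverse[OF mt] continuous_flow \<phi> by simp
qed

text \<open>Composition with the flow is thereby compatible with almost everywhere equality, so
  representatives may be exchanged under it.\<close>

lemma null_set_flow:
  assumes t: "t \<in> {-\<tau>..\<tau>}" and N: "N \<in> null_sets lborel"
  shows "AE x in lborel. \<Psi> t x \<notin> N"
proof -
  have "(\<integral>\<^sup>+x. indicator N (\<Psi> t x) \<partial>lborel) \<le> ennreal ((1 + 2 * \<Lambda> * \<bar>t\<bar>) ^ DIM('a)) * (\<integral>\<^sup>+x. indicator N x \<partial>lborel)"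
    using N by (intro nn_integral_flow_le[OF t]) auto
  also have "\<dots> = 0" using N by (simp add: null_sets_def)
  finally have "(\<integral>\<^sup>+x. indicator N (\<Psi> t x) \<partial>lborel) = 0" by simp
  moreover have [measurable]: "N \<in> sets borel" using N by auto
  have "(\<lambda>x. indicator N (\<Psi> t x) :: ennreal) \<in> borel_measurable lborel" by measurable
  ultimately have "AE x in lborel. (indicator N (\<Psi> t x) :: ennreal) = 0" by (subst (asm) nn_integral_0_iff_AE) auto
  then show ?thesis by eventually_elim (auto simp: indicator_def split: if_splits)
qed

lemma integral_flow_le:
  fixes w :: "'a \<Rightarrow> real"
  assumes t: "t \<in> {-\<tau>..\<tau>}" and w: "integrable lborel w"
  shows "integrable lborel (\<lambda>x. w (\<Psi> t x))"
    and "(LBINT x. \<bar>w (\<Psi> t x)\<bar>) \<le> (1 + 2 * \<Lambda> * \<bar>t\<bar>) ^ DIM('a) * (LBINT x. \<bar>w x\<bar>)"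
proof -
  have [measurable]: "w \<in> borel_measurable borel" using w by auto
  have "(\<integral>\<^sup>+x. ennreal \<bar>w (\<Psi> t x)\<bar> \<partial>lborel) \<le> ennreal ((1 + 2 * \<Lambda> * \<bar>t\<bar>) ^ DIM('a)) * (\<integral>\<^sup>+x. ennreal \<bar>w x\<bar> \<partial>lborel)"
    by (intro nn_integral_flow_le[OF t, of "\<lambda>x. ennreal \<bar>w x\<bar>"]) auto
  also have "(\<integral>\<^sup>+x. ennreal \<bar>w x\<bar> \<partial>lborel) = ennreal (LBINT x. \<bar>w x\<bar>)"
    using w by (intro nn_integral_eq_integral) auto
  finally have le: "(\<integral>\<^sup>+x. ennreal \<bar>w (\<Psi> t x)\<bar> \<partial>lborel) \<le> ennreal ((1 + 2 * \<Lambda> * \<bar>t\<bar>) ^ DIM('a) * (LBINT x. \<bar>w x\<bar>))"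
    using expansion_power[OF t] by (simp add: ennreal_mult)
  then have "(\<integral>\<^sup>+x. ennreal (norm (w (\<Psi> t x))) \<partial>lborel) < \<infinity>" by (auto simp: less_top[symmetric] top_unique)
  moreover have "(\<lambda>x. w (\<Psi> t x)) \<in> borel_measurable lborel" by measurable
  ultimately show int: "integrable lborel (\<lambda>x. w (\<Psi> t x))" by (intro integrableI_bounded)
  have "(\<integral>\<^sup>+x. ennreal \<bar>w (\<Psi> t x)\<bar> \<partial>lborel) = ennreal (LBINT x. \<bar>w (\<Psi> t x)\<bar>)"
    using int by (intro nn_integral_eq_integral) auto
  then show "(LBINT x. \<bar>w (\<Psi> t x)\<bar>) \<le> (1 + 2 * \<Lambda> * \<bar>t\<bar>) ^ DIM('a) * (LBINT x. \<bar>w x\<bar>)"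
    using le expansion_power[OF t] by (simp add: ennreal_le_iff)
qed

lemma integral_abs_flow_le:
  fixes w :: "'a \<Rightarrow> real"
  assumes t: "t \<in> {-\<tau>..\<tau>}" and w: "integrable lborel w"
  shows "(LBINT x. \<bar>w (\<Psi> t x)\<bar>) \<le> distortion * (LBINT x. \<bar>w x\<bar>)"
proof -
  have "(LBINT x. \<bar>w (\<Psi> t x)\<bar>) \<le> (1 + 2 * \<Lambda> * \<bar>t\<bar>) ^ DIM('a) * (LBINT x. \<bar>w x\<bar>)"
    by (rule integral_flow_le(2)[OF assms])
  also have "\<dots> \<le> distortion * (LBINT x. \<bar>w x\<bar>)"
    by (intro mult_right_mono expansion_power(3)[OF t]) simp
  finally show ?thesis .
qed

text \<open>The flow map and its inverse both distort volume at most by k, so J <= k I and I <= k J;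
  as k - 1 is of order \<open>t\<close>, so is the difference. One factor \<open>distortion\<close>
  comes from the bound for k - 1, the other from estimating J by I.\<close>

lemma integral_flow_diff_nonneg:
  fixes w :: "'a \<Rightarrow> real"
  assumes t: "t \<in> {-\<tau>..\<tau>}" and w: "integrable lborel w" "\<And>x. w x \<ge> 0"
  shows "\<bar>(LBINT x. w (\<Psi> t x)) - (LBINT x. w x)\<bar>
    \<le> (DIM('a) * 2 * \<Lambda> * distortion\<^sup>2) * \<bar>t\<bar> * (LBINT x. w x)"
proof -
  define k where "k = (1 + 2 * \<Lambda> * \<bar>t\<bar>) ^ DIM('a)"
  define c where "c = DIM('a) * 2 * \<Lambda> * distortion * \<bar>t\<bar>"
  have k: "1 \<le> k" "k \<le> distortion" "k - 1 \<le> c" using expansion_power[OF t] by (simp_all add: k_def c_def)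
  have c: "c \<ge> 0" using k by linarith
  define I J where "I = (LBINT x. w x)" and "J = (LBINT x. w (\<Psi> t x))"
  have pos: "I \<ge> 0" "J \<ge> 0" unfolding I_def J_def using w by auto
  have JI: "J \<le> k * I"
    using integral_flow_le(2)[OF t w(1)] w(2) by (simp add: I_def J_def k_def)
  have mt: "- t \<in> {-\<tau>..\<tau>}" using t by auto
  have IJ: "I \<le> k * J"
    using integral_flow_le(2)[OF mt integral_flow_le(1)[OF t w(1)]] w(2) inverse[OF mt]
    by (simp add: I_def J_def k_def)
  have "J - I \<le> (k - 1) * I" using JI by (simp add: algebra_simps)
  also have "\<dots> \<le> c * I" using k pos by (intro mult_right_mono) auto
  also have "\<dots> \<le> c * (distortion * I)"
    using mult_right_mono[OF distortion_ge_1 pos(1)] c by (intro mult_left_mono) auto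
  finally have 1: "J - I \<le> c * (distortion * I)" .
  have "I - J \<le> (k - 1) * J" using IJ by (simp add: algebra_simps)
  also have "\<dots> \<le> c * J" using k pos by (intro mult_right_mono) auto
  also have "\<dots> \<le> c * (distortion * I)"
    using JI mult_right_mono[OF k(2) pos(1)] c by (intro mult_left_mono) auto
  finally have "\<bar>J - I\<bar> \<le> c * (distortion * I)" using 1 by linarith
  then show ?thesis by (simp add: I_def J_def c_def power2_eq_square mult_ac)
qed

lemma integral_flow_diff:
  fixes w :: "'a \<Rightarrow> real"
  assumes t: "t \<in> {-\<tau>..\<tau>}" and w: "integrable lborel w"
  shows "\<bar>(LBINT x. w (\<Psi> t x)) - (LBINT x. w x)\<bar>
    \<le> (DIM('a) * 2 * \<Lambda> * distortion\<^sup>2) * \<bar>t\<bar> * (LBINT x. \<bar>w x\<bar>)"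
proof -
  define p n where "p x = max (w x) 0" and "n x = max (- w x) 0" for x
  have int: "integrable lborel p" "integrable lborel n" unfolding p_def n_def using w by auto
  have int': "integrable lborel (\<lambda>x. p (\<Psi> t x))" "integrable lborel (\<lambda>x. n (\<Psi> t x))"
    using integral_flow_le(1)[OF t] int by auto
  have pn: "w x = p x - n x" "\<bar>w x\<bar> = p x + n x" for x by (auto simp: p_def n_def)
  have 1: "\<bar>(LBINT x. p (\<Psi> t x)) - (LBINT x. p x)\<bar> \<le> (DIM('a) * 2 * \<Lambda> * distortion\<^sup>2) * \<bar>t\<bar> * (LBINT x. p x)"
    by (rule integral_flow_diff_nonneg[OF t int(1)]) (simp add: p_def)
  have 2: "\<bar>(LBINT x. n (\<Psi> t x)) - (LBINT x. n x)\<bar> \<le> (DIM('a) * 2 * \<Lambda> * distortion\<^sup>2) * \<bar>t\<bar> * (LBINT x. n x)"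
    by (rule integral_flow_diff_nonneg[OF t int(2)]) (simp add: n_def)
  show ?thesis
    unfolding pn(2) unfolding pn(1) Bochner_Integration.integral_diff[OF int]
      Bochner_Integration.integral_diff[OF int'] Bochner_Integration.integral_add[OF int]
    using 1 2 by (simp add: distrib_left)
qed

text \<open>A discrete integration by parts: (F o \<Psi> - F) u = (F o \<Psi>)(u - u o \<Psi>) + ((F
  u) o \<Psi> - F u). The first term is small because \<open>u\<close> is Lipschitz and points move
  at most by M |t|, the second because the flow nearly preserves volume. Only the L^1 norm of
  \<open>F\<close> enters, so one \<open>C\<close> serves all \<open>F\<close>.\<close>

lemma flow_pairing_bound:
  fixes F u :: "'a \<Rightarrow> real"
  assumes u: "L-lipschitz_on UNIV u" "\<And>x. \<bar>u x\<bar> \<le> B"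
  obtains C where "C \<ge> 0" "\<And>F t. integrable lborel F \<Longrightarrow> t \<in> {-\<tau>..\<tau>} \<Longrightarrow>
    \<bar>LBINT x. (F (\<Psi> t x) - F x) * u x\<bar> \<le> C * \<bar>t\<bar> * (LBINT x. \<bar>F x\<bar>)"
proof
  define D where "D = DIM('a) * 2 * \<Lambda> * distortion\<^sup>2"
  define C where "C = L * M * distortion + D * B"
  have L: "L \<ge> 0" using u(1) by (rule lipschitz_on_nonneg)
  have B: "B \<ge> 0" using u(2)[of undefined] by linarith
  have D: "D \<ge> 0" using \<Lambda> by (simp add: D_def)
  show "C \<ge> 0" using L M D B distortion_ge_1 by (auto simp: C_def)
  have um: "u \<in> borel_measurable borel"
    by (intro borel_measurable_continuous_onI lipschitz_on_continuous_on[OF u(1)])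
  fix F :: "'a \<Rightarrow> real" and t assume F: "integrable lborel F" and t: "t \<in> {-\<tau>..\<tau>}"
  note Ft = integral_flow_le(1)[OF t F]
  have um': "(\<lambda>x. u x - u (\<Psi> t x)) \<in> borel_measurable borel" using um by measurable
  have ub: "\<bar>u x - u (\<Psi> t x)\<bar> \<le> L * M * \<bar>t\<bar>" for x
  proof -
    have "\<bar>u x - u (\<Psi> t x)\<bar> \<le> L * norm (\<Psi> t x - x)"
      using lipschitz_onD[OF u(1), of x "\<Psi> t x"] by (simp add: dist_norm norm_minus_commute)
    also have "\<dots> \<le> L * (M * \<bar>t\<bar>)" using speed[OF t] L by (intro mult_left_mono) auto
    finally show ?thesis by simp
  qed
  note FU = integrable_mult_bounded[OF F um u(2)]
  note I1 = integrable_mult_bounded[OF Ft um' ub]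
  note I2 = integral_flow_le(1)[OF t FU(1)]
  have "(LBINT x. (F (\<Psi> t x) - F x) * u x) =
    (LBINT x. F (\<Psi> t x) * (u x - u (\<Psi> t x)) + (F (\<Psi> t x) * u (\<Psi> t x)) - F x * u x)"
    by (rule Bochner_Integration.integral_cong) (auto simp: algebra_simps)
  also have "\<dots> = (LBINT x. F (\<Psi> t x) * (u x - u (\<Psi> t x))) +
      ((LBINT x. F (\<Psi> t x) * u (\<Psi> t x)) - (LBINT x. F x * u x))"
    using I1(1) I2 FU(1) by simp
  finally have "\<bar>LBINT x. (F (\<Psi> t x) - F x) * u x\<bar> \<le>
      \<bar>LBINT x. F (\<Psi> t x) * (u x - u (\<Psi> t x))\<bar> +
      \<bar>(LBINT x. F (\<Psi> t x) * u (\<Psi> t x)) - (LBINT x. F x * u x)\<bar>" by linarith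
  also have "\<bar>LBINT x. F (\<Psi> t x) * (u x - u (\<Psi> t x))\<bar> \<le> L * M * \<bar>t\<bar> * (distortion * (LBINT x. \<bar>F x\<bar>))"
  proof -
    have "\<bar>LBINT x. F (\<Psi> t x) * (u x - u (\<Psi> t x))\<bar> \<le> (LBINT x. \<bar>F (\<Psi> t x) * (u x - u (\<Psi> t x))\<bar>)"
      by (rule integral_abs_bound)
    also have "\<dots> \<le> L * M * \<bar>t\<bar> * (LBINT x. \<bar>F (\<Psi> t x)\<bar>)" by (rule I1(2))
    also have "\<dots> \<le> L * M * \<bar>t\<bar> * (distortion * (LBINT x. \<bar>F x\<bar>))"
      using integral_abs_flow_le[OF t F] L M by (intro mult_left_mono) auto
    finally show ?thesis .
  qed
  also have "\<bar>(LBINT x. F (\<Psi> t x) * u (\<Psi> t x)) - (LBINT x. F x * u x)\<bar> \<le> D * \<bar>t\<bar> * (B * (LBINT x. \<bar>F x\<bar>))"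
  proof -
    have "\<bar>(LBINT x. F (\<Psi> t x) * u (\<Psi> t x)) - (LBINT x. F x * u x)\<bar> \<le> D * \<bar>t\<bar> * (LBINT x. \<bar>F x * u x\<bar>)"
      using integral_flow_diff[OF t FU(1)] by (simp add: D_def)
    also have "\<dots> \<le> D * \<bar>t\<bar> * (B * (LBINT x. \<bar>F x\<bar>))"
      using FU(2) D by (intro mult_left_mono) auto
    finally show ?thesis .
  qed
  finally show "\<bar>LBINT x. (F (\<Psi> t x) - F x) * u x\<bar> \<le> C * \<bar>t\<bar> * (LBINT x. \<bar>F x\<bar>)"
    by (simp add: C_def algebra_simps)
qed

end

section \<open>Polynomial approximation in L^1\<close>

lemma integrable_indicator_mult_continuous:
  fixes p :: "'a::euclidean_space \<Rightarrow> real"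
  assumes "compact S" "continuous_on S p"
  shows "integrable lborel (\<lambda>x. indicator S x * p x)"
  using borel_integrable_compact[OF assms]
  by simp

text \<open>Three errors of \<epsilon>/3: truncating \<open>F\<close>, replacing the truncation by a
  truncated continuous function, and the Weierstrass approximation of the latter on
  \<open>S\<close>. The error is measured on \<open>S\<close> because nonzero polynomials are not
  integrable on the whole space.\<close>

lemma L1_polynomial_approximation:
  fixes F :: "'a::euclidean_space \<Rightarrow> real"
  assumes F: "integrable lborel F" and S: "compact S" and \<epsilon>: "\<epsilon> > 0"
  obtains p where "real_polynomial_function p" "(LBINT x. indicator S x * \<bar>F x - p x\<bar>) < \<epsilon>"
proof -
  have [measurable]: "F \<in> borel_measurable borel" using F by auto
  have [measurable]: "S \<in> sets borel" using S by (simp add: compact_imp_closed)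
  have Sfin: "emeasure lborel S < \<infinity>" using S by (rule emeasure_compact_finite)
  then have indS: "integrable lborel (\<lambda>x. indicator S x * c)" for c :: real
    by (intro integrable_mult_left integrable_real_indicator) auto
  define cl where "cl k y = max (- real k) (min (real k) y)" for k y
  have clb: "\<bar>cl k y\<bar> \<le> real k" for k y by (auto simp: cl_def)
  have clc: "continuous_on UNIV (cl k)" for k unfolding cl_def by (intro continuous_intros)
  have [measurable]: "cl k \<in> borel_measurable borel" for k by (rule borel_measurable_continuous_onI[OF clc])
  have "(\<lambda>k. LBINT x. indicator S x * \<bar>F x - cl k (F x)\<bar>) \<longlonglongrightarrow> (\<integral>x. 0 \<partial>(lborel :: 'a measure))"
  proof (rule integral_dominated_convergence)
    show "integrable lborel (\<lambda>x. \<bar>F x\<bar>)" using F by auto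
    show "AE x in lborel. (\<lambda>k. indicator S x * \<bar>F x - cl k (F x)\<bar>) \<longlonglongrightarrow> 0"
    proof (rule AE_I2, rule tendsto_eventually)
      fix x
      show "eventually (\<lambda>k. indicator S x * \<bar>F x - cl k (F x)\<bar> = 0) sequentially"
        using eventually_ge_at_top[of "nat \<lceil>\<bar>F x\<bar>\<rceil>"]
      proof eventually_elim
        case (elim k)
        then have "\<bar>F x\<bar> \<le> real k" by linarith
        then show ?case by (auto simp: cl_def)
      qed
    qed
    show "AE x in lborel. norm (indicator S x * \<bar>F x - cl k (F x)\<bar>) \<le> \<bar>F x\<bar>" for k
      by (intro AE_I2) (auto simp: indicator_def cl_def)
  qed auto
  then have "eventually (\<lambda>k. (LBINT x. indicator S x * \<bar>F x - cl k (F x)\<bar>) < \<epsilon> / 3) sequentially"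
    using \<epsilon> by (intro order_tendstoD) auto
  then obtain k where k: "(LBINT x. indicator S x * \<bar>F x - cl k (F x)\<bar>) < \<epsilon> / 3"
    by (auto simp: eventually_sequentially)
  \<comment> \<open>A measurable function is an almost everywhere limit of continuous functions;
    composing them with \<open>cl k\<close> provides the bound for dominated convergence on
    \<open>S\<close>.\<close>
  have "F measurable_on UNIV"
    by (rule lebesgue_measurable_imp_measurable_on) (auto intro: borel_imp_lebesgue_measurable)
  then obtain N g where N: "negligible N" "\<And>n. continuous_on UNIV (g n)" "\<And>x. x \<notin> N \<Longrightarrow> (\<lambda>n. g n x) \<longlonglongrightarrow> F x"
    unfolding measurable_on_def by auto
  have [measurable]: "g n \<in> borel_measurable borel" for n by (rule borel_measurable_continuous_onI[OF N(2)])
  have AEg: "AE x in lborel. (\<lambda>n. g n x) \<longlonglongrightarrow> F x"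
  proof -
    have "AE x in lebesgue. x \<notin> N" using N(1) by (intro AE_not_in) (simp add: negligible_iff_null_sets)
    then show ?thesis unfolding AE_completion_iff using N(3) by (auto elim: eventually_mono)
  qed
  have "(\<lambda>n. LBINT x. indicator S x * \<bar>cl k (F x) - cl k (g n x)\<bar>) \<longlonglongrightarrow> (\<integral>x. 0 \<partial>(lborel :: 'a measure))"
  proof (rule integral_dominated_convergence)
    show "integrable lborel (\<lambda>x. indicator S x * (2 * real k))" by (rule indS)
    show "AE x in lborel. (\<lambda>n. indicator S x * \<bar>cl k (F x) - cl k (g n x)\<bar>) \<longlonglongrightarrow> 0"
      using AEg
    proof eventually_elim
      case (elim x)
      have "(\<lambda>n. cl k (g n x)) \<longlonglongrightarrow> cl k (F x)"
        using elim clc[of k] by (auto simp: continuous_on_eq_continuous_at intro: isCont_tendsto_compose)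
      then have "(\<lambda>n. indicator S x * \<bar>cl k (F x) - cl k (g n x)\<bar>) \<longlonglongrightarrow> indicator S x * \<bar>cl k (F x) - cl k (F x)\<bar>"
        by (intro tendsto_intros)
      then show ?case by simp
    qed
    show "AE x in lborel. norm (indicator S x * \<bar>cl k (F x) - cl k (g n x)\<bar>) \<le> indicator S x * (2 * real k)" for n
      using clb[of k "F _"] clb[of k "g n _"] by (intro AE_I2) (auto simp: indicator_def abs_le_iff, smt+)
  qed auto
  then have "eventually (\<lambda>n. (LBINT x. indicator S x * \<bar>cl k (F x) - cl k (g n x)\<bar>) < \<epsilon> / 3) sequentially"
    using \<epsilon> by (intro order_tendstoD) auto
  then obtain n where n: "(LBINT x. indicator S x * \<bar>cl k (F x) - cl k (g n x)\<bar>) < \<epsilon> / 3"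
    by (auto simp: eventually_sequentially)
  define G where "G x = cl k (g n x)" for x
  have Gc: "continuous_on UNIV G" unfolding G_def by (rule continuous_on_compose2[OF clc N(2)]) auto
  have [measurable]: "G \<in> borel_measurable borel" by (rule borel_measurable_continuous_onI[OF Gc])
  define \<eta> where "\<eta> = \<epsilon> / (3 * (measure lborel S + 1))"
  have \<eta>: "\<eta> > 0" using \<epsilon> by (auto simp: \<eta>_def intro!: divide_pos_pos add_nonneg_pos)
  obtain p where p: "real_polynomial_function p" "\<And>x. x \<in> S \<Longrightarrow> \<bar>G x - p x\<bar> < \<eta>"
    using Stone_Weierstrass_real_polynomial_function[OF S continuous_on_subset[OF Gc] \<eta>] by auto
  have pc: "continuous_on UNIV p"
    using p(1) by (intro continuous_on_polymonial_function) (simp add: real_polynomial_function_eq)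
  have [measurable]: "p \<in> borel_measurable borel" by (rule borel_measurable_continuous_onI[OF pc])
  have i1: "integrable lborel (\<lambda>x. indicator S x * \<bar>F x - cl k (F x)\<bar>)"
    by (rule Bochner_Integration.integrable_bound[OF F]) (auto simp: indicator_def cl_def)
  have i2: "integrable lborel (\<lambda>x. indicator S x * \<bar>cl k (F x) - G x\<bar>)"
  proof (rule Bochner_Integration.integrable_bound[OF indS[of "2 * real k"]])
    show "AE x in lborel. norm (indicator S x * \<bar>cl k (F x) - G x\<bar>) \<le> norm (indicator S x * (2 * real k))"
    proof (rule AE_I2)
      fix x show "norm (indicator S x * \<bar>cl k (F x) - G x\<bar>) \<le> norm (indicator S x * (2 * real k))"
        using clb[of k "F x"] clb[of k "g n x"] by (auto simp: indicator_def G_def)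
    qed
  qed auto
  have i3: "integrable lborel (\<lambda>x. indicator S x * \<bar>G x - p x\<bar>)"
    by (rule Bochner_Integration.integrable_bound[OF indS[of "\<eta>"]])
      (use p(2) in \<open>auto simp: indicator_def less_imp_le abs_of_pos[OF \<eta>]\<close>)
  have "(LBINT x. indicator S x * \<bar>G x - p x\<bar>) \<le> (LBINT x. indicator S x * \<eta>)"
    using p(2) by (intro integral_mono i3 indS) (auto simp: indicator_def less_imp_le)
  also have "\<dots> = measure lborel S * \<eta>" using Sfin by simp
  also have "\<dots> < \<epsilon> / 3"
  proof -
    have "measure lborel S * \<eta> < (measure lborel S + 1) * \<eta>" using \<eta> by simp
    also have "\<dots> = \<epsilon> / 3" by (simp add: \<eta>_def field_simps add_nonneg_eq_0_iff)
    finally show ?thesis .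
  qed
  finally have i3': "(LBINT x. indicator S x * \<bar>G x - p x\<bar>) < \<epsilon> / 3" .
  have int: "integrable lborel (\<lambda>x. indicator S x * \<bar>F x - cl k (F x)\<bar> + indicator S x * \<bar>cl k (F x) - G x\<bar> + indicator S x * \<bar>G x - p x\<bar>)"
    using i1 i2 i3 by auto
  have le: "indicator S x * \<bar>F x - p x\<bar> \<le> indicator S x * \<bar>F x - cl k (F x)\<bar> + indicator S x * \<bar>cl k (F x) - G x\<bar> + indicator S x * \<bar>G x - p x\<bar>" for x
    by (auto simp: indicator_def)
  have "(LBINT x. indicator S x * \<bar>F x - p x\<bar>) \<le>
    (LBINT x. indicator S x * \<bar>F x - cl k (F x)\<bar> + indicator S x * \<bar>cl k (F x) - G x\<bar> + indicator S x * \<bar>G x - p x\<bar>)"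
  proof (intro integral_mono int le)
    show "integrable lborel (\<lambda>x. indicator S x * \<bar>F x - p x\<bar>)"
    proof (rule Bochner_Integration.integrable_bound[OF int])
      show "AE x in lborel. norm (indicator S x * \<bar>F x - p x\<bar>) \<le> norm (indicator S x * \<bar>F x - cl k (F x)\<bar> + indicator S x * \<bar>cl k (F x) - G x\<bar> + indicator S x * \<bar>G x - p x\<bar>)"
        by (intro AE_I2) (auto simp: indicator_def)
    qed measurable
  qed
  also have "\<dots> < \<epsilon>" using i1 i2 i3 k n i3' unfolding G_def[symmetric] by simp
  finally show thesis using that p(1) by blast
qed

text \<open>Induction over the structure of polynomials; in the product case boundedness of
  \<open>S\<close> bounds both factors.\<close>

lemma real_polynomial_function_lipschitz_on_bounded:
  fixes p :: "'a::euclidean_space \<Rightarrow> real"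
  assumes "real_polynomial_function p" "bounded S"
  shows "\<exists>L. L-lipschitz_on S p"
  using assms(1)
proof induction
  case (linear f)
  then obtain K where "\<And>x. norm (f x) \<le> norm x * K" "K \<ge> 0" using bounded_linear.nonneg_bounded by blast
  then have "K-lipschitz_on S f"
    by (intro lipschitz_onI) (auto simp: dist_norm mult.commute bounded_linear.linear linear_diff[OF bounded_linear.linear[OF linear], symmetric])
  then show ?case ..
next
  case (mult f g)
  then obtain A B where AB: "A-lipschitz_on S f" "B-lipschitz_on S g" by blast
  have bd: "\<exists>R. \<forall>x\<in>S. \<bar>h x\<bar> \<le> R" if "real_polynomial_function h" for h
  proof -
    have "continuous_on (closure S) h"
      using that by (intro continuous_on_polymonial_function) (simp add: real_polynomial_function_eq)
    then have "bounded (h ` closure S)"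
      using assms(2) by (intro compact_imp_bounded compact_continuous_image) (auto simp: compact_closure)
    then obtain R where "\<And>x. x \<in> closure S \<Longrightarrow> \<bar>h x\<bar> \<le> R"
      unfolding bounded_iff real_norm_def by (metis image_eqI)
    then show ?thesis using closure_subset[of S] by blast
  qed
  obtain R1 R2 where R: "\<And>x. x \<in> S \<Longrightarrow> \<bar>f x\<bar> \<le> R1" "\<And>x. x \<in> S \<Longrightarrow> \<bar>g x\<bar> \<le> R2"
    using bd[OF mult.hyps(1)] bd[OF mult.hyps(2)] by blast
  have A0: "A \<ge> 0" "B \<ge> 0" using AB lipschitz_on_nonneg by auto
  have "(\<bar>R1\<bar> * B + \<bar>R2\<bar> * A)-lipschitz_on S (\<lambda>x. f x * g x)"
  proof (rule lipschitz_onI)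
    fix x y assume xy: "x \<in> S" "y \<in> S"
    have "f x * g x - f y * g y = f x * (g x - g y) + g y * (f x - f y)" by (simp add: algebra_simps)
    then have "\<bar>f x * g x - f y * g y\<bar> \<le> \<bar>f x\<bar> * \<bar>g x - g y\<bar> + \<bar>g y\<bar> * \<bar>f x - f y\<bar>"
      by (metis abs_mult abs_triangle_ineq)
    also have "\<dots> \<le> \<bar>R1\<bar> * (B * dist x y) + \<bar>R2\<bar> * (A * dist x y)"
      using R(1)[OF xy(1)] R(2)[OF xy(2)] lipschitz_onD[OF AB(1) xy] lipschitz_onD[OF AB(2) xy]
      by (intro add_mono mult_mono) (auto simp: dist_real_def)
    finally show "dist (f x * g x) (f y * g y) \<le> (\<bar>R1\<bar> * B + \<bar>R2\<bar> * A) * dist x y"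
      by (simp add: dist_real_def algebra_simps)
  qed (use A0 in auto)
  then show ?case ..
qed (auto intro: lipschitz_on_constant lipschitz_on_add)

section \<open>Limit of the quotients paired with a test function\<close>

locale lipschitz_flow = short_time_flow Y \<Psi> \<tau> \<Lambda> M
  for Y :: "real^'n \<Rightarrow> real^'n" and \<Psi> \<tau> \<Lambda> M +
  fixes C :: real
  assumes Y_lipschitz: "C-lipschitz_on UNIV Y" and Y_bounded: "\<And>x. norm (Y x) \<le> M"

locale flow_test_function = lipschitz_flow Y \<Psi> \<tau> \<Lambda> M C
  for Y :: "real^'n \<Rightarrow> real^'n" and \<Psi> \<tau> \<Lambda> M C +
  fixes u :: "real^'n \<Rightarrow> real" and K :: "(real^'n) set" and L B R :: real
  assumes u_lipschitz: "L-lipschitz_on UNIV u" and u_differentiable: "\<And>x. u differentiable (at x)"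
    and u_bounded: "\<And>x. \<bar>u x\<bar> \<le> B" and u_support: "\<And>x. x \<notin> K \<Longrightarrow> u x = 0"
    and K_compact: "compact K" and K_ball: "K \<subseteq> cball 0 R"
begin

text \<open>Almost everywhere the divergence of the field uY. As a single function, bounded almost
  everywhere and zero off \<open>K\<close>, it lets the limit functional be estimated by the L^1
  norm of \<open>F\<close>.\<close>

definition div_uY :: "real^'n \<Rightarrow> real" where
  "div_uY x = lie_deriv Y u x + u x * divergence Y x"

lemma L_nonneg: "L \<ge> 0"
  using u_lipschitz by (rule lipschitz_on_nonneg)

lemma B_nonneg: "B \<ge> 0"
  using u_bounded[of undefined] by linarith

lemma u_measurable [measurable]: "u \<in> borel_measurable borel"
  by (intro borel_measurable_continuous_onI lipschitz_on_continuous_on[OF u_lipschitz])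

lemma lie_deriv_measurable: "lie_deriv Y u \<in> borel_measurable lebesgue"
proof -
  have "continuous_on UNIV (\<lambda>x. Y x $ i)" for i
    by (rule lipschitz_on_continuous_on[OF lipschitz_on_component[OF Y_lipschitz]])
  then have "(\<lambda>x. Y x $ i) \<in> borel_measurable lebesgue" for i
    by (intro borel_imp_lebesgue_measurable borel_measurable_continuous_onI)
  then show ?thesis
    unfolding lie_deriv_def[abs_def] using partial_deriv_measurable[OF u_lipschitz]
    by (intro borel_measurable_sum borel_measurable_times) auto
qed

lemma lie_deriv_support: "x \<notin> K \<Longrightarrow> lie_deriv Y u x = 0"
  by (rule lie_deriv_has_derivative[OF has_derivative_0_outside_support[OF compact_imp_closed[OF K_compact] u_support]])

lemma lie_deriv_bounded: "\<bar>lie_deriv Y u x\<bar> \<le> CARD('n) * (M * L)"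
  by (intro abs_lie_deriv_le u_lipschitz u_differentiable Y_bounded)

lemma udiv_AE_bounded: "AE x in lebesgue. \<bar>u x * divergence Y x\<bar> \<le> B * (CARD('n) * C)"
  using divergence_lebesgue(2)[OF Y_lipschitz]
  by eventually_elim (auto simp: abs_mult intro!: mult_mono u_bounded B_nonneg)

lemma udiv_measurable: "(\<lambda>x. u x * divergence Y x) \<in> borel_measurable lebesgue"
  using divergence_lebesgue(1)[OF Y_lipschitz] borel_imp_lebesgue_measurable[OF u_measurable] by auto

lemma div_uY_measurable: "div_uY \<in> borel_measurable lebesgue"
  unfolding div_uY_def[abs_def] using lie_deriv_measurable udiv_measurable by auto

lemma div_uY_support: "x \<notin> K \<Longrightarrow> div_uY x = 0"
  by (simp add: div_uY_def u_support lie_deriv_support)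

definition div_uY_bound :: real where "div_uY_bound = CARD('n) * (M * L) + B * (CARD('n) * C)"

lemma div_uY_AE_bounded: "AE x in lebesgue. \<bar>div_uY x\<bar> \<le> div_uY_bound"
  using udiv_AE_bounded
proof eventually_elim
  case (elim x)
  then show ?case using lie_deriv_bounded[of x] unfolding div_uY_def div_uY_bound_def by linarith
qed

lemma div_uY_bound_nonneg: "0 \<le> div_uY_bound"
  using M L_nonneg B_nonneg lipschitz_on_nonneg[OF Y_lipschitz] by (simp add: div_uY_bound_def)

lemma flow_stays:
  assumes "x \<in> K" "t \<in> {0..\<tau>}"
  shows "\<Psi> t x \<in> cball 0 (R + M * \<tau>)" "x \<in> cball 0 (R + M * \<tau>)"
  using flow_in_ball[of x R t] assms K_ball by auto

text \<open>Chain rule along the integral curve. Time 0 is interior to the time interval, so the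
  derivative within the interval is a full derivative there.\<close>

lemma flow_quotient_tendsto:
  fixes p :: "real^'n \<Rightarrow> real"
  assumes D: "(p has_derivative D) (at x)"
    and t: "\<And>n. 0 < t n" "\<And>n. t n \<le> \<tau>" "t \<longlonglongrightarrow> 0"
  shows "(\<lambda>n. (p (\<Psi> (t n) x) - p x) / t n) \<longlonglongrightarrow> lie_deriv Y p x"
proof -
  have "((\<lambda>s. \<Psi> s x) has_vector_derivative Y (\<Psi> 0 x)) (at 0 within {-\<tau>..\<tau>})"
    using \<tau> by (intro derivative) auto
  moreover have "at 0 within {-\<tau>..\<tau>} = at 0" using \<tau> by (intro at_within_interior) auto
  ultimately have "((\<lambda>s. \<Psi> s x) has_derivative (\<lambda>h. h *\<^sub>R Y x)) (at 0)"
    by (simp add: has_vector_derivative_def start)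
  moreover have "(p has_derivative D) (at (\<Psi> 0 x))" using D by (simp add: start)
  ultimately have "((\<lambda>s. p (\<Psi> s x)) has_derivative (\<lambda>h. D (h *\<^sub>R Y x))) (at 0)"
    by (rule has_derivative_compose)
  moreover have "(\<lambda>h. D (h *\<^sub>R Y x)) = (*) (D (Y x))"
    using linear_scale[OF has_derivative_linear[OF D]] by (auto simp: mult.commute)
  ultimately have "((\<lambda>s. p (\<Psi> s x)) has_real_derivative lie_deriv Y p x) (at 0)"
    by (simp add: has_field_derivative_def lie_deriv_has_derivative[OF D])
  then have "((\<lambda>h. (p (\<Psi> h x) - p x) / h) \<longlongrightarrow> lie_deriv Y p x) (at 0)"
    by (simp add: DERIV_def start)
  moreover have "filterlim t (at 0) sequentially"
    using t(1,3) by (auto simp: filterlim_at less_imp_neq[symmetric])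
  ultimately show ?thesis by (rule filterlim_compose)
qed

text \<open>A polynomial is Lipschitz on the ball containing the orbits that start in
  \<open>K\<close>, so the integrands are dominated by A M |u| and converge pointwise to (Y p) u.
  Integration by parts is applied to the product p u, and the product rule for Y(p u) then isolates
  the term with Y p.\<close>

lemma polynomial_flow_limit:
  assumes p: "real_polynomial_function p"
    and t: "\<And>n. 0 < t n" "\<And>n. t n \<le> \<tau>" "t \<longlonglongrightarrow> 0"
  shows "(\<lambda>n. LBINT x. (p (\<Psi> (t n) x) - p x) / t n * u x) \<longlonglongrightarrow> - (\<integral>x. p x * div_uY x \<partial>lebesgue)"
proof -
  define S where "S = cball (0::real^'n) (R + M * \<tau>)"
  have pd: "\<exists>D. (p has_derivative D) (at x)" for x
    using p differentiable_at_polynomial_function[of p x UNIV]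
    by (simp add: real_polynomial_function_eq differentiable_def)
  have pc: "continuous_on UNIV p"
    using p by (intro continuous_on_polymonial_function) (simp add: real_polynomial_function_eq)
  have [measurable]: "p \<in> borel_measurable borel" by (rule borel_measurable_continuous_onI[OF pc])
  obtain A where A: "A-lipschitz_on S p"
    using real_polynomial_function_lipschitz_on_bounded[OF p, of S] by (auto simp: S_def)
  have A0: "A \<ge> 0" using A by (rule lipschitz_on_nonneg)
  obtain b where b: "\<And>x. x \<in> S \<Longrightarrow> \<bar>p x\<bar> \<le> b" "b \<ge> 0"
  proof -
    have "bounded (p ` S)"
      by (intro compact_imp_bounded compact_continuous_image continuous_on_subset[OF pc]) (auto simp: S_def)
    then obtain b where "\<And>x. x \<in> S \<Longrightarrow> norm (p x) \<le> b" unfolding bounded_iff by (metis image_eqI)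
    then show thesis using that[of "max b 0"] by (auto simp: le_max_iff_disj)
  qed
  have KS: "x \<in> S" if "x \<in> K" for x using flow_stays(2)[OF that, of 0] \<tau> by (simp add: S_def)
  have Kb: "bounded K" using K_compact by (rule compact_imp_bounded)
  have pw: "(\<lambda>n. (p (\<Psi> (t n) x) - p x) / t n * u x) \<longlonglongrightarrow> lie_deriv Y p x * u x" for x
  proof -
    obtain D where D: "(p has_derivative D) (at x)" using pd by blast
    show ?thesis by (intro tendsto_mult tendsto_const flow_quotient_tendsto[OF D t])
  qed
  have lim: "(\<lambda>n. LBINT x. (p (\<Psi> (t n) x) - p x) / t n * u x) \<longlonglongrightarrow> (LBINT x. lie_deriv Y p x * u x)"
  proof (rule integral_dominated_convergence)
    show "AE x in lborel. (\<lambda>n. (p (\<Psi> (t n) x) - p x) / t n * u x) \<longlonglongrightarrow> lie_deriv Y p x * u x" using pw by simp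
    show m: "(\<lambda>x. (p (\<Psi> (t n) x) - p x) / t n * u x) \<in> borel_measurable lborel" for n by measurable
    show "(\<lambda>x. lie_deriv Y p x * u x) \<in> borel_measurable lborel"
      by (rule borel_measurable_LIMSEQ_real[OF _ m]) (rule pw)
    have "integrable lebesgue (\<lambda>x. A * M * \<bar>u x\<bar>)"
      by (rule integrable_bounded_support[where K = K and B = "A * M * B"])
        (use u_support Kb A0 M u_bounded in \<open>auto simp: abs_mult intro!: borel_imp_lebesgue_measurable mult_left_mono\<close>)
    then show "integrable lborel (\<lambda>x. A * M * \<bar>u x\<bar>)" by (subst (asm) integrable_completion) auto
    show "AE x in lborel. norm ((p (\<Psi> (t n) x) - p x) / t n * u x) \<le> A * M * \<bar>u x\<bar>" for n
    proof (rule AE_I2)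
      fix x
      show "norm ((p (\<Psi> (t n) x) - p x) / t n * u x) \<le> A * M * \<bar>u x\<bar>"
      proof (cases "x \<in> K")
        case True
        have tn: "t n \<in> {0..\<tau>}" "t n \<in> {-\<tau>..\<tau>}" using t(1,2)[of n] by auto
        have "\<bar>p (\<Psi> (t n) x) - p x\<bar> \<le> A * norm (\<Psi> (t n) x - x)"
          using lipschitz_onD[OF A, of "\<Psi> (t n) x" x] flow_stays[OF True tn(1)] by (simp add: S_def dist_norm)
        also have "\<dots> \<le> A * (M * t n)" using speed[OF tn(2), of x] A0 t(1)[of n] by (intro mult_left_mono) auto
        finally have "\<bar>(p (\<Psi> (t n) x) - p x) / t n\<bar> \<le> A * M" using t(1)[of n] by (simp add: field_simps)
        then show ?thesis unfolding real_norm_def abs_mult by (intro mult_right_mono) auto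
      qed (simp add: u_support)
    qed
  qed
  have um: "u \<in> borel_measurable lebesgue" by (rule borel_imp_lebesgue_measurable) measurable
  have pm: "p \<in> borel_measurable lebesgue" by (rule borel_imp_lebesgue_measurable) measurable
  have lpm: "(\<lambda>x. lie_deriv Y p x * u x) \<in> borel_measurable borel"
  proof -
    have "(\<lambda>x. (p (\<Psi> (t n) x) - p x) / t n * u x) \<in> borel_measurable borel" for n by measurable
    then show ?thesis by (rule borel_measurable_LIMSEQ_real[OF pw])
  qed
  define v where "v x = p x * u x" for x
  \<comment> \<open>The polynomial is Lipschitz on \<open>S\<close> only, but its product with
    \<open>u\<close> vanishes off \<open>K\<close> and is therefore Lipschitz on the whole
    space.\<close>
  have half: "\<bar>v x - v y\<bar> \<le> (b * L + B * A) * dist x y" if x: "x \<in> S" for x y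
  proof (cases "y \<in> S")
    case True
    have "v x - v y = p x * (u x - u y) + u y * (p x - p y)" by (simp add: v_def algebra_simps)
    then have "\<bar>v x - v y\<bar> \<le> \<bar>p x\<bar> * \<bar>u x - u y\<bar> + \<bar>u y\<bar> * \<bar>p x - p y\<bar>"
      by (metis abs_mult abs_triangle_ineq)
    also have "\<dots> \<le> b * (L * dist x y) + B * (A * dist x y)"
      using b(1)[OF x] b(2) u_bounded[of y] B_nonneg lipschitz_onD[OF A x True] lipschitz_onD[OF u_lipschitz, of x y]
      by (intro add_mono mult_mono) (auto simp: dist_real_def)
    finally show ?thesis by (simp add: algebra_simps)
  next
    case False
    then have "u y = 0" using u_support KS by blast
    then have "\<bar>v x - v y\<bar> = \<bar>p x\<bar> * \<bar>u x - u y\<bar>" by (simp add: v_def abs_mult)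
    also have "\<dots> \<le> b * (L * dist x y)"
      using b(1)[OF x] b(2) lipschitz_onD[OF u_lipschitz, of x y] by (intro mult_mono) (auto simp: dist_real_def)
    also have "\<dots> \<le> (b * L + B * A) * dist x y" using B_nonneg A0 by (simp add: algebra_simps)
    finally show ?thesis .
  qed
  have vl: "(b * L + B * A)-lipschitz_on UNIV v"
  proof (rule lipschitz_onI)
    fix x y
    show "dist (v x) (v y) \<le> (b * L + B * A) * dist x y"
    proof (cases "x \<in> S \<or> y \<in> S")
      case True
      then show ?thesis using half[of x y] half[of y x] by (auto simp: dist_real_def dist_commute abs_minus_commute)
    next
      case False
      then have "v x = 0" "v y = 0" using KS u_support by (auto simp: v_def)
      then show ?thesis using b B_nonneg L_nonneg A0 by simp
    qed
  qed (use b B_nonneg L_nonneg A0 in auto)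
  have vd: "v differentiable (at x)" for x
    unfolding v_def using pd[of x] u_differentiable[of x] by (intro differentiable_mult) (auto simp: differentiable_def)
  have lie_v: "lie_deriv Y v x = p x * lie_deriv Y u x + lie_deriv Y p x * u x" for x
  proof -
    obtain Dp Du where D: "(p has_derivative Dp) (at x)" "(u has_derivative Du) (at x)"
      using pd[of x] u_differentiable[of x] by (auto simp: differentiable_def)
    have "(v has_derivative (\<lambda>h. p x * Du h + Dp h * u x)) (at x)"
      unfolding v_def by (rule has_derivative_mult[OF D])
    from lie_deriv_has_derivative[OF this] show ?thesis
      by (simp add: lie_deriv_has_derivative[OF D(1)] lie_deriv_has_derivative[OF D(2)])
  qed
  have i1: "integrable lebesgue (\<lambda>x. p x * lie_deriv Y u x)"
  proof (rule integrable_bounded_support[where K = K and B = "b * (CARD('n) * (M * L))"])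
    show "AE x in lebesgue. \<bar>p x * lie_deriv Y u x\<bar> \<le> b * (CARD('n) * (M * L))"
    proof (rule AE_I2)
      fix x show "\<bar>p x * lie_deriv Y u x\<bar> \<le> b * (CARD('n) * (M * L))"
      proof (cases "x \<in> K")
        case True
        then show ?thesis unfolding abs_mult using b lie_deriv_bounded[of x] KS by (intro mult_mono) auto
      qed (use b(2) M L_nonneg in \<open>simp add: lie_deriv_support\<close>)
    qed
  qed (use pm lie_deriv_measurable Kb lie_deriv_support in auto)
  have i2: "integrable lebesgue (\<lambda>x. p x * (u x * divergence Y x))"
  proof (rule integrable_bounded_support[where K = K and B = "b * (B * (CARD('n) * C))"])
    show "AE x in lebesgue. \<bar>p x * (u x * divergence Y x)\<bar> \<le> b * (B * (CARD('n) * C))"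
      using udiv_AE_bounded
    proof eventually_elim
      case (elim x)
      show ?case
      proof (cases "x \<in> K")
        case True
        then show ?thesis unfolding abs_mult[of "p x"] using b elim KS by (intro mult_mono) auto
      qed (use b(2) B_nonneg lipschitz_on_nonneg[OF Y_lipschitz] in \<open>simp add: u_support\<close>)
    qed
  qed (use pm udiv_measurable Kb u_support in auto)
  \<comment> \<open>The gradient of \<open>p\<close> has no global bound; the estimate comes from
    writing (Y p) u as Y(p u) - p (Y u).\<close>
  have i3: "integrable lebesgue (\<lambda>x. lie_deriv Y p x * u x)"
  proof (rule integrable_bounded_support[where K = K and B = "CARD('n) * (M * (b * L + B * A)) + b * (CARD('n) * (M * L))"])
    show "AE x in lebesgue. \<bar>lie_deriv Y p x * u x\<bar> \<le> CARD('n) * (M * (b * L + B * A)) + b * (CARD('n) * (M * L))"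
    proof (rule AE_I2)
      fix x
      have "\<bar>lie_deriv Y v x\<bar> \<le> CARD('n) * (M * (b * L + B * A))"
        by (intro abs_lie_deriv_le vl vd Y_bounded)
      moreover have "\<bar>p x * lie_deriv Y u x\<bar> \<le> b * (CARD('n) * (M * L))"
      proof (cases "x \<in> K")
        case True
        then show ?thesis unfolding abs_mult using b lie_deriv_bounded[of x] KS by (intro mult_mono) auto
      qed (use b(2) M L_nonneg in \<open>simp add: lie_deriv_support\<close>)
      ultimately show "\<bar>lie_deriv Y p x * u x\<bar> \<le> CARD('n) * (M * (b * L + B * A)) + b * (CARD('n) * (M * L))"
        using lie_v[of x] by linarith
    qed
  qed (use borel_imp_lebesgue_measurable[OF lpm] Kb u_support in auto)
  have "(\<integral>x. lie_deriv Y v x \<partial>lebesgue) = - (\<integral>x. v x * divergence Y x \<partial>lebesgue)"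
    by (rule integration_by_parts_divergence[OF Y_lipschitz Y_bounded vl vd _ Kb]) (simp add: v_def u_support)
  then have "(\<integral>x. p x * lie_deriv Y u x \<partial>lebesgue) + (\<integral>x. lie_deriv Y p x * u x \<partial>lebesgue) = - (\<integral>x. p x * (u x * divergence Y x) \<partial>lebesgue)"
    unfolding lie_v using i1 i3 by (simp add: v_def mult.assoc)
  moreover have "(\<integral>x. p x * div_uY x \<partial>lebesgue) = (\<integral>x. p x * lie_deriv Y u x \<partial>lebesgue) + (\<integral>x. p x * (u x * divergence Y x) \<partial>lebesgue)"
    unfolding div_uY_def distrib_left using i1 i2 by simp
  ultimately have "(\<integral>x. lie_deriv Y p x * u x \<partial>lebesgue) = - (\<integral>x. p x * div_uY x \<partial>lebesgue)" by linarith
  moreover have "(\<integral>x. lie_deriv Y p x * u x \<partial>lebesgue) = (LBINT x. lie_deriv Y p x * u x)"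
    using lpm by (intro integral_completion) auto
  ultimately show ?thesis using lim by simp
qed

text \<open>\<open>F\<close> is replaced by a polynomial up to an L^1 error below
  \<open>\<eta>\<close> on a ball. By the pairing bound the error changes the quotients at most by
  \<open>c * \<eta>\<close>, uniformly in time, and the limit at most by
  \<open>div_uY_bound * \<eta>\<close>.\<close>

lemma flow_limit:
  assumes F: "integrable lborel F"
    and t: "\<And>n. 0 < t n" "\<And>n. t n \<le> \<tau>" "t \<longlonglongrightarrow> 0"
  shows "(\<lambda>n. LBINT x. (F (\<Psi> (t n) x) - F x) / t n * u x) \<longlonglongrightarrow> - (\<integral>x. F x * div_uY x \<partial>lebesgue)"
proof (rule LIMSEQ_I)
  fix \<epsilon> :: real assume "\<epsilon> > 0"
  define S where "S = cball (0::real^'n) (R + M * \<tau>)"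
  have S: "compact S" by (simp add: S_def)
  have [measurable]: "S \<in> sets borel" by (simp add: S_def)
  obtain c where c: "c \<ge> 0" "\<And>F t. integrable lborel F \<Longrightarrow> t \<in> {-\<tau>..\<tau>} \<Longrightarrow>
    \<bar>LBINT x. (F (\<Psi> t x) - F x) * u x\<bar> \<le> c * \<bar>t\<bar> * (LBINT x. \<bar>F x\<bar>)"
    using flow_pairing_bound[OF u_lipschitz u_bounded] by blast
  \<comment> \<open>Both error terms together stay below \<epsilon>/2, leaving \<epsilon>/2 for the
    polynomial limit.\<close>
  define \<eta> where "\<eta> = \<epsilon> / (2 * (c + div_uY_bound + 1))"
  have den: "c + div_uY_bound + 1 > 0" using c(1) div_uY_bound_nonneg by linarith
  have \<eta>: "\<eta> > 0" "(c + div_uY_bound) * \<eta> < \<epsilon> / 2"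
  proof -
    show "\<eta> > 0" using \<open>\<epsilon> > 0\<close> den by (simp add: \<eta>_def)
    then have "(c + div_uY_bound) * \<eta> < (c + div_uY_bound + 1) * \<eta>" by simp
    also have "\<dots> = \<epsilon> / 2" using den by (simp add: \<eta>_def field_simps)
    finally show "(c + div_uY_bound) * \<eta> < \<epsilon> / 2" .
  qed
  obtain p where p: "real_polynomial_function p" "(LBINT x. indicator S x * \<bar>F x - p x\<bar>) < \<eta>"
    using L1_polynomial_approximation[OF F S \<eta>(1)] by blast
  have pc: "continuous_on UNIV p"
    using p(1) by (intro continuous_on_polymonial_function) (simp add: real_polynomial_function_eq)
  have [measurable]: "p \<in> borel_measurable borel" by (rule borel_measurable_continuous_onI[OF pc])
  have [measurable]: "F \<in> borel_measurable borel" using F by auto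
  \<comment> \<open>Points of \<open>K\<close> stay in \<open>S\<close> under the flow and
    \<open>u\<close> vanishes off \<open>K\<close>, so the error may be set to 0 outside
    \<open>S\<close>, which makes it integrable.\<close>
  define E where "E x = indicator S x * (F x - p x)" for x
  have pS: "integrable lborel (\<lambda>x. indicator S x * p x)"
    by (rule integrable_indicator_mult_continuous[OF S continuous_on_subset[OF pc]]) simp
  have E: "integrable lborel E"
  proof -
    have "integrable lborel (\<lambda>x. indicator S x * F x)"
      by (rule Bochner_Integration.integrable_bound[OF F]) (auto simp: indicator_def)
    then show ?thesis using pS unfolding E_def[abs_def] right_diff_distrib by (rule Bochner_Integration.integrable_diff)
  qed
  have Eabs: "(LBINT x. \<bar>E x\<bar>) < \<eta>" using p(2) by (simp add: E_def abs_mult)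
  have Wl: "integrable lebesgue (\<lambda>x. E x * div_uY x)" "\<bar>\<integral>x. E x * div_uY x \<partial>lebesgue\<bar> \<le> div_uY_bound * (\<integral>x. \<bar>E x\<bar> \<partial>lebesgue)"
    using integrable_mult_lebesgue_bounded[OF _ div_uY_measurable div_uY_AE_bounded div_uY_bound_nonneg, of E] E
    by (auto simp: integrable_completion)
  have Flebe: "integrable lebesgue (\<lambda>x. F x * div_uY x)"
    using integrable_mult_lebesgue_bounded(1)[OF _ div_uY_measurable div_uY_AE_bounded div_uY_bound_nonneg, of F] F
    by (auto simp: integrable_completion)
  have "(\<integral>x. \<bar>E x\<bar> \<partial>lebesgue) = (LBINT x. \<bar>E x\<bar>)" using E by (intro integral_completion) auto
  then have EW: "\<bar>\<integral>x. E x * div_uY x \<partial>lebesgue\<bar> \<le> div_uY_bound * \<eta>"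
    using Wl(2) Eabs div_uY_bound_nonneg by (smt (verit) mult_left_mono)
  have pW: "(\<integral>x. p x * div_uY x \<partial>lebesgue) = (\<integral>x. F x * div_uY x \<partial>lebesgue) - (\<integral>x. E x * div_uY x \<partial>lebesgue)"
  proof -
    have "p x * div_uY x = F x * div_uY x - E x * div_uY x" for x
      using flow_stays(2)[of x 0] \<tau> div_uY_support[of x] by (cases "x \<in> K") (auto simp: E_def S_def algebra_simps)
    then show ?thesis using Flebe Wl(1) by simp
  qed
  have split: "(LBINT x. (F (\<Psi> (t n) x) - F x) / t n * u x) =
      (LBINT x. (p (\<Psi> (t n) x) - p x) / t n * u x) + (LBINT x. (E (\<Psi> (t n) x) - E x) * u x) / t n" for n
  proof -
    have tn: "t n \<in> {0..\<tau>}" "t n \<in> {-\<tau>..\<tau>}" using t(1,2)[of n] by auto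
    have i: "integrable lborel (\<lambda>x. (G (\<Psi> (t n) x) - G x) * u x)" if "integrable lborel G" for G
      by (intro integrable_mult_bounded(1)[OF _ u_measurable u_bounded] Bochner_Integration.integrable_diff
          integral_flow_le(1)[OF tn(2)] that)
    have "(LBINT x. (p (\<Psi> (t n) x) - p x) / t n * u x) =
      (LBINT x. ((F (\<Psi> (t n) x) - F x) * u x) / t n - ((E (\<Psi> (t n) x) - E x) * u x) / t n)"
    proof (rule Bochner_Integration.integral_cong)
      fix x
      show "(p (\<Psi> (t n) x) - p x) / t n * u x = ((F (\<Psi> (t n) x) - F x) * u x) / t n - ((E (\<Psi> (t n) x) - E x) * u x) / t n"
        using flow_stays[of x "t n"] tn(1) u_support[of x] t(1)[of n]
        by (cases "x \<in> K") (auto simp: E_def S_def field_simps)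
    qed simp
    also have "\<dots> = (LBINT x. ((F (\<Psi> (t n) x) - F x) * u x) / t n) - (LBINT x. ((E (\<Psi> (t n) x) - E x) * u x) / t n)"
      using i[OF F] i[OF E] by (intro Bochner_Integration.integral_diff) auto
    finally show ?thesis by simp
  qed
  have Eb: "\<bar>(LBINT x. (E (\<Psi> (t n) x) - E x) * u x) / t n\<bar> \<le> c * \<eta>" for n
  proof -
    have tn: "t n \<in> {-\<tau>..\<tau>}" using t(1,2)[of n] by auto
    have "\<bar>LBINT x. (E (\<Psi> (t n) x) - E x) * u x\<bar> \<le> c * \<bar>t n\<bar> * (LBINT x. \<bar>E x\<bar>)" by (rule c(2)[OF E tn])
    also have "\<dots> \<le> c * \<bar>t n\<bar> * \<eta>" using Eabs c(1) by (intro mult_left_mono) auto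
    finally show ?thesis using t(1)[of n] by (simp add: field_simps)
  qed
  obtain n0 where n0: "\<And>n. n \<ge> n0 \<Longrightarrow> \<bar>(LBINT x. (p (\<Psi> (t n) x) - p x) / t n * u x) - - (\<integral>x. p x * div_uY x \<partial>lebesgue)\<bar> < \<epsilon> / 2"
    using LIMSEQ_D[OF polynomial_flow_limit[OF p(1) t], of "\<epsilon> / 2"] \<open>\<epsilon> > 0\<close> by auto
  show "\<exists>n0. \<forall>n\<ge>n0. norm ((LBINT x. (F (\<Psi> (t n) x) - F x) / t n * u x) - - (\<integral>x. F x * div_uY x \<partial>lebesgue)) < \<epsilon>"
  proof (intro exI allI impI)
    fix n assume "n0 \<le> n"
    have "(c + div_uY_bound) * \<eta> = c * \<eta> + div_uY_bound * \<eta>" by (simp add: distrib_right)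
    then show "norm ((LBINT x. (F (\<Psi> (t n) x) - F x) / t n * u x) - - (\<integral>x. F x * div_uY x \<partial>lebesgue)) < \<epsilon>"
      using n0[OF \<open>n0 \<le> n\<close>] Eb[of n] EW \<eta>(2) unfolding split[of n] pW real_norm_def by linarith
  qed
qed

end

section \<open>Excess of the quotients over the upper gradient\<close>

context short_time_flow
begin

text \<open>Polynomial approximation again: the L^1 error is transported with factor
  \<open>distortion\<close>, and the polynomial itself changes at most by A M t on the ball.\<close>

lemma flow_L1_continuous:
  fixes F :: "'a \<Rightarrow> real"
  assumes F: "integrable lborel F" and K: "K \<in> sets borel" "K \<subseteq> cball 0 R" and \<epsilon>: "\<epsilon> > 0"
  obtains \<sigma> where "0 < \<sigma>" "\<sigma> \<le> \<tau>"
    "\<And>t. t \<in> {0..\<sigma>} \<Longrightarrow> (\<integral>\<^sup>+x. indicator K x * ennreal \<bar>F (\<Psi> t x) - F x\<bar> \<partial>lborel) \<le> ennreal \<epsilon>"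
proof -
  define S where "S = cball (0::'a) (R + M * \<tau>)"
  have S: "compact S" by (simp add: S_def)
  have [measurable]: "S \<in> sets borel" "K \<in> sets borel" "F \<in> borel_measurable borel" using K F by (auto simp: S_def)
  define \<eta> where "\<eta> = \<epsilon> / (2 * (distortion + 1))"
  have den: "distortion + 1 > 0" using distortion_ge_1 by linarith
  have \<eta>: "\<eta> > 0" "(distortion + 1) * \<eta> = \<epsilon> / 2" using \<epsilon> den by (auto simp: \<eta>_def field_simps)
  obtain p where p: "real_polynomial_function p" "(LBINT x. indicator S x * \<bar>F x - p x\<bar>) < \<eta>"
    using L1_polynomial_approximation[OF F S \<eta>(1)] by blast
  have pc: "continuous_on UNIV p"
    using p(1) by (intro continuous_on_polymonial_function) (simp add: real_polynomial_function_eq)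
  have [measurable]: "p \<in> borel_measurable borel" by (rule borel_measurable_continuous_onI[OF pc])
  obtain A where A: "A-lipschitz_on S p"
    using real_polynomial_function_lipschitz_on_bounded[OF p(1), of S] by (auto simp: S_def)
  have A0: "A \<ge> 0" using A by (rule lipschitz_on_nonneg)
  define E where "E x = indicator S x * (F x - p x)" for x
  have pS: "integrable lborel (\<lambda>x. indicator S x * p x)"
    by (rule integrable_indicator_mult_continuous[OF S continuous_on_subset[OF pc]]) simp
  have E: "integrable lborel E"
  proof -
    have "integrable lborel (\<lambda>x. indicator S x * F x)"
      by (rule Bochner_Integration.integrable_bound[OF F]) (auto simp: indicator_def)
    then show ?thesis using pS unfolding E_def[abs_def] right_diff_distrib by (rule Bochner_Integration.integrable_diff)
  qed
  have Eabs: "(LBINT x. \<bar>E x\<bar>) < \<eta>" using p(2) by (simp add: E_def abs_mult)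
  define b where "b = measure lborel (cball (0::'a) R)"
  have bfin: "emeasure lborel (cball (0::'a) R) = ennreal b"
    unfolding b_def using emeasure_compact_finite[OF compact_cball, of "0::'a" R]
    by (intro emeasure_eq_ennreal_measure) (metis infinity_ennreal_def less_irrefl)
  \<comment> \<open>The change A M t of the polynomial, integrated over a ball of volume
    \<open>b\<close>, stays at most \<epsilon>/2; the summand 1 keeps the denominator
    positive.\<close>
  define \<sigma> where "\<sigma> = min \<tau> (\<epsilon> / (2 * (A * M * b + 1)))"
  have AMb: "A * M * b \<ge> 0" using A0 M by (simp add: b_def)
  have \<sigma>: "0 < \<sigma>" "\<sigma> \<le> \<tau>" using \<tau> \<epsilon> AMb by (auto simp: \<sigma>_def intro!: divide_pos_pos add_nonneg_pos)
  have "A * M * b * \<sigma> \<le> A * M * b * (\<epsilon> / (2 * (A * M * b + 1)))" using AMb by (intro mult_left_mono) (auto simp: \<sigma>_def)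
  also have "\<dots> \<le> \<epsilon> / 2" using AMb \<epsilon> by (simp add: field_simps)
  finally have small: "A * M * b * \<sigma> \<le> \<epsilon> / 2" .
  show thesis
  proof (rule that[OF \<sigma>])
    fix t assume t: "t \<in> {0..\<sigma>}"
    then have t1: "t \<in> {0..\<tau>}" and t2: "t \<in> {-\<tau>..\<tau>}" using \<sigma> by auto
    have pw: "indicator K x * ennreal \<bar>F (\<Psi> t x) - F x\<bar> \<le>
        ennreal \<bar>E (\<Psi> t x)\<bar> + ennreal \<bar>E x\<bar> + ennreal (A * M * t) * indicator (cball 0 R) x" for x
    proof (cases "x \<in> K")
      case True
      then have xR: "norm x \<le> R" using K by auto
      note st = flow_in_ball[OF xR t1, folded S_def]
      have "\<bar>p (\<Psi> t x) - p x\<bar> \<le> A * norm (\<Psi> t x - x)"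
        using lipschitz_onD[OF A st] by (simp add: dist_norm)
      also have "\<dots> \<le> A * (M * t)" using speed[OF t2, of x] A0 t by (intro mult_left_mono) auto
      finally have "\<bar>F (\<Psi> t x) - F x\<bar> \<le> \<bar>E (\<Psi> t x)\<bar> + \<bar>E x\<bar> + A * M * t"
        using st by (simp add: E_def)
      then have "ennreal \<bar>F (\<Psi> t x) - F x\<bar> \<le> ennreal (\<bar>E (\<Psi> t x)\<bar> + \<bar>E x\<bar> + A * M * t)" by (rule ennreal_leI)
      also have "\<dots> = ennreal \<bar>E (\<Psi> t x)\<bar> + ennreal \<bar>E x\<bar> + ennreal (A * M * t)"
        using A0 M t by (simp add: ennreal_plus)
      finally show ?thesis using True xR by simp
    qed simp
    have "(\<integral>\<^sup>+x. indicator K x * ennreal \<bar>F (\<Psi> t x) - F x\<bar> \<partial>lborel) \<le>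
      (\<integral>\<^sup>+x. ennreal \<bar>E (\<Psi> t x)\<bar> + ennreal \<bar>E x\<bar> + ennreal (A * M * t) * indicator (cball 0 R) x \<partial>lborel)"
      by (intro nn_integral_mono pw)
    also have "\<dots> = (\<integral>\<^sup>+x. ennreal \<bar>E (\<Psi> t x)\<bar> \<partial>lborel) + (\<integral>\<^sup>+x. ennreal \<bar>E x\<bar> \<partial>lborel) + ennreal (A * M * t) * ennreal b"
    proof -
      have [measurable]: "E \<in> borel_measurable borel" using E by auto
      have m1: "(\<lambda>x. ennreal \<bar>E (\<Psi> t x)\<bar>) \<in> borel_measurable lborel"
        and m2: "(\<lambda>x. ennreal \<bar>E x\<bar>) \<in> borel_measurable lborel"
        by measurable
      have m3: "(\<lambda>x. ennreal (A * M * t) * indicator (cball 0 R) x) \<in> borel_measurable lborel"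
        by (intro borel_measurable_times_ennreal borel_measurable_indicator borel_measurable_const) auto
      show ?thesis
        unfolding nn_integral_add[OF borel_measurable_add[OF m1 m2] m3] nn_integral_add[OF m1 m2]
        by (simp add: nn_integral_cmult_indicator bfin)
    qed
    also have "(\<integral>\<^sup>+x. ennreal \<bar>E (\<Psi> t x)\<bar> \<partial>lborel) = ennreal (LBINT x. \<bar>E (\<Psi> t x)\<bar>)"
      using integral_flow_le(1)[OF t2 E] by (intro nn_integral_eq_integral) auto
    also have "(\<integral>\<^sup>+x. ennreal \<bar>E x\<bar> \<partial>lborel) = ennreal (LBINT x. \<bar>E x\<bar>)"
      using E by (intro nn_integral_eq_integral) auto
    also have "ennreal (LBINT x. \<bar>E (\<Psi> t x)\<bar>) + ennreal (LBINT x. \<bar>E x\<bar>) + ennreal (A * M * t) * ennreal b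
      = ennreal ((LBINT x. \<bar>E (\<Psi> t x)\<bar>) + (LBINT x. \<bar>E x\<bar>) + A * M * t * b)"
      using A0 M t by (simp add: ennreal_plus ennreal_mult b_def)
    also have "\<dots> \<le> ennreal \<epsilon>"
    proof (rule ennreal_leI)
      have "(LBINT x. \<bar>E (\<Psi> t x)\<bar>) \<le> distortion * (LBINT x. \<bar>E x\<bar>)" by (rule integral_abs_flow_le[OF t2 E])
      also have "\<dots> \<le> distortion * \<eta>" using Eabs distortion_ge_1 by (intro mult_left_mono) auto
      finally have 1: "(LBINT x. \<bar>E (\<Psi> t x)\<bar>) + (LBINT x. \<bar>E x\<bar>) \<le> \<epsilon> / 2"
        using Eabs \<eta>(2) by (simp add: distrib_right)
      have "A * M * t * b = (A * M * b) * t" by simp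
      also have "\<dots> \<le> (A * M * b) * \<sigma>" using t AMb by (intro mult_left_mono) auto
      finally show "(LBINT x. \<bar>E (\<Psi> t x)\<bar>) + (LBINT x. \<bar>E x\<bar>) + A * M * t * b \<le> \<epsilon>"
        using 1 small by linarith
    qed
    finally show "(\<integral>\<^sup>+x. indicator K x * ennreal \<bar>F (\<Psi> t x) - F x\<bar> \<partial>lborel) \<le> ennreal \<epsilon>" .
  qed
qed

lemma flow_pair_measurable [measurable]: "(\<lambda>(s, x). \<Psi> s x) \<in> borel_measurable (borel \<Otimes>\<^sub>M borel)"
  using borel_measurable_continuous_onI[OF continuous] by (simp add: borel_prod)

text \<open>Subtracting t H(x) from the time integral leaves at most the integral of |H(\<Psi> s x)
  - H(x)|. After division by \<open>t\<close>, exchanging the integrals bounds the excess by a time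
  average of L^1 distances, each at most \<epsilon>. Since \<open>ennreal\<close> sends negative
  numbers to 0, the integrand of the conclusion is a positive part.\<close>

lemma flow_excess:
  fixes F H :: "'a \<Rightarrow> real"
  assumes F: "F \<in> borel_measurable borel" and H: "integrable lborel H" "\<And>x. 0 \<le> H x"
    and K: "K \<in> sets borel" "K \<subseteq> cball 0 R" and \<epsilon>: "\<epsilon> > 0"
  obtains \<sigma> where "0 < \<sigma>" "\<sigma> \<le> \<tau>"
    "\<And>t. 0 < t \<Longrightarrow> t \<le> \<sigma> \<Longrightarrow>
      (AE x in lborel. x \<in> K \<longrightarrow> ennreal \<bar>F (\<Psi> t x) - F x\<bar> \<le> (\<integral>\<^sup>+s\<in>{0..t}. ennreal (H (\<Psi> s x)) \<partial>lborel)) \<Longrightarrow>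
      (\<integral>\<^sup>+x. indicator K x * ennreal (\<bar>F (\<Psi> t x) - F x\<bar> / t - H x) \<partial>lborel) \<le> ennreal \<epsilon>"
proof -
  obtain \<sigma> where \<sigma>: "0 < \<sigma>" "\<sigma> \<le> \<tau>"
    "\<And>t. t \<in> {0..\<sigma>} \<Longrightarrow> (\<integral>\<^sup>+x. indicator K x * ennreal \<bar>H (\<Psi> t x) - H x\<bar> \<partial>lborel) \<le> ennreal \<epsilon>"
    using flow_L1_continuous[OF H(1) K \<epsilon>] by blast
  show thesis
  proof (rule that[OF \<sigma>(1,2)])
    fix t assume t: "0 < t" "t \<le> \<sigma>"
      and ae: "AE x in lborel. x \<in> K \<longrightarrow> ennreal \<bar>F (\<Psi> t x) - F x\<bar> \<le> (\<integral>\<^sup>+s\<in>{0..t}. ennreal (H (\<Psi> s x)) \<partial>lborel)"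
    have [measurable]: "H \<in> borel_measurable borel" "K \<in> sets borel" "F \<in> borel_measurable borel" using H K F by auto
    have [measurable]: "(\<lambda>s. \<Psi> s x) \<in> borel_measurable borel" for x
      using measurable_compose[OF measurable_Pair2' flow_pair_measurable, of x] by simp
    define G where "G x s = indicator K x * (indicator {0..t} s * ennreal \<bar>H (\<Psi> s x) - H x\<bar>)" for x s
    have [measurable]: "(\<lambda>(x, s). \<Psi> s x) \<in> borel_measurable (borel \<Otimes>\<^sub>M borel)"
      using measurable_compose[OF measurable_pair_swap' flow_pair_measurable] by (simp add: split_def)
    have Gm: "case_prod G \<in> borel_measurable (borel \<Otimes>\<^sub>M borel)"
    proof -
      have "(\<lambda>z. indicator K (fst z) * (indicator {0..t} (snd z) * ennreal \<bar>H ((\<lambda>(x, s). \<Psi> s x) z) - H (fst z)\<bar>)) \<in> borel_measurable (borel \<Otimes>\<^sub>M borel)"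
        by measurable
      then show ?thesis by (simp add: G_def split_def)
    qed
    have pw: "indicator K x * ennreal (\<bar>F (\<Psi> t x) - F x\<bar> / t - H x) \<le> ennreal (1 / t) * (\<integral>\<^sup>+s. G x s \<partial>lborel)"
      if "x \<in> K \<longrightarrow> ennreal \<bar>F (\<Psi> t x) - F x\<bar> \<le> (\<integral>\<^sup>+s\<in>{0..t}. ennreal (H (\<Psi> s x)) \<partial>lborel)" for x
    proof (cases "x \<in> K")
      case True
      define a where "a = \<bar>F (\<Psi> t x) - F x\<bar>"
      define J where "J = (\<integral>\<^sup>+s. indicator {0..t} s * ennreal \<bar>H (\<Psi> s x) - H x\<bar> \<partial>lborel)"
      have "ennreal a \<le> (\<integral>\<^sup>+s\<in>{0..t}. ennreal (H (\<Psi> s x)) \<partial>lborel)" using that True by (simp add: a_def)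
      also have "\<dots> \<le> (\<integral>\<^sup>+s. ennreal (H x) * indicator {0..t} s + indicator {0..t} s * ennreal \<bar>H (\<Psi> s x) - H x\<bar> \<partial>lborel)"
      proof (intro nn_integral_mono)
        fix s
        have "ennreal (H (\<Psi> s x)) \<le> ennreal (H x + \<bar>H (\<Psi> s x) - H x\<bar>)" by (intro ennreal_leI) linarith
        also have "\<dots> = ennreal (H x) + ennreal \<bar>H (\<Psi> s x) - H x\<bar>" using H(2) by (simp add: ennreal_plus)
        finally show "ennreal (H (\<Psi> s x)) * indicator {0..t} s \<le> ennreal (H x) * indicator {0..t} s + indicator {0..t} s * ennreal \<bar>H (\<Psi> s x) - H x\<bar>"
          by (auto simp: indicator_def)
      qed
      also have "\<dots> = ennreal (H x) * ennreal t + J"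
        unfolding J_def using t by (subst nn_integral_add) (auto simp: nn_integral_cmult_indicator)
      finally have le: "ennreal a \<le> ennreal (H x * t) + J" using t H(2) by (simp add: ennreal_mult)
      \<comment> \<open>The time integral may be infinite for some \<open>x\<close>; the inequality
        is trivial there.\<close>
      have "ennreal (a - H x * t) \<le> J"
      proof (cases J)
        case (real j)
        have "ennreal a \<le> ennreal (H x * t + j)" using le real t H(2) by (simp add: ennreal_plus)
        then have "a \<le> H x * t + j" using real t H(2) by (subst (asm) ennreal_le_iff) auto
        then show ?thesis using real by (simp add: ennreal_leI)
      qed simp
      then have "ennreal (1 / t) * ennreal (a - H x * t) \<le> ennreal (1 / t) * J" by (intro mult_left_mono) auto
      moreover have "ennreal (1 / t) * ennreal (a - H x * t) = ennreal (a / t - H x)"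
        using t by (subst ennreal_mult'[symmetric]) (auto simp: field_simps)
      ultimately show ?thesis using True by (simp add: G_def J_def a_def)
    qed simp
    have "(\<integral>\<^sup>+x. indicator K x * ennreal (\<bar>F (\<Psi> t x) - F x\<bar> / t - H x) \<partial>lborel) \<le> (\<integral>\<^sup>+x. ennreal (1 / t) * (\<integral>\<^sup>+s. G x s \<partial>lborel) \<partial>lborel)"
      using ae by (intro nn_integral_mono_AE) (auto elim!: eventually_mono intro: pw)
    also have "\<dots> = ennreal (1 / t) * (\<integral>\<^sup>+x. (\<integral>\<^sup>+s. G x s \<partial>lborel) \<partial>lborel)"
      using Gm by (intro nn_integral_cmult lborel.borel_measurable_nn_integral) simp
    also have "(\<integral>\<^sup>+x. (\<integral>\<^sup>+s. G x s \<partial>lborel) \<partial>lborel) = (\<integral>\<^sup>+s. (\<integral>\<^sup>+x. G x s \<partial>lborel) \<partial>lborel)"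
      using Gm by (intro lborel_pair.Fubini'[symmetric]) simp
    also have "\<dots> \<le> (\<integral>\<^sup>+s. ennreal \<epsilon> * indicator {0..t} s \<partial>lborel)"
    proof (intro nn_integral_mono)
      fix s
      show "(\<integral>\<^sup>+x. G x s \<partial>lborel) \<le> ennreal \<epsilon> * indicator {0..t} s"
        using \<sigma>(3)[of s] t by (cases "s \<in> {0..t}") (auto simp: G_def)
    qed
    also have "\<dots> = ennreal \<epsilon> * ennreal t" using t by (simp add: nn_integral_cmult_indicator)
    also have "ennreal (1 / t) * (ennreal \<epsilon> * ennreal t) = ennreal \<epsilon>"
      using t \<epsilon> by (simp add: ennreal_mult[symmetric])
    finally show "(\<integral>\<^sup>+x. indicator K x * ennreal (\<bar>F (\<Psi> t x) - F x\<bar> / t - H x) \<partial>lborel) \<le> ennreal \<epsilon>"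
      by (simp add: mult_left_mono)
  qed
qed

end

section \<open>Transfer to the given field and functions\<close>

lemma test_function_lipschitz:
  fixes u :: "real^'n \<Rightarrow> real"
  assumes "test_function \<Omega> u"
  obtains L B where "L-lipschitz_on UNIV u" "\<And>x. u differentiable (at x)" "\<And>x. \<bar>u x\<bar> \<le> B"
proof -
  define K where "K = closure {x. u x \<noteq> 0}"
  have K: "compact K" using assms by (simp add: test_function_def K_def)
  have u0: "u x = 0" if "x \<notin> K" for x using that closure_subset[of "{x. u x \<noteq> 0}"] by (auto simp: K_def)
  have Ck: "C_k k u" for k using assms by (simp add: test_function_def)
  have d: "u differentiable (at x)" for x using Ck[of "Suc 0"] by simp
  have pd: "continuous_on UNIV (partial_deriv i u)" for i using Ck[of "Suc 0"] by simp
  have cont: "continuous_on UNIV u" using Ck[of 0] by simp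
  have bounded_K: "\<exists>b\<ge>0. \<forall>x\<in>K. \<bar>g x\<bar> \<le> b" if "continuous_on UNIV g" for g :: "real^'n \<Rightarrow> real"
  proof -
    have "bounded (g ` K)"
      using that K by (intro compact_imp_bounded compact_continuous_image continuous_on_subset[OF that]) auto
    then obtain b where "\<And>x. x \<in> K \<Longrightarrow> norm (g x) \<le> b" unfolding bounded_iff by (metis image_eqI)
    then show ?thesis by (intro exI[of _ "max b 0"]) (auto simp: le_max_iff_disj)
  qed
  obtain b where b: "\<And>i. b i \<ge> 0" "\<And>i x. x \<in> K \<Longrightarrow> \<bar>partial_deriv i u x\<bar> \<le> b i"
    using bounded_K[OF pd] by metis
  obtain B where B: "B \<ge> 0" "\<And>x. x \<in> K \<Longrightarrow> \<bar>u x\<bar> \<le> B" using bounded_K[OF cont] by blast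
  have ub: "\<bar>u x\<bar> \<le> B" for x using B u0 by (cases "x \<in> K") auto
  define L where "L = (\<Sum>i\<in>UNIV. b i)"
  have L0: "L \<ge> 0" unfolding L_def using b(1) by (intro sum_nonneg) auto
  have "L-lipschitz_on UNIV u"
  proof (rule bounded_derivative_imp_lipschitz[where f' = "\<lambda>x. frechet_derivative u (at x)"])
    fix x
    have D: "(u has_derivative frechet_derivative u (at x)) (at x)" using d by (simp add: frechet_derivative_works)
    then show "(u has_derivative frechet_derivative u (at x)) (at x within UNIV)" by simp
    have pb: "\<bar>partial_deriv i u x\<bar> \<le> b i" for i
    proof (cases "x \<in> K")
      case False
      have "(u has_derivative (\<lambda>_. 0)) (at x)"
        by (rule has_derivative_0_outside_support[OF compact_imp_closed[OF K] u0 False])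
      then show ?thesis using b(1) by (simp add: partial_deriv_has_derivative(2))
    qed (rule b(2))
    show "onorm (frechet_derivative u (at x)) \<le> L"
    proof (rule onorm_bound[OF L0])
      fix y
      have "frechet_derivative u (at x) y = (\<Sum>i\<in>UNIV. y $ i * partial_deriv i u x)"
        using lie_deriv_has_derivative[OF D, of "\<lambda>_. y"] by (simp add: lie_deriv_def)
      also have "\<bar>\<dots>\<bar> \<le> (\<Sum>i\<in>UNIV. norm y * b i)"
      proof (rule order_trans[OF sum_abs], rule sum_mono)
        fix i show "\<bar>y $ i * partial_deriv i u x\<bar> \<le> norm y * b i"
          unfolding abs_mult using component_le_norm_cart[of y i] pb[of i] by (intro mult_mono) auto
      qed
      finally show "norm (frechet_derivative u (at x) y) \<le> L * norm y"
        by (simp add: L_def sum_distrib_left[symmetric] mult.commute)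
    qed
  qed (use L0 in auto)
  then show thesis using that d ub by blast
qed

text \<open>An exhaustion by compact sets shows that \<open>f\<close> on \<Omega>, extended by 0, is
  Lebesgue measurable, so it has a Borel representative. Composing a Lebesgue measurable function
  with a continuous map can destroy measurability; Borel functions avoid this.\<close>

lemma L1_loc_borel_version:
  fixes f :: "real^'n \<Rightarrow> real"
  assumes \<Omega>: "open \<Omega>" and f: "L1_loc \<Omega> f"
  obtains f' where "f' \<in> borel_measurable borel" "AE x in lborel. x \<in> \<Omega> \<longrightarrow> f x = f' x"
    "\<And>K. compact K \<Longrightarrow> K \<subseteq> \<Omega> \<Longrightarrow> integrable lborel (\<lambda>x. indicator K x * f' x)"
proof -
  obtain C where C: "\<And>n. compact (C n)" "\<And>n. C n \<subseteq> \<Omega>"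
    "\<And>n. C n \<subseteq> interior (C (Suc n))" "\<Union>(range C) = \<Omega>"
    "\<And>K. compact K \<Longrightarrow> K \<subseteq> \<Omega> \<Longrightarrow> \<exists>N. \<forall>n\<ge>N. K \<subseteq> C n"
    by (rule open_Union_compact_subsets[OF \<Omega>]) (rule that)
  have m: "(\<lambda>x. indicator (C n) x * f x) \<in> borel_measurable lebesgue" for n
    using f C(1,2) by (auto simp: L1_loc_def set_integrable_def dest!: borel_measurable_integrable)
  have lim: "(\<lambda>n. indicator (C n) x * f x) \<longlonglongrightarrow> indicator \<Omega> x * f x" for x
  proof (cases "x \<in> \<Omega>")
    case True
    then obtain N where "\<And>n. n \<ge> N \<Longrightarrow> x \<in> C n" using C(5)[of "{x}"] by auto
    then show ?thesis using True
      by (intro tendsto_eventually) (auto simp: eventually_sequentially intro!: exI[of _ N])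
  next
    case False
    then have "x \<notin> C n" for n using C(2) by blast
    then show ?thesis using False by simp
  qed
  have "(\<lambda>x. indicator \<Omega> x * f x) \<in> borel_measurable lebesgue"
    by (rule borel_measurable_LIMSEQ_real[OF lim m])
  then obtain f' where f': "f' \<in> borel_measurable lborel" "AE x in lborel. indicator \<Omega> x * f x = f' x"
    using completion_ex_borel_measurable_real by blast
  have ae: "AE x in lborel. x \<in> \<Omega> \<longrightarrow> f x = f' x" using f'(2) by eventually_elim auto
  show thesis
  proof (rule that[OF _ ae])
    show m: "f' \<in> borel_measurable borel" using f'(1) by simp
    fix K assume K: "compact K" "K \<subseteq> \<Omega>"
    then have [measurable]: "K \<in> sets borel" by (simp add: compact_imp_closed)
    have "integrable lebesgue (\<lambda>x. indicator K x * f x)" using f K by (auto simp: L1_loc_def set_integrable_def)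
    moreover have "AE x in lebesgue. indicator K x * f x = indicator K x * f' x"
      using ae unfolding AE_completion_iff by eventually_elim (use K in \<open>auto simp: indicator_def\<close>)
    moreover have m': "(\<lambda>x. indicator K x * f' x) \<in> borel_measurable borel" using m by measurable
    ultimately have "integrable lebesgue (\<lambda>x. indicator K x * f' x)"
      using borel_imp_lebesgue_measurable[OF m']
      by (subst integrable_cong_AE[symmetric]) (auto dest: borel_measurable_integrable)
    then show "integrable lborel (\<lambda>x. indicator K x * f' x)" using m' by (simp add: integrable_completion)
  qed
qed

lemma partial_deriv_cong_ball:
  fixes f g :: "real^'n \<Rightarrow> real"
  assumes "\<rho> > 0" and "\<And>y. dist x y \<le> \<rho> \<Longrightarrow> f y = g y"
  shows "partial_deriv i f x = partial_deriv i g x"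
  unfolding partial_deriv_def
proof (rule deriv_cong_ev)
  show "eventually (\<lambda>s. f (x + s *\<^sub>R axis i 1) = g (x + s *\<^sub>R axis i 1)) (nhds 0)"
    unfolding eventually_nhds_metric
    using assms by (intro exI[of _ \<rho>]) (auto simp: dist_norm norm_axis_1)
qed simp

text \<open>For each time almost every point is carried off \<open>N\<close>; exchanging the order
  of \<open>s\<close> and \<open>x\<close> gives, for almost every starting point, an orbit that
  meets \<open>N\<close> only at a null set of times. Time integrals along that orbit do not see
  changes on \<open>N\<close>.\<close>

lemma AE_flow_avoids_null_set:
  assumes flow: "short_time_flow Y \<Psi> \<tau> \<Lambda> M" and N: "N \<in> null_sets lborel"
  shows "AE x in lborel. AE s in lborel. s \<in> {-\<tau>..\<tau>} \<longrightarrow> \<Psi> s x \<notin> N"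
proof -
  interpret short_time_flow Y \<Psi> \<tau> \<Lambda> M by (rule flow)
  have [measurable]: "N \<in> sets borel" using N by auto
  have "{z \<in> space (lborel \<Otimes>\<^sub>M lborel). fst z \<in> {-\<tau>..\<tau>} \<longrightarrow> \<Psi> (fst z) (snd z) \<notin> N} \<in> sets (lborel \<Otimes>\<^sub>M lborel)"
  proof -
    have [measurable]: "(\<lambda>z. \<Psi> (fst z) (snd z)) \<in> borel_measurable (lborel \<Otimes>\<^sub>M lborel)"
      using flow_pair_measurable by (simp add: split_def lborel_prod borel_prod)
    show ?thesis by measurable
  qed
  then have "(AE s in lborel. AE x in lborel. s \<in> {-\<tau>..\<tau>} \<longrightarrow> \<Psi> s x \<notin> N) \<longleftrightarrow>
    (AE x in lborel. AE s in lborel. s \<in> {-\<tau>..\<tau>} \<longrightarrow> \<Psi> s x \<notin> N)"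
    by (rule lborel_pair.AE_commute)
  moreover have "AE s in lborel. AE x in lborel. s \<in> {-\<tau>..\<tau>} \<longrightarrow> \<Psi> s x \<notin> N"
  proof (rule AE_I2)
    fix s show "AE x in lborel. s \<in> {-\<tau>..\<tau>} \<longrightarrow> \<Psi> s x \<notin> N"
      using null_set_flow[OF _ N, of s] by (cases "s \<in> {-\<tau>..\<tau>}") auto
  qed
  ultimately show ?thesis by simp
qed

text \<open>The auxiliary field and its flow depend on \<open>K\<close> and disappear from the
  conclusions, which speak of the true flow only; results for different compact sets can therefore
  be combined. The excess estimate concerns almost every time, because the upper gradient inequality
  does.\<close>

lemma local_flow_difference_quotients:
  fixes \<Omega> :: "(real^'n) set" and X :: "real^'n \<Rightarrow> real^'n" and f h f' h' :: "real^'n \<Rightarrow> real"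
  assumes \<Omega>: "open \<Omega>" and X: "locally_lipschitz_field \<Omega> X"
    and f': "f' \<in> borel_measurable borel" "AE x in lborel. x \<in> \<Omega> \<longrightarrow> f x = f' x"
      "\<And>K. compact K \<Longrightarrow> K \<subseteq> \<Omega> \<Longrightarrow> integrable lborel (\<lambda>x. indicator K x * f' x)"
    and h': "h' \<in> borel_measurable borel" "AE x in lborel. x \<in> \<Omega> \<longrightarrow> h x = h' x" "\<And>x. 0 \<le> h' x"
      "\<And>K. compact K \<Longrightarrow> K \<subseteq> \<Omega> \<Longrightarrow> integrable lborel (\<lambda>x. indicator K x * h' x)"
    and ug: "upper_gradient \<Omega> X f h"
    and K: "compact K" "K \<subseteq> \<Omega>"
  obtains \<sigma>\<^sub>0 where "\<sigma>\<^sub>0 > 0"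
    "\<And>t. 0 < t \<Longrightarrow> t < \<sigma>\<^sub>0 \<Longrightarrow> (\<lambda>x. indicator K x * f' (flow \<Omega> X t x)) \<in> borel_measurable borel"
    "\<And>u t. test_function \<Omega> u \<Longrightarrow> (\<And>x. x \<notin> K \<Longrightarrow> u x = 0) \<Longrightarrow> (\<And>n. 0 < t n) \<Longrightarrow> (\<And>n. t n < \<sigma>\<^sub>0) \<Longrightarrow> t \<longlonglongrightarrow> 0 \<Longrightarrow>
      (\<forall>n. integrable lborel (\<lambda>x. (f' (flow \<Omega> X (t n) x) - f' x) / t n * u x)) \<and>
      (\<lambda>n. LBINT x. (f' (flow \<Omega> X (t n) x) - f' x) / t n * u x) \<longlonglongrightarrow>
        - (LINT x:\<Omega>|lebesgue. f x * lie_deriv X u x) - (LINT x:\<Omega>|lebesgue. f x * u x * divergence X x)"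
    "\<And>\<epsilon>. \<epsilon> > 0 \<Longrightarrow> \<exists>\<sigma>>0. AE t in lborel. 0 < t \<and> t < \<sigma> \<longrightarrow>
      (\<integral>\<^sup>+x. indicator K x * ennreal (\<bar>f' (flow \<Omega> X t x) - f' x\<bar> / t - h' x) \<partial>lborel) \<le> ennreal \<epsilon>"
proof -
  obtain Y C M0 \<rho> K' where Y: "C-lipschitz_on UNIV Y" "\<And>x. norm (Y x) \<le> M0" and \<rho>: "\<rho> > 0"
    and K': "compact K'" "K' \<subseteq> \<Omega>" and near: "\<And>x y. x \<in> K \<Longrightarrow> dist x y \<le> \<rho> \<Longrightarrow> y \<in> K' \<and> Y y = X y"
    by (rule locally_lipschitz_field_extension[OF \<Omega> X K]) (rule that)
  obtain \<Psi> \<tau> \<Lambda> where flow: "short_time_flow Y \<Psi> \<tau> \<Lambda> M0"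
    by (rule short_time_flow_exists[OF Y])
  interpret lipschitz_flow Y \<Psi> \<tau> \<Lambda> M0 C
    using flow Y by (simp add: lipschitz_flow_def lipschitz_flow_axioms_def)
  \<comment> \<open>With speed at most \<open>M0\<close>, orbits from \<open>K\<close> stay within
    \<rho> of their start before this time, where \<open>Y\<close> and \<open>X\<close> agree; the
    summand 1 covers M0 = 0.\<close>
  define \<sigma>\<^sub>0 where "\<sigma>\<^sub>0 = min \<tau> (\<rho> / (M0 + 1))"
  have \<sigma>\<^sub>0: "0 < \<sigma>\<^sub>0" "\<sigma>\<^sub>0 \<le> \<tau>" using \<tau> \<rho> M by (auto simp: \<sigma>\<^sub>0_def)
  have M\<sigma>\<^sub>0: "M0 * \<sigma>\<^sub>0 \<le> \<rho>"
  proof -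
    have "M0 * \<sigma>\<^sub>0 \<le> M0 * (\<rho> / (M0 + 1))" using M by (intro mult_left_mono) (auto simp: \<sigma>\<^sub>0_def)
    also have "\<dots> \<le> \<rho>" using M \<rho> by (simp add: field_simps)
    finally show ?thesis .
  qed
  have near\<Omega>: "y \<in> \<Omega> \<and> Y y = X y" if "x \<in> K" "dist x y \<le> \<rho>" for x y
    using near[OF that] K'(2) by blast
  have fl: "t \<in> flow_interval \<Omega> X x" "flow \<Omega> X t x = \<Psi> t x" if "x \<in> K" "\<bar>t\<bar> < \<sigma>\<^sub>0" for x t
    using flow_eq_short_time_flow[OF X flow near\<Omega>[OF that(1)] \<sigma>\<^sub>0 M\<sigma>\<^sub>0 that(2)] by auto
  have inK': "\<Psi> t x \<in> K'" if "x \<in> K" "\<bar>t\<bar> < \<sigma>\<^sub>0" for x t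
  proof -
    have "norm (\<Psi> t x - x) \<le> M0 * \<bar>t\<bar>" using that \<sigma>\<^sub>0 by (intro speed) auto
    also have "\<dots> \<le> M0 * \<sigma>\<^sub>0" using that M by (intro mult_left_mono) auto
    also note M\<sigma>\<^sub>0
    finally show ?thesis using near[OF that(1), of "\<Psi> t x"] by (simp add: dist_norm norm_minus_commute)
  qed
  have KK': "x \<in> K'" if "x \<in> K" for x using inK'[OF that, of 0] \<sigma>\<^sub>0 by (simp add: start)
  have [measurable]: "K \<in> sets borel" "K' \<in> sets borel" "f' \<in> borel_measurable borel" "h' \<in> borel_measurable borel"
    using K(1) K'(1) f'(1) h'(1) by (auto simp: compact_imp_closed)
  \<comment> \<open>\<open>K'\<close> contains all these orbits, so cutting off to it makes the
    functions integrable on the whole space without changing them along the orbits.\<close>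
  define F where "F x = indicator K' x * f' x" for x
  define H where "H x = indicator K' x * h' x" for x
  have F: "integrable lborel F" and H: "integrable lborel H" "\<And>x. 0 \<le> H x"
    using f'(3)[OF K'] h'(4)[OF K'] h'(3) by (auto simp: F_def[abs_def] H_def[abs_def])
  have [measurable]: "F \<in> borel_measurable borel" unfolding F_def[abs_def] by measurable
  have Feq: "f' (flow \<Omega> X t x) = F (\<Psi> t x)" "f' x = F x" "h' x = H x" if "x \<in> K" "\<bar>t\<bar> < \<sigma>\<^sub>0" for x t
    using fl(2)[OF that] inK'[OF that] KK'[OF that(1)] by (auto simp: F_def H_def)
  obtain R where R: "K \<subseteq> cball 0 R" by (rule bounded_subset_cball_0[OF compact_imp_bounded[OF K(1)]])
  show thesis
  proof (rule that[OF \<sigma>\<^sub>0(1)])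
    fix t assume t: "0 < t" "t < \<sigma>\<^sub>0"
    have "(\<lambda>x. indicator K x * f' (flow \<Omega> X t x)) = (\<lambda>x. indicator K x * F (\<Psi> t x))"
      using Feq(1) t by (auto simp: indicator_def)
    also have "\<dots> \<in> borel_measurable borel" by measurable
    finally show "(\<lambda>x. indicator K x * f' (flow \<Omega> X t x)) \<in> borel_measurable borel" .
  next
    fix u :: "real^'n \<Rightarrow> real" and t :: "nat \<Rightarrow> real"
    assume u: "test_function \<Omega> u" and uK: "\<And>x. x \<notin> K \<Longrightarrow> u x = 0"
      and t: "\<And>n. 0 < t n" "\<And>n. t n < \<sigma>\<^sub>0" "t \<longlonglongrightarrow> 0"
    obtain L B where LB: "L-lipschitz_on UNIV u" "\<And>x. u differentiable (at x)" "\<And>x. \<bar>u x\<bar> \<le> B"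
      by (rule test_function_lipschitz[OF u]) (rule that)
    interpret flow_test_function Y \<Psi> \<tau> \<Lambda> M0 C u K L B R
      by unfold_locales (use LB uK K R in auto)
    have t\<tau>: "t n \<le> \<tau>" for n using t(2)[of n] \<sigma>\<^sub>0(2) by linarith
    have quot: "(f' (flow \<Omega> X (t n) x) - f' x) / t n * u x = (F (\<Psi> (t n) x) - F x) / t n * u x" for n x
      using Feq[of x "t n"] t(1,2)[of n] uK[of x] by (cases "x \<in> K") auto
    have "integrable lborel (\<lambda>x. (F (\<Psi> (t n) x) - F x) / t n * u x)" for n
    proof -
      have tn: "t n \<in> {-\<tau>..\<tau>}" using t(1)[of n] t\<tau>[of n] \<tau> by auto
      show ?thesis
        by (intro integrable_mult_bounded(1)[OF _ u_measurable u_bounded] integrable_divide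
          Bochner_Integration.integrable_diff integral_flow_le(1)[OF tn] F)
    qed
    moreover have "(\<lambda>n. LBINT x. (F (\<Psi> (t n) x) - F x) / t n * u x) \<longlonglongrightarrow> - (\<integral>x. F x * div_uY x \<partial>lebesgue)"
      by (rule flow_limit[OF F t(1) t\<tau> t(3)])
    moreover have "- (\<integral>x. F x * div_uY x \<partial>lebesgue) =
      - (LINT x:\<Omega>|lebesgue. f x * lie_deriv X u x) - (LINT x:\<Omega>|lebesgue. f x * u x * divergence X x)"
    proof -
      have Fl: "integrable lebesgue F" using F by (simp add: integrable_completion)
      have i1: "integrable lebesgue (\<lambda>x. F x * lie_deriv Y u x)"
        by (rule integrable_mult_lebesgue_bounded(1)[OF Fl lie_deriv_measurable AE_I2[OF lie_deriv_bounded]])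
          (use M L_nonneg in auto)
      have i2: "integrable lebesgue (\<lambda>x. F x * (u x * divergence Y x))"
        by (rule integrable_mult_lebesgue_bounded(1)[OF Fl udiv_measurable udiv_AE_bounded])
          (use B_nonneg lipschitz_on_nonneg[OF Y_lipschitz] in auto)
      have ff: "AE x in lebesgue. x \<in> \<Omega> \<longrightarrow> f x = f' x" using f'(2) by (simp add: AE_completion_iff)
      have K\<Omega>: "x \<in> \<Omega>" if "x \<in> K" for x using that K(2) by blast
      \<comment> \<open>On \<open>K\<close> the fields agree; off \<open>K\<close>, an open set,
        \<open>u\<close> is locally 0 and both sides vanish.\<close>
      have lie_eq: "lie_deriv X u x = lie_deriv Y u x" for x
      proof (cases "x \<in> K")
        case True
        then show ?thesis using near[OF True, of x] \<rho> by (simp add: lie_deriv_def)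
      next
        case False
        have "(u has_derivative (\<lambda>_. 0)) (at x)"
          by (rule has_derivative_0_outside_support[OF compact_imp_closed[OF K(1)] uK False])
        then show ?thesis by (simp add: lie_deriv_has_derivative)
      qed
      have div_eq: "u x * divergence X x = u x * divergence Y x" for x
      proof (cases "x \<in> K")
        case True
        have "partial_deriv i (\<lambda>y. X y $ i) x = partial_deriv i (\<lambda>y. Y y $ i) x" for i
          by (rule partial_deriv_cong_ball[OF \<rho>]) (use near[OF True] in simp)
        then show ?thesis by (simp add: divergence_def)
      qed (simp add: uK)
      have e1: "AE x in lebesgue. F x * lie_deriv Y u x = indicator \<Omega> x *\<^sub>R (f x * lie_deriv X u x)"
        using ff
      proof eventually_elim
        case (elim x)
        then show ?case
          using K\<Omega>[of x] KK'[of x] lie_deriv_support[of x] by (cases "x \<in> K") (auto simp: F_def lie_eq)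
      qed
      have e2: "AE x in lebesgue. F x * (u x * divergence Y x) = indicator \<Omega> x *\<^sub>R (f x * u x * divergence X x)"
        using ff
      proof eventually_elim
        case (elim x)
        then show ?case
          using K\<Omega>[of x] KK'[of x] uK[of x] div_eq[of x] by (cases "x \<in> K") (auto simp: F_def mult.assoc)
      qed
      have "(\<integral>x. F x * lie_deriv Y u x \<partial>lebesgue) = (LINT x:\<Omega>|lebesgue. f x * lie_deriv X u x)"
        unfolding set_lebesgue_integral_def
        using i1 lebesgue_measurable_if_AE_eq[OF borel_measurable_integrable[OF i1] e1]
        by (intro integral_cong_AE e1) auto
      moreover have "(\<integral>x. F x * (u x * divergence Y x) \<partial>lebesgue) = (LINT x:\<Omega>|lebesgue. f x * u x * divergence X x)"
        unfolding set_lebesgue_integral_def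
        using i2 lebesgue_measurable_if_AE_eq[OF borel_measurable_integrable[OF i2] e2]
        by (intro integral_cong_AE e2) auto
      moreover have "(\<integral>x. F x * div_uY x \<partial>lebesgue) = (\<integral>x. F x * lie_deriv Y u x \<partial>lebesgue) + (\<integral>x. F x * (u x * divergence Y x) \<partial>lebesgue)"
        unfolding div_uY_def distrib_left using i1 i2 by simp
      ultimately show ?thesis by simp
    qed
    ultimately show "(\<forall>n. integrable lborel (\<lambda>x. (f' (flow \<Omega> X (t n) x) - f' x) / t n * u x)) \<and>
      (\<lambda>n. LBINT x. (f' (flow \<Omega> X (t n) x) - f' x) / t n * u x) \<longlonglongrightarrow>
        - (LINT x:\<Omega>|lebesgue. f x * lie_deriv X u x) - (LINT x:\<Omega>|lebesgue. f x * u x * divergence X x)"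
      unfolding quot by simp
  next
    fix \<epsilon> :: real assume \<epsilon>: "\<epsilon> > 0"
    obtain \<sigma> where \<sigma>: "0 < \<sigma>" "\<sigma> \<le> \<tau>"
      "\<And>t. 0 < t \<Longrightarrow> t \<le> \<sigma> \<Longrightarrow>
      (AE x in lborel. x \<in> K \<longrightarrow> ennreal \<bar>F (\<Psi> t x) - F x\<bar> \<le> (\<integral>\<^sup>+s\<in>{0..t}. ennreal (H (\<Psi> s x)) \<partial>lborel)) \<Longrightarrow>
      (\<integral>\<^sup>+x. indicator K x * ennreal (\<bar>F (\<Psi> t x) - F x\<bar> / t - H x) \<partial>lborel) \<le> ennreal \<epsilon>"
      by (rule flow_excess[OF \<open>F \<in> borel_measurable borel\<close> H \<open>K \<in> sets borel\<close> R \<epsilon>]) (rule that)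
    have "AE x in lborel. \<not> (x \<in> \<Omega> \<and> (f x \<noteq> f' x \<or> h x \<noteq> h' x))"
      using f'(2) h'(2) by eventually_elim auto
    \<comment> \<open>One null set collects the points of \<Omega> where a representative differs
      from \<open>f\<close> or \<open>h\<close>; orbits are kept off it at time 0, at time
      \<open>t\<close> and at almost all times in between.\<close>
    then obtain N where N: "N \<in> null_sets lborel" "\<And>x. x \<in> \<Omega> \<Longrightarrow> x \<notin> N \<Longrightarrow> f x = f' x \<and> h x = h' x"
      by (rule AE_E3) auto
    have "AE z in lborel. (\<lambda>(t, x). (t, x) \<in> flow_domain_pos \<Omega> X \<longrightarrow>
        ennreal \<bar>f (flow \<Omega> X t x) - f x\<bar> \<le> (\<integral>\<^sup>+ s\<in>{0..t}. ennreal (h (flow \<Omega> X s x)) \<partial>lebesgue)) z"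
      using ug by (simp add: upper_gradient_def AE_completion_iff)
    \<comment> \<open>The exceptional set in the product is sliced at fixed times: for almost every
      \<open>t\<close> the inequality holds for almost every \<open>x\<close>.\<close>
    then have "AE t in lborel. AE x in lborel. (t, x) \<in> flow_domain_pos \<Omega> X \<longrightarrow>
        ennreal \<bar>f (flow \<Omega> X t x) - f x\<bar> \<le> (\<integral>\<^sup>+ s\<in>{0..t}. ennreal (h (flow \<Omega> X s x)) \<partial>lebesgue)"
      unfolding lborel_prod[symmetric] by (rule lborel_pair.AE_pair[THEN eventually_mono]) simp
    then have good: "AE t in lborel. 0 < t \<and> t < \<sigma>\<^sub>0 \<longrightarrow>
      (AE x in lborel. x \<in> K \<longrightarrow> ennreal \<bar>F (\<Psi> t x) - F x\<bar> \<le> (\<integral>\<^sup>+s\<in>{0..t}. ennreal (H (\<Psi> s x)) \<partial>lborel))"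
    proof eventually_elim
      case (elim t)
      show ?case
      proof
        assume t: "0 < t \<and> t < \<sigma>\<^sub>0"
        then have t': "t \<in> {-\<tau>..\<tau>}" using \<sigma>\<^sub>0 by auto
        have N1: "AE x in lborel. x \<notin> N" using N(1) by (rule AE_not_in)
        show "AE x in lborel. x \<in> K \<longrightarrow> ennreal \<bar>F (\<Psi> t x) - F x\<bar> \<le> (\<integral>\<^sup>+s\<in>{0..t}. ennreal (H (\<Psi> s x)) \<partial>lborel)"
          using elim N1 null_set_flow[OF t' N(1)] AE_flow_avoids_null_set[OF flow N(1)]
        proof eventually_elim
          case (elim x)
          show ?case
          proof
            assume x: "x \<in> K"
            have "(t, x) \<in> flow_domain_pos \<Omega> X"
              using x K(2) fl(1)[OF x, of t] t by (auto simp: flow_domain_pos_def)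
            then have "ennreal \<bar>f (flow \<Omega> X t x) - f x\<bar> \<le> (\<integral>\<^sup>+ s\<in>{0..t}. ennreal (h (flow \<Omega> X s x)) \<partial>lborel)"
              using elim(1) by (simp add: nn_integral_completion)
            moreover have "f (flow \<Omega> X t x) = F (\<Psi> t x)"
              using N(2)[of "\<Psi> t x"] elim(3) fl(2)[OF x, of t] inK'[OF x, of t] K'(2) t by (auto simp: F_def)
            moreover have "f x = F x" using N(2)[of x] elim(2) KK'[OF x] K'(2) by (auto simp: F_def)
            moreover have "(\<integral>\<^sup>+ s\<in>{0..t}. ennreal (h (flow \<Omega> X s x)) \<partial>lborel) = (\<integral>\<^sup>+s\<in>{0..t}. ennreal (H (\<Psi> s x)) \<partial>lborel)"
            proof (rule nn_integral_cong_AE)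
              show "AE s in lborel. ennreal (h (flow \<Omega> X s x)) * indicator {0..t} s = ennreal (H (\<Psi> s x)) * indicator {0..t} s"
                using elim(4)
              proof eventually_elim
                case (elim s)
                show ?case
                proof (cases "s \<in> {0..t}")
                  case True
                  then have s: "\<bar>s\<bar> < \<sigma>\<^sub>0" "s \<in> {-\<tau>..\<tau>}" using t t' by auto
                  then have "h (flow \<Omega> X s x) = H (\<Psi> s x)"
                    using N(2)[of "\<Psi> s x"] elim fl(2)[OF x s(1)] inK'[OF x s(1)] K'(2) by (auto simp: H_def)
                  then show ?thesis by simp
                qed simp
              qed
            qed
            ultimately show "ennreal \<bar>F (\<Psi> t x) - F x\<bar> \<le> (\<integral>\<^sup>+s\<in>{0..t}. ennreal (H (\<Psi> s x)) \<partial>lborel)" by simp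
          qed
        qed
      qed
    qed
    show "\<exists>\<sigma>>0. AE t in lborel. 0 < t \<and> t < \<sigma> \<longrightarrow>
      (\<integral>\<^sup>+x. indicator K x * ennreal (\<bar>f' (flow \<Omega> X t x) - f' x\<bar> / t - h' x) \<partial>lborel) \<le> ennreal \<epsilon>"
    proof (intro exI[of _ "min \<sigma> \<sigma>\<^sub>0"] conjI)
      show "AE t in lborel. 0 < t \<and> t < min \<sigma> \<sigma>\<^sub>0 \<longrightarrow>
        (\<integral>\<^sup>+x. indicator K x * ennreal (\<bar>f' (flow \<Omega> X t x) - f' x\<bar> / t - h' x) \<partial>lborel) \<le> ennreal \<epsilon>"
        using good
      proof eventually_elim
        case (elim t)
        show ?case
        proof
          assume t: "0 < t \<and> t < min \<sigma> \<sigma>\<^sub>0"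
          have "(\<integral>\<^sup>+x. indicator K x * ennreal (\<bar>f' (flow \<Omega> X t x) - f' x\<bar> / t - h' x) \<partial>lborel) =
            (\<integral>\<^sup>+x. indicator K x * ennreal (\<bar>F (\<Psi> t x) - F x\<bar> / t - H x) \<partial>lborel)"
            using Feq[of _ t] t by (intro nn_integral_cong) (auto simp: indicator_def)
          also have "\<dots> \<le> ennreal \<epsilon>" using elim t by (intro \<sigma>(3)) auto
          finally show "(\<integral>\<^sup>+x. indicator K x * ennreal (\<bar>f' (flow \<Omega> X t x) - f' x\<bar> / t - h' x) \<partial>lborel) \<le> ennreal \<epsilon>" .
        qed
      qed
    qed (use \<sigma>(1) \<sigma>\<^sub>0 in simp)
  qed
qed

section \<open>Upper gradients and distributional derivatives\<close>

text \<open>An interval of positive length is not contained in the exceptional null set; this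
  provides good times below any threshold.\<close>

lemma AE_interval_witness:
  fixes \<delta> :: real
  assumes "AE t in lborel. 0 < t \<and> t < \<delta> \<longrightarrow> P t" and "0 < \<delta>"
  obtains t where "0 < t" "t < \<delta>" "P t"
proof (rule ccontr)
  assume "\<not> thesis"
  with that have "\<And>t. 0 < t \<Longrightarrow> t < \<delta> \<Longrightarrow> \<not> P t" by blast
  then have "AE t in lborel. t \<notin> {0<..<\<delta>}" using assms(1) by (auto elim: eventually_mono)
  then have "{0<..<\<delta>} \<in> null_sets lborel" by (subst (asm) AE_iff_null_sets[symmetric]) auto
  then show False using assms(2) by (simp add: null_sets_def)
qed

theorem theorem1p2:
  fixes \<Omega> :: "(real^'n) set"
    and X :: "real^'n \<Rightarrow> real^'n"
    and f h :: "real^'n \<Rightarrow> real"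
  assumes "open \<Omega>"
    and "locally_lipschitz_field \<Omega> X"
    and "L1_loc \<Omega> f"
    and "L1_loc \<Omega> h"
    and "upper_gradient \<Omega> X f h"
  shows "\<exists>g. distributional_deriv \<Omega> X f g \<and> (AE x\<in>\<Omega> in lebesgue. \<bar>g x\<bar> \<le> h x)"
proof -
  note \<Omega> = assms(1) and X = assms(2) and ug = assms(5)
  obtain f' where f': "f' \<in> borel_measurable borel" "AE x in lborel. x \<in> \<Omega> \<longrightarrow> f x = f' x"
    "\<And>K. compact K \<Longrightarrow> K \<subseteq> \<Omega> \<Longrightarrow> integrable lborel (\<lambda>x. indicator K x * f' x)"
    by (rule L1_loc_borel_version[OF \<Omega> assms(3)]) (rule that)
  obtain h0 where h0: "h0 \<in> borel_measurable borel" "AE x in lborel. x \<in> \<Omega> \<longrightarrow> h x = h0 x"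
    "\<And>K. compact K \<Longrightarrow> K \<subseteq> \<Omega> \<Longrightarrow> integrable lborel (\<lambda>x. indicator K x * h0 x)"
    by (rule L1_loc_borel_version[OF \<Omega> assms(4)]) (rule that)
  \<comment> \<open>The representative may be negative off \<Omega> or on a null set; the maximum
    with 0 makes [-h', h'] a nonempty range everywhere.\<close>
  define h' where "h' x = max 0 (h0 x)" for x
  have h'm [measurable]: "h' \<in> borel_measurable borel" unfolding h'_def[abs_def] using h0(1) by measurable
  have [measurable]: "f' \<in> borel_measurable borel" by (rule f'(1))
  have h'pos: "0 \<le> h' x" for x by (simp add: h'_def)
  have h'eq: "AE x in lborel. x \<in> \<Omega> \<longrightarrow> h x = h' x"
    using h0(2) by eventually_elim (use ug in \<open>auto simp: upper_gradient_def h'_def\<close>)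
  have h'int: "integrable lborel (\<lambda>x. indicator K x * h' x)" if "compact K" "K \<subseteq> \<Omega>" for K
  proof -
    have [measurable]: "K \<in> sets borel" using that by (simp add: compact_imp_closed)
    show ?thesis
    proof (rule Bochner_Integration.integrable_bound[OF h0(3)[OF that]])
      show "AE x in lborel. norm (indicator K x * h' x) \<le> norm (indicator K x * h0 x)"
        by (intro AE_I2) (auto simp: indicator_def h'_def)
    qed measurable
  qed
  obtain C where C: "\<And>n. compact (C n)" "\<And>n. C n \<subseteq> \<Omega>"
    "\<And>n. C n \<subseteq> interior (C (Suc n))" "\<Union>(range C) = \<Omega>"
    "\<And>K. compact K \<Longrightarrow> K \<subseteq> \<Omega> \<Longrightarrow> \<exists>N. \<forall>n\<ge>N. K \<subseteq> C n"
    by (rule open_Union_compact_subsets[OF \<Omega>]) (rule that)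
  have [measurable]: "C n \<in> sets borel" for n using C(1) by (simp add: compact_imp_closed)
  define T where "T u = - (LINT x:\<Omega>|lebesgue. f x * lie_deriv X u x) - (LINT x:\<Omega>|lebesgue. f x * u x * divergence X x)" for u
  define q where "q t x = (f' (flow \<Omega> X t x) - f' x) / t" for t x
  \<comment> \<open>\<open>s\<close> is a threshold for the set \<open>C n\<close>: measurability
    and convergence concern times below it, while the excess has a further threshold for each
    \<epsilon>.\<close>
  define good where "good n s \<longleftrightarrow> s > 0 \<and>
    (\<forall>t. 0 < t \<longrightarrow> t < s \<longrightarrow> (\<lambda>x. indicator (C n) x * f' (flow \<Omega> X t x)) \<in> borel_measurable borel) \<and>
    (\<forall>u t. test_function \<Omega> u \<longrightarrow> (\<forall>x. x \<notin> C n \<longrightarrow> u x = 0) \<longrightarrow> (\<forall>n. 0 < t n) \<longrightarrow> (\<forall>n. t n < s) \<longrightarrow> t \<longlonglongrightarrow> 0 \<longrightarrow>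
      (\<forall>n. integrable lborel (\<lambda>x. q (t n) x * u x)) \<and> (\<lambda>n. LBINT x. q (t n) x * u x) \<longlonglongrightarrow> T u) \<and>
    (\<forall>\<epsilon>>0. \<exists>\<sigma>>0. AE t in lborel. 0 < t \<and> t < \<sigma> \<longrightarrow>
      (\<integral>\<^sup>+x. indicator (C n) x * ennreal (\<bar>q t x\<bar> - h' x) \<partial>lborel) \<le> ennreal \<epsilon>)" for n s
  have "\<exists>s. good n s" for n
  proof (rule local_flow_difference_quotients[OF \<Omega> X f' h'm h'eq h'pos h'int ug C(1) C(2), of n])
    fix s :: real
    assume s: "s > 0"
      "\<And>t. 0 < t \<Longrightarrow> t < s \<Longrightarrow> (\<lambda>x. indicator (C n) x * f' (flow \<Omega> X t x)) \<in> borel_measurable borel"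
      "\<And>u t. test_function \<Omega> u \<Longrightarrow> (\<And>x. x \<notin> C n \<Longrightarrow> u x = 0) \<Longrightarrow> (\<And>n. 0 < t n) \<Longrightarrow> (\<And>n. t n < s) \<Longrightarrow> t \<longlonglongrightarrow> 0 \<Longrightarrow>
      (\<forall>n. integrable lborel (\<lambda>x. (f' (flow \<Omega> X (t n) x) - f' x) / t n * u x)) \<and>
      (\<lambda>n. LBINT x. (f' (flow \<Omega> X (t n) x) - f' x) / t n * u x) \<longlonglongrightarrow>
        - (LINT x:\<Omega>|lebesgue. f x * lie_deriv X u x) - (LINT x:\<Omega>|lebesgue. f x * u x * divergence X x)"
      "\<And>\<epsilon>. \<epsilon> > 0 \<Longrightarrow> \<exists>\<sigma>>0. AE t in lborel. 0 < t \<and> t < \<sigma> \<longrightarrow>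
      (\<integral>\<^sup>+x. indicator (C n) x * ennreal (\<bar>f' (flow \<Omega> X t x) - f' x\<bar> / t - h' x) \<partial>lborel) \<le> ennreal \<epsilon>"
    have ex: "\<exists>\<sigma>>0. AE t in lborel. 0 < t \<and> t < \<sigma> \<longrightarrow>
      (\<integral>\<^sup>+x. indicator (C n) x * ennreal (\<bar>q t x\<bar> - h' x) \<partial>lborel) \<le> ennreal \<epsilon>" if "\<epsilon> > 0" for \<epsilon>
    proof -
      obtain \<sigma> where \<sigma>: "\<sigma> > 0" "AE t in lborel. 0 < t \<and> t < \<sigma> \<longrightarrow>
        (\<integral>\<^sup>+x. indicator (C n) x * ennreal (\<bar>f' (flow \<Omega> X t x) - f' x\<bar> / t - h' x) \<partial>lborel) \<le> ennreal \<epsilon>"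
        using s(4)[OF \<open>\<epsilon> > 0\<close>] by blast
      have "AE t in lborel. 0 < t \<and> t < \<sigma> \<longrightarrow>
        (\<integral>\<^sup>+x. indicator (C n) x * ennreal (\<bar>q t x\<bar> - h' x) \<partial>lborel) \<le> ennreal \<epsilon>"
        using \<sigma>(2) by eventually_elim (auto simp: q_def abs_divide)
      with \<sigma>(1) show ?thesis by blast
    qed
    have lim: "(\<forall>n. integrable lborel (\<lambda>x. q (t n) x * u x)) \<and> (\<lambda>n. LBINT x. q (t n) x * u x) \<longlonglongrightarrow> T u"
      if "test_function \<Omega> u" "\<forall>x. x \<notin> C n \<longrightarrow> u x = 0" "\<forall>n. 0 < t n" "\<forall>n. t n < s" "t \<longlonglongrightarrow> 0" for u t
      unfolding q_def T_def by (rule s(3)) (use that in auto)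
    have "good n s" unfolding good_def using s(1,2) ex lim by blast
    then show ?thesis ..
  qed
  then obtain s where s: "\<And>n. good n (s n)" by metis
  note s_unfolded = s[unfolded good_def]
  note spos = s_unfolded[THEN conjunct1]
    and s_measurable = s_unfolded[THEN conjunct2, THEN conjunct1, rule_format]
    and s_limit = s_unfolded[THEN conjunct2, THEN conjunct2, THEN conjunct1, rule_format]
    and s_excess = s_unfolded[THEN conjunct2, THEN conjunct2, THEN conjunct2, rule_format]
  \<comment> \<open>Diagonal choice: the n-th time is below the thresholds of all \<open>C m\<close>
    with m <= n, so from index m on the sequence is admissible for \<open>C m\<close>, and its
    excess over \<open>C n\<close> is at most 1/(n+1). The last condition is available only for
    almost every time.\<close>
  define small where "small n t \<longleftrightarrow> 0 < t \<and> t < inverse (real (Suc n)) \<and> (\<forall>m\<le>n. t < s m) \<and>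
      (\<integral>\<^sup>+x. indicator (C n) x * ennreal (\<bar>q t x\<bar> - h' x) \<partial>lborel) \<le> ennreal (inverse (real (Suc n)))" for n t
  have "\<exists>t. small n t" for n
  proof -
    obtain \<sigma> where \<sigma>: "\<sigma> > 0" "AE t in lborel. 0 < t \<and> t < \<sigma> \<longrightarrow>
      (\<integral>\<^sup>+x. indicator (C n) x * ennreal (\<bar>q t x\<bar> - h' x) \<partial>lborel) \<le> ennreal (inverse (real (Suc n)))"
      using s_excess[of "inverse (real (Suc n))" n] by auto
    define m where "m = Min (s ` {..n})"
    have m: "m > 0" "\<And>i. i \<le> n \<Longrightarrow> m \<le> s i" using spos by (auto simp: m_def)
    define \<delta> where "\<delta> = min \<sigma> (min m (inverse (real (Suc n))))"
    have \<delta>: "\<delta> > 0" using \<sigma> m by (simp add: \<delta>_def)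
    have ae: "AE t in lborel. 0 < t \<and> t < \<delta> \<longrightarrow>
      (\<integral>\<^sup>+x. indicator (C n) x * ennreal (\<bar>q t x\<bar> - h' x) \<partial>lborel) \<le> ennreal (inverse (real (Suc n)))"
      using \<sigma>(2) by eventually_elim (simp add: \<delta>_def)
    obtain t where t: "0 < t" "t < \<delta>"
      "(\<integral>\<^sup>+x. indicator (C n) x * ennreal (\<bar>q t x\<bar> - h' x) \<partial>lborel) \<le> ennreal (inverse (real (Suc n)))"
      by (rule AE_interval_witness[OF ae \<delta>]) (rule that)
    have "t < s i" if "i \<le> n" for i using t(2) m(2)[OF that] by (simp add: \<delta>_def)
    then have "small n t" using t unfolding small_def \<delta>_def by simp
    then show ?thesis ..
  qed
  then obtain t where small: "\<And>n. small n (t n)" by metis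
  have t: "\<And>n. 0 < t n" "\<And>n. t n < inverse (real (Suc n))" "\<And>n m. m \<le> n \<Longrightarrow> t n < s m"
    "\<And>n. (\<integral>\<^sup>+x. indicator (C n) x * ennreal (\<bar>q (t n) x\<bar> - h' x) \<partial>lborel) \<le> ennreal (inverse (real (Suc n)))"
    using small unfolding small_def by simp_all
  have t0: "t \<longlonglongrightarrow> 0"
    by (rule tendsto_sandwich[OF _ _ tendsto_const LIMSEQ_inverse_real_of_nat])
      (use t(1,2) in \<open>auto intro!: always_eventually less_imp_le\<close>)
  \<comment> \<open>The indicator restricts the quotient to the set where it is known to be
    measurable, and leaves a function dominated by \<open>h'\<close> on the whole space.\<close>
  define k where "k n x = indicator (C n) x * max (- h' x) (min (h' x) (q (t n) x))" for n x
  have km: "k n \<in> borel_measurable borel" for n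
  proof -
    have [measurable]: "(\<lambda>x. indicator (C n) x * f' (flow \<Omega> X (t n) x)) \<in> borel_measurable borel"
      using t(1)[of n] t(3)[of n n] by (intro s_measurable) auto
    have "k n = (\<lambda>x. indicator (C n) x * max (- h' x) (min (h' x) ((indicator (C n) x * f' (flow \<Omega> X (t n) x) - f' x) / t n)))"
      by (auto simp: k_def q_def indicator_def)
    also have "\<dots> \<in> borel_measurable borel" by measurable
    finally show ?thesis .
  qed
  have kb: "\<bar>k n x\<bar> \<le> h' x" for n x using h'pos[of x] by (auto simp: k_def indicator_def)
  obtain g where g: "g \<in> borel_measurable borel" "\<And>x. \<bar>g x\<bar> \<le> h' x"
    "\<And>u c. u \<in> borel_measurable borel \<Longrightarrow> integrable lborel (\<lambda>x. h' x * u x) \<Longrightarrow>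
      (\<lambda>n. LBINT x. k n x * u x) \<longlonglongrightarrow> c \<Longrightarrow> (LBINT x. g x * u x) = c"
    by (rule weak_limit_dominated[OF km kb h'm]) (rule that)
  have [measurable]: "g \<in> borel_measurable borel" by (rule g(1))
  have gT: "(LINT x:\<Omega>|lebesgue. g x * u x) = T u" if u: "test_function \<Omega> u" for u
  proof -
    obtain L B where LB: "L-lipschitz_on UNIV u" "\<And>x. u differentiable (at x)" "\<And>x. \<bar>u x\<bar> \<le> B"
      by (rule test_function_lipschitz[OF u]) (rule that)
    have B: "B \<ge> 0" using LB(3)[of 0] by linarith
    have um [measurable]: "u \<in> borel_measurable borel"
      by (intro borel_measurable_continuous_onI lipschitz_on_continuous_on[OF LB(1)])
    obtain J where J: "\<And>n. n \<ge> J \<Longrightarrow> closure {x. u x \<noteq> 0} \<subseteq> C n"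
      using C(5)[of "closure {x. u x \<noteq> 0}"] u by (auto simp: test_function_def)
    have u0: "u x = 0" if "x \<notin> C n" "n \<ge> J" for x n
      using J[OF that(2)] closure_subset[of "{x. u x \<noteq> 0}"] that(1) by blast
    have hu: "integrable lborel (\<lambda>x. h' x * u x)"
    proof (rule Bochner_Integration.integrable_bound)
      show "integrable lborel (\<lambda>x. B * (indicator (C J) x * h' x))" using h'int[OF C(1,2)] by simp
      show "AE x in lborel. norm (h' x * u x) \<le> norm (B * (indicator (C J) x * h' x))"
      proof (rule AE_I2)
        fix x show "norm (h' x * u x) \<le> norm (B * (indicator (C J) x * h' x))"
          using mult_right_mono[OF LB(3)[of x] h'pos[of x]] B h'pos[of x] u0[of x J]
          by (cases "x \<in> C J") (auto simp: abs_mult mult.commute)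
      qed
    qed measurable
    \<comment> \<open>The support of \<open>u\<close> lies in \<open>C J\<close>, and from index
      \<open>J\<close> on the times are below the threshold of \<open>C J\<close>; dropping finitely
      many terms does not affect limits.\<close>
    define t' where "t' n = t (n + J)" for n
    have B': "(\<forall>n. integrable lborel (\<lambda>x. q (t' n) x * u x)) \<and> (\<lambda>n. LBINT x. q (t' n) x * u x) \<longlonglongrightarrow> T u"
    proof (rule s_limit[OF u])
      show "t' \<longlonglongrightarrow> 0" unfolding t'_def by (rule LIMSEQ_ignore_initial_segment[OF t0])
      show "u x = 0" if "x \<notin> C J" for x using u0[OF that] by simp
      show "0 < t' n" "t' n < s J" for n using t(1,3) by (simp_all add: t'_def)
    qed
    have near: "\<bar>(LBINT x. k (n + J) x * u x) - (LBINT x. q (t' n) x * u x)\<bar> \<le> B * inverse (real (Suc (n + J)))" for n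
    proof -
      have kint: "integrable lborel (\<lambda>x. k (n + J) x * u x)"
      proof (rule Bochner_Integration.integrable_bound[OF hu])
        show "AE x in lborel. norm (k (n + J) x * u x) \<le> norm (h' x * u x)"
          using kb h'pos by (intro AE_I2) (simp add: abs_mult mult_right_mono)
      qed (use km in measurable)
      have qint: "integrable lborel (\<lambda>x. q (t' n) x * u x)" using B' by blast
      have "ennreal \<bar>LBINT x. k (n + J) x * u x - q (t' n) x * u x\<bar> \<le> (\<integral>\<^sup>+x. ennreal (norm (k (n + J) x * u x - q (t' n) x * u x)) \<partial>lborel)"
        using integral_norm_bound_ennreal[OF Bochner_Integration.integrable_diff[OF kint qint]] by simp
      also have "\<dots> \<le> (\<integral>\<^sup>+x. ennreal B * (indicator (C (n + J)) x * ennreal (\<bar>q (t (n + J)) x\<bar> - h' x)) \<partial>lborel)"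
      proof (rule nn_integral_mono)
        fix x
        show "ennreal (norm (k (n + J) x * u x - q (t' n) x * u x)) \<le> ennreal B * (indicator (C (n + J)) x * ennreal (\<bar>q (t (n + J)) x\<bar> - h' x))"
        proof (cases "x \<in> C (n + J)")
          case True
          \<comment> \<open>Clamping to [-h', h'] moves a value exactly by the positive part of |q|
            - h', which is what the excess estimate integrates.\<close>
          have "\<bar>k (n + J) x - q (t' n) x\<bar> \<le> max 0 (\<bar>q (t (n + J)) x\<bar> - h' x)"
            using True h'pos[of x] by (auto simp: k_def t'_def)
          then have "\<bar>u x\<bar> * \<bar>k (n + J) x - q (t' n) x\<bar> \<le> B * max 0 (\<bar>q (t (n + J)) x\<bar> - h' x)"
            using LB(3)[of x] B by (intro mult_mono) auto
          then have "norm (k (n + J) x * u x - q (t' n) x * u x) \<le> B * max 0 (\<bar>q (t (n + J)) x\<bar> - h' x)"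
            by (simp only: real_norm_def mult.commute[of _ "u x"] right_diff_distrib[symmetric] abs_mult)
          then have "ennreal (norm (k (n + J) x * u x - q (t' n) x * u x)) \<le> ennreal (B * max 0 (\<bar>q (t (n + J)) x\<bar> - h' x))"
            by (rule ennreal_leI)
          also have "\<dots> = ennreal B * ennreal (\<bar>q (t (n + J)) x\<bar> - h' x)"
            using B by (simp add: ennreal_mult max_def ennreal_neg)
          finally show ?thesis using True by simp
        qed (simp add: u0)
      qed
      also have "\<dots> = ennreal B * (\<integral>\<^sup>+x. indicator (C (n + J)) x * ennreal (\<bar>q (t (n + J)) x\<bar> - h' x) \<partial>lborel)"
      proof (rule nn_integral_cmult)
        have [measurable]: "(\<lambda>x. indicator (C (n + J)) x * f' (flow \<Omega> X (t (n + J)) x)) \<in> borel_measurable borel"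
          using t(1)[of "n + J"] t(3)[of "n + J" "n + J"] by (intro s_measurable) auto
        have "(\<lambda>x. indicator (C (n + J)) x * ennreal (\<bar>q (t (n + J)) x\<bar> - h' x)) =
          (\<lambda>x. indicator (C (n + J)) x * ennreal (\<bar>(indicator (C (n + J)) x * f' (flow \<Omega> X (t (n + J)) x) - f' x) / t (n + J)\<bar> - h' x))"
          by (auto simp: q_def indicator_def)
        also have "\<dots> \<in> borel_measurable lborel" by measurable
        finally show "(\<lambda>x. indicator (C (n + J)) x * ennreal (\<bar>q (t (n + J)) x\<bar> - h' x)) \<in> borel_measurable lborel" .
      qed
      also have "\<dots> \<le> ennreal B * ennreal (inverse (real (Suc (n + J))))"
        by (intro mult_left_mono t(4)) simp
      also have "\<dots> = ennreal (B * inverse (real (Suc (n + J))))" using B by (simp add: ennreal_mult)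
      finally have "\<bar>LBINT x. k (n + J) x * u x - q (t' n) x * u x\<bar> \<le> B * inverse (real (Suc (n + J)))"
        using B by (subst (asm) ennreal_le_iff) auto
      then show ?thesis using kint qint by simp
    qed
    have "(\<lambda>n. B * inverse (real (Suc (n + J)))) \<longlonglongrightarrow> B * 0"
      by (intro tendsto_mult tendsto_const LIMSEQ_ignore_initial_segment[OF LIMSEQ_inverse_real_of_nat])
    then have B0: "(\<lambda>n. B * inverse (real (Suc (n + J)))) \<longlonglongrightarrow> 0" by simp
    have "(\<lambda>n. (LBINT x. k (n + J) x * u x) - (LBINT x. q (t' n) x * u x)) \<longlonglongrightarrow> 0"
      by (rule Lim_null_comparison[OF always_eventually B0]) (simp only: real_norm_def near simp_thms)
    from tendsto_add[OF this conjunct2[OF B']]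
    have "(\<lambda>n. LBINT x. k (n + J) x * u x) \<longlonglongrightarrow> T u" by simp
    then have "(\<lambda>n. LBINT x. k n x * u x) \<longlonglongrightarrow> T u" by (rule LIMSEQ_offset[where k = J])
    then have "(LBINT x. g x * u x) = T u" by (rule g(3)[OF um hu])
    moreover have "(LINT x:\<Omega>|lebesgue. g x * u x) = (LBINT x. g x * u x)"
    proof -
      have "indicator \<Omega> x *\<^sub>R (g x * u x) = g x * u x" for x
        using u0[of x J] C(2)[of J] by (cases "x \<in> C J") auto
      then have "(LINT x:\<Omega>|lebesgue. g x * u x) = (\<integral>x. g x * u x \<partial>lebesgue)"
        unfolding set_lebesgue_integral_def by presburger
      also have "\<dots> = (LBINT x. g x * u x)" by (rule integral_completion) measurable
      finally show ?thesis .
    qed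
    ultimately show ?thesis by simp
  qed
  have gL: "L1_loc \<Omega> g"
    unfolding L1_loc_def set_integrable_def
  proof (intro allI impI, elim conjE)
    fix K assume K: "compact K" "K \<subseteq> \<Omega>"
    have [measurable]: "K \<in> sets borel" using K by (simp add: compact_imp_closed)
    have m: "(\<lambda>x. indicator K x * g x) \<in> borel_measurable borel" by measurable
    have "integrable lborel (\<lambda>x. indicator K x * g x)"
    proof (rule Bochner_Integration.integrable_bound[OF h'int[OF K]])
      show "AE x in lborel. norm (indicator K x * g x) \<le> norm (indicator K x * h' x)"
        using g(2) h'pos by (intro AE_I2) (auto simp: indicator_def)
    qed (use m in simp)
    then show "integrable lebesgue (\<lambda>x. indicator K x *\<^sub>R g x)" using m by (simp add: integrable_completion)
  qed
  have "AE x\<in>\<Omega> in lebesgue. \<bar>g x\<bar> \<le> h x"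
    unfolding AE_completion_iff using h'eq 
  proof eventually_elim
    case (elim x)
    then show ?case using g(2)[of x] by simp
  qed
  moreover have "distributional_deriv \<Omega> X f g"
    unfolding distributional_deriv_def using assms(3) gL gT by (simp add: T_def)
  ultimately show ?thesis by blast
qed

end
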